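(* Under the standing hypotheses and with the notation of the context, there exist $k_9\in\mathbb N$ and $\beta>0$, where $\beta$ is a constant for which $$\big\langle\nabla e^{\gamma_k\psi_{\gamma_k}(y)}-\nabla e^{\gamma_k\psi_{\gamma_k}(x)},\,y-x\big\rangle\ge-\frac{4r\beta MM_\psi}{\eta}\|y-x\|^2\quad\forall x,y\in C^{\gamma_k}(k),\ \forall k\ge k_9,$$ such that the following holds. Let $u\in\mathscr U$ and $k\ge k_9$, let $x_{\gamma_k}$ be the solution of $(D_{\gamma_k})$ corresponding to $u$, let $N$ be a positive integer and $h:=T/N$. Then there exists $u^N\in\mathscr U^N$ such that the solution $x^N_{\gamma_k}$ of $(D_{\gamma_k})$ corresponding to $u^N$ satisfies, for $\delta_j:=\|x_{\gamma_k}(jh)-x^N_{\gamma_k}(jh)\|^2$, $$\delta_j\le\frac{2\hat M^2e^{6\bar MT}}{3\bar M}\,(1+6\bar Mh)(1+\bar Mh)\,h,\qquad j=1,\dots,N,$$ where $\bar M:=M+\frac{4r\beta MM_\psi}{\eta}$ and $\hat M:=M+\frac{2M\bar M_\psi}{\eta}$.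
   Context: Data: $T>0$; $f\colon\mathbb R^n\times\mathbb R^m\to\mathbb R^n$; $U\subset\mathbb R^m$ nonempty; $\psi_1,\dots,\psi_r\colon\mathbb R^n\to\mathbb R$; $C_i=\{x:\psi_i(x)\le 0\}$, $C=\bigcap_{i=1}^r C_i$; $x_0\in C$. $\mathscr U$ is the set of measurable $u\colon[0,T]\to\mathbb R^m$ with $u(t)\in U$ a.e. $T_C$ denotes the Clarke tangent cone to $C$. $\|\cdot\|$ is the Euclidean norm. Standing hypotheses. (1) $f$ is continuous on $C\times U$; there is $M>0$ such that $x\mapsto f(x,u)$ is $M$-Lipschitz for all $u\in U$ and $\|f(x,u)\|\le M$ for all $(x,u)\in C\times U$. (2) $f(x,U)$ is convex for all $x\in\mathbb R^n$, and $U$ is compact. (3) $C\ne\emptyset$; each $\psi_i$ is $\mathcal C^{1,1}$ (Fréchet differentiable with locally Lipschitz derivative); each $C_i$ is compact, with connected boundary if $n>1$, and convex if $n=1$; and there is $\eta>0$ such that, with $\mathcal I^0_x=\{i:\psi_i(x)=0\}$, one has $\|\sum_{i\in\mathcal I^0_c}\lambda_i\nabla\psi_i(c)\|>2\eta$ for every $c\in\mathbb R^n$ with $\mathcal I^0_c\neq\emptyset$ and all $\lambda_i\ge0$ with $\sum_{i\in\mathcal I^0_c}\lambda_i=1$. Constants. $\bar M_\psi\ge2\eta$ is a common upper bound on $C$ of $\|\nabla\psi_1\|,\dots,\|\nabla\psi_r\|$; $M_\psi>0$ is such that $2M_\psi$ is a common Lipschitz constant of $\nabla\psi_1,\dots,\nabla\psi_r$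 on the convex hull of $C$. $(\gamma_k)_k$ is a sequence with $\gamma_k>2M/\eta$ for all $k$ and $\gamma_k\to\infty$. Put $\alpha_k=\frac{1}{\gamma_k}\ln\!\big(\frac{\eta\gamma_k}{2M}\big)$, $\sigma_k=\frac{rM_\psi}{2\eta^2}\big(\frac{\ln r}{\gamma_k}+\alpha_k\big)$, $\psi_{\gamma_k}(x)=\frac1{\gamma_k}\ln\big(\sum_{i=1}^re^{\gamma_k\psi_i(x)}\big)$, and $C^{\gamma_k}(k)=\{x\in\mathbb R^n:\psi_{\gamma_k}(x)\le-\alpha_k\}$. If $x_0\in\operatorname{int}C$, set $x_0^k=x_0$ for all $k$. If $x_0\in\operatorname{bdry}C$, set $x_0^k=x_0+\sigma_k\, d_{x_0}/\|d_{x_0}\|$, where $d_{c}=\sum_{j\in\mathcal I^0_{c}}v_j(c)$ and $v_j(c)$ is the projection of $-\nabla\psi_j(c)$ onto $T_C(c)$ (it is known that $d_c\neq0$ for $c\in\operatorname{bdry}C$). $(D_{\gamma_k})$ is the control system $\dot x(t)=f(x(t),u(t))-\sum_{i=1}^r\gamma_k e^{\gamma_k\psi_i(x(t))}\nabla\psi_i(x(t))$ a.e. $t\in[0,T]$, $x(0)=x_0^k$ (equivalently, the penalty term is $\gamma_ke^{\gamma_k\psi_{\gamma_k}(x(t))}\nabla\psi_{\gamma_k}(x(t))$). For a positive integer $N$ and $h=T/N$, $\mathscr U^N$ is the set of piecewise constant controls $u^N$ with $u^N(t)=u^N_j\in U$ for $t\in[(j-1)h,jh)$, $j=1,\dots,N$.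 (For each control and $k$ large, the solution of $(D_{\gamma_k})$ is unique.) *)

theory Defs
  imports "HOL-Analysis.Analysis"
begin

definition gradient :: "('a::real_inner \<Rightarrow> real) \<Rightarrow> 'a \<Rightarrow> 'a" where
  "gradient \<phi> x = (THE D. GDERIV \<phi> x :> D)"

definition C11 :: "('a::euclidean_space \<Rightarrow> real) \<Rightarrow> bool" where
  "C11 \<phi> \<longleftrightarrow> (\<forall>x. \<phi> differentiable (at x)) \<and>
     (\<forall>x. \<exists>e>0. \<exists>L. L-lipschitz_on (ball x e) (gradient \<phi>))"

text \<open>The pairs \<open>(s, t) \<in> P\<close> are the endpoints of finitely many nonoverlapping
  subintervals of \<open>[a, b]\<close>.\<close>

definition abs_continuous_on_interval ::
    "real \<Rightarrow> real \<Rightarrow> (real \<Rightarrow> 'a::real_normed_vector) \<Rightarrow> bool" where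
  "abs_continuous_on_interval a b x \<longleftrightarrow>
     (\<forall>\<epsilon>>0. \<exists>\<delta>>0. \<forall>P. finite P \<longrightarrow>
        (\<forall>(s, t)\<in>P. a \<le> s \<and> s \<le> t \<and> t \<le> b) \<longrightarrow>
        pairwise (\<lambda>p q. {fst p<..<snd p} \<inter> {fst q<..<snd q} = {}) P \<longrightarrow>
        (\<Sum>(s, t)\<in>P. t - s) < \<delta> \<longrightarrow>
        (\<Sum>(s, t)\<in>P. norm (x t - x s)) < \<epsilon>)"

text \<open>The Clarke tangent cone of \<open>S\<close> at a point \<open>x \<in> S\<close>, in its sequential form.\<close>

definition clarke_tangent_cone :: "'a::euclidean_space set \<Rightarrow> 'a \<Rightarrow> 'a set" where
  "clarke_tangent_cone S x =
     {v. \<forall>(y :: nat \<Rightarrow> 'a) (\<tau> :: nat \<Rightarrow> real).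
           (\<forall>i. y i \<in> S) \<and> y \<longlonglongrightarrow> x \<and> (\<forall>i. \<tau> i > 0) \<and> \<tau> \<longlonglongrightarrow> 0 \<longrightarrow>
           (\<exists>w. w \<longlonglongrightarrow> v \<and> (\<forall>i. y i + \<tau> i *\<^sub>R w i \<in> S))}"

text \<open>The constraint functions \<open>\<psi> 1, \<dots>, \<psi> r\<close> are indexed by \<open>{1..r}\<close>; the values of \<open>\<psi>\<close>
  at other indices are irrelevant.\<close>

definition constraint_set :: "nat \<Rightarrow> (nat \<Rightarrow> 'a \<Rightarrow> real) \<Rightarrow> 'a set" where
  "constraint_set r \<psi> = (\<Inter>i\<in>{1..r}. {x. \<psi> i x \<le> 0})"

definition active :: "nat \<Rightarrow> (nat \<Rightarrow> 'a \<Rightarrow> real) \<Rightarrow> 'a \<Rightarrow> nat set" where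
  "active r \<psi> x = {i \<in> {1..r}. \<psi> i x = 0}"

definition psi_gamma :: "nat \<Rightarrow> (nat \<Rightarrow> 'a \<Rightarrow> real) \<Rightarrow> real \<Rightarrow> 'a \<Rightarrow> real" where
  "psi_gamma r \<psi> g x = (1 / g) * ln (\<Sum>i=1..r. exp (g * \<psi> i x))"

definition alpha :: "real \<Rightarrow> real \<Rightarrow> real \<Rightarrow> real" where
  "alpha M \<eta> g = (1 / g) * ln (\<eta> * g / (2 * M))"

definition sigma :: "nat \<Rightarrow> real \<Rightarrow> real \<Rightarrow> real \<Rightarrow> real \<Rightarrow> real" where
  "sigma r M \<eta> M\<psi> g = (real r * M\<psi> / (2 * \<eta>\<^sup>2)) * (ln (real r) / g + alpha M \<eta> g)"

definition C_gamma :: "nat \<Rightarrow> (nat \<Rightarrow> 'a \<Rightarrow> real) \<Rightarrow> real \<Rightarrow> real \<Rightarrow> real \<Rightarrow> 'a set" where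
  "C_gamma r \<psi> M \<eta> g = {x. psi_gamma r \<psi> g x \<le> - alpha M \<eta> g}"

definition inward_dir ::
    "nat \<Rightarrow> (nat \<Rightarrow> 'a::euclidean_space \<Rightarrow> real) \<Rightarrow> 'a \<Rightarrow> 'a" where
  "inward_dir r \<psi> c =
     (\<Sum>j\<in>active r \<psi> c.
        closest_point (clarke_tangent_cone (constraint_set r \<psi>) c) (- gradient (\<psi> j) c))"

text \<open>Intended for \<open>x0\<close> in the constraint set, which is closed, so that outside the frontier
  means in the interior.\<close>

definition initial_point ::
    "nat \<Rightarrow> (nat \<Rightarrow> 'a::euclidean_space \<Rightarrow> real) \<Rightarrow> real \<Rightarrow> real \<Rightarrow> real \<Rightarrow> 'a \<Rightarrow> real \<Rightarrow> 'a" where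
  "initial_point r \<psi> M \<eta> M\<psi> x0 g =
     (if x0 \<in> frontier (constraint_set r \<psi>)
      then x0 + sigma r M \<eta> M\<psi> g *\<^sub>R (inward_dir r \<psi> x0 /\<^sub>R norm (inward_dir r \<psi> x0))
      else x0)"

definition controls :: "real \<Rightarrow> 'b::euclidean_space set \<Rightarrow> (real \<Rightarrow> 'b) set" where
  "controls T U = {u. u \<in> borel_measurable (lebesgue_on {0..T}) \<and>
                      (AE t in lebesgue_on {0..T}. u t \<in> U)}"

definition pc_controls :: "real \<Rightarrow> 'b set \<Rightarrow> nat \<Rightarrow> (real \<Rightarrow> 'b) set" where
  "pc_controls T U N =
     {u. \<forall>j\<in>{1..N}. \<exists>w\<in>U. \<forall>t\<in>{(real j - 1) * (T / N) ..< real j * (T / N)}. u t = w}"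

definition solves ::
    "real \<Rightarrow> ('a::euclidean_space \<times> 'b \<Rightarrow> 'a) \<Rightarrow> nat \<Rightarrow> (nat \<Rightarrow> 'a \<Rightarrow> real) \<Rightarrow> real \<Rightarrow> 'a
       \<Rightarrow> (real \<Rightarrow> 'b) \<Rightarrow> (real \<Rightarrow> 'a) \<Rightarrow> bool" where
  "solves T f r \<psi> g xi u x \<longleftrightarrow>
     abs_continuous_on_interval 0 T x \<and> x 0 = xi \<and>
     (AE t in lebesgue_on {0..T}.
        (x has_vector_derivative
           (f (x t, u t) - (\<Sum>i=1..r. (g * exp (g * \<psi> i (x t))) *\<^sub>R gradient (\<psi> i) (x t))))
          (at t within {0..T}))"

end

theory Submission
  imports Defs
begin

text \<open>The force \<open>G = \<Sum> g exp (g \<psi> i) \<nabla>\<psi> i\<close> of the penalty \<open>E = \<Sum> g exp (g \<psi> i)\<close> is hypomonotone on \<open>C\<close>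
  with a constant proportional to \<open>E\<close>. By compactness and the constraint qualification,
  \<open>norm G \<ge> \<eta> E\<close> on \<open>C\<close> wherever \<open>E \<ge> 2 M / \<eta>\<close> and \<open>g\<close> is large, so trajectories starting in
  \<open>{E < g}\<close> stay there, and along them the time integral of \<open>E\<close> is bounded independently of \<open>g\<close>
  and of the control. The initial points lie in \<open>{E < g}\<close> for large \<open>k\<close>; they need not lie in
  \<open>C_gamma\<close>, which is why the argument rests on the integral of \<open>E\<close> rather than on a pointwise
  velocity bound. On each step the control is replaced by a value whose velocity at the left grid
  point is the average velocity there (the velocity sets are convex). Gronwall's inequality then
  yields a squared error of at most \<open>c h\<close>, with \<open>c\<close> independent of \<open>k\<close>, of \<open>N\<close> and of the
  control. Since the constant of the claim tends to infinity with \<open>\<beta>\<close>, a large \<open>\<beta>\<close> finishes the proof.\<close>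

section \<open>Absolutely continuous functions\<close>

text \<open>The Lipschitz constant of the penalty force may grow with \<open>g\<close>, so a
  two-sided Gronwall estimate cannot be uniform in \<open>k\<close>. For the squared distance of two
  trajectories a one-sided estimate suffices: hypomonotonicity puts \<open>E\<close> itself,
  evaluated along both trajectories, into the Gronwall exponent, and there only its time integral
  matters.

  That integral is controlled through the potential \<open>ln E / g\<close>, which is
  \<open>psi_gamma\<close> up to the additive constant \<open>ln g / g\<close>. Up to a constant
  rate it decreases at least as fast as \<open>\<eta>\<^sup>2 * E\<close>, and its total drop is
  bounded because the \<psi> i are bounded on \<open>C\<close>.

  The same integral bounds the lengths of the trajectories. Freezing the state on a step of length
  \<open>h\<close> costs at most a multiple of \<open>h\<close> times the distance travelled on that
  step, so the costs add up to a multiple of \<open>h\<close> without any pointwise bound on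
  velocities.

  The hypomonotonicity demanded on \<open>C_gamma\<close> only weakens as \<beta> grows and holds
  once \<open>r * \<beta> \<ge> 2\<close>; hence \<beta> can be chosen last, after all constants of
  the error estimate.\<close>

lemma AE_lebesgue_on_negligible_iff:
  fixes S :: "'a::euclidean_space set"
  assumes "S \<in> sets lebesgue"
  shows "(AE t in lebesgue_on S. P t) \<longleftrightarrow> (\<exists>Z. negligible Z \<and> (\<forall>t\<in>S - Z. P t))"
proof -
  have "(AE t in lebesgue_on S. P t) \<longleftrightarrow> (AE t in lebesgue. t \<in> S \<longrightarrow> P t)"
    using assms by (subst AE_restrict_space_iff) auto
  also have "\<dots> \<longleftrightarrow> (\<exists>Z. negligible Z \<and> (\<forall>t\<in>S - Z. P t))"
    unfolding eventually_ae_filter_negligible by (rule ex_cong) auto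
  finally show ?thesis .
qed

lemma abs_continuous_on_interval_subset:
  assumes "abs_continuous_on_interval a b x" "a \<le> c" "d \<le> b"
  shows "abs_continuous_on_interval c d x"
  unfolding abs_continuous_on_interval_def
proof (intro allI impI)
  fix e :: real assume "e > 0"
  with assms(1) obtain \<delta> where "\<delta> > 0" and
    \<delta>: "\<And>P. finite P \<Longrightarrow> (\<forall>(s, t)\<in>P. a \<le> s \<and> s \<le> t \<and> t \<le> b) \<Longrightarrow>
        pairwise (\<lambda>p q. {fst p<..<snd p} \<inter> {fst q<..<snd q} = {}) P \<Longrightarrow>
        (\<Sum>(s, t)\<in>P. t - s) < \<delta> \<Longrightarrow> (\<Sum>(s, t)\<in>P. norm (x t - x s)) < e"
    unfolding abs_continuous_on_interval_def by meson
  show "\<exists>\<delta>>0. \<forall>P. finite P \<longrightarrow>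
        (\<forall>(s, t)\<in>P. c \<le> s \<and> s \<le> t \<and> t \<le> d) \<longrightarrow>
        pairwise (\<lambda>p q. {fst p<..<snd p} \<inter> {fst q<..<snd q} = {}) P \<longrightarrow>
        (\<Sum>(s, t)\<in>P. t - s) < \<delta> \<longrightarrow>
        (\<Sum>(s, t)\<in>P. norm (x t - x s)) < e"
  proof (intro exI[of _ \<delta>] conjI allI impI \<open>\<delta> > 0\<close>)
    fix P :: "(real \<times> real) set"
    assume P: "finite P" "\<forall>(s, t)\<in>P. c \<le> s \<and> s \<le> t \<and> t \<le> d"
      "pairwise (\<lambda>p q. {fst p<..<snd p} \<inter> {fst q<..<snd q} = {}) P" "(\<Sum>(s, t)\<in>P. t - s) < \<delta>"
    have "\<forall>(s, t)\<in>P. a \<le> s \<and> s \<le> t \<and> t \<le> b"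
      using P(2) assms(2,3) by fastforce
    with P \<delta> show "(\<Sum>(s, t)\<in>P. norm (x t - x s)) < e" by blast
  qed
qed

lemma abs_continuous_on_interval_imp_continuous_on:
  assumes "abs_continuous_on_interval a b x"
  shows "continuous_on {a..b} x"
  unfolding continuous_on_iff
proof (intro ballI allI impI)
  fix t e :: real assume t: "t \<in> {a..b}" and "e > 0"
  with assms obtain \<delta> where "\<delta> > 0" and
    \<delta>: "\<And>P. finite P \<Longrightarrow> (\<forall>(s, t)\<in>P. a \<le> s \<and> s \<le> t \<and> t \<le> b) \<Longrightarrow>
        pairwise (\<lambda>p q. {fst p<..<snd p} \<inter> {fst q<..<snd q} = {}) P \<Longrightarrow>
        (\<Sum>(s, t)\<in>P. t - s) < \<delta> \<Longrightarrow> (\<Sum>(s, t)\<in>P. norm (x t - x s)) < e"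
    unfolding abs_continuous_on_interval_def by meson
  have "dist (x s) (x t) < e" if "s \<in> {a..b}" "dist s t < \<delta>" for s
    using \<delta>[of "{(s, t)}"] \<delta>[of "{(t, s)}"] t that
    by (cases "s \<le> t") (auto simp: dist_real_def dist_norm norm_minus_commute)
  with \<open>\<delta> > 0\<close> show "\<exists>d>0. \<forall>s\<in>{a..b}. dist s t < d \<longrightarrow> dist (x s) (x t) < e" by blast
qed

lemma lipschitz_on_imp_abs_continuous_on_interval:
  fixes x :: "real \<Rightarrow> 'a::real_normed_vector"
  assumes "L-lipschitz_on {a..b} x"
  shows "abs_continuous_on_interval a b x"
  unfolding abs_continuous_on_interval_def
proof (intro allI impI)
  fix e :: real assume "e > 0"
  have L: "L \<ge> 0" using assms lipschitz_on_nonneg by blast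
  show "\<exists>\<delta>>0. \<forall>P. finite P \<longrightarrow>
        (\<forall>(s, t)\<in>P. a \<le> s \<and> s \<le> t \<and> t \<le> b) \<longrightarrow>
        pairwise (\<lambda>p q. {fst p<..<snd p} \<inter> {fst q<..<snd q} = {}) P \<longrightarrow>
        (\<Sum>(s, t)\<in>P. t - s) < \<delta> \<longrightarrow>
        (\<Sum>(s, t)\<in>P. norm (x t - x s)) < e"
  proof (intro exI[of _ "e / (L + 1)"] conjI allI impI)
    show "e / (L + 1) > 0" using L \<open>e > 0\<close> by simp
    fix P :: "(real \<times> real) set"
    assume P: "finite P" "\<forall>(s, t)\<in>P. a \<le> s \<and> s \<le> t \<and> t \<le> b" "(\<Sum>(s, t)\<in>P. t - s) < e / (L + 1)"
    have "(\<Sum>(s, t)\<in>P. norm (x t - x s)) \<le> (\<Sum>(s, t)\<in>P. L * (t - s))"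
    proof (intro sum_mono, clarify)
      fix s t assume "(s, t) \<in> P"
      with P(2) have "a \<le> s" "s \<le> t" "t \<le> b" by auto
      then show "norm (x t - x s) \<le> L * (t - s)"
        using lipschitz_on_normD[OF assms, of t s] by auto
    qed
    also have "\<dots> = L * (\<Sum>(s, t)\<in>P. t - s)"
      by (simp add: sum_distrib_left case_prod_unfold)
    also have "\<dots> \<le> L * (e / (L + 1))" using P(3) L by (intro mult_left_mono) auto
    also have "\<dots> < e" using L \<open>e > 0\<close> by (simp add: field_simps)
    finally show "(\<Sum>(s, t)\<in>P. norm (x t - x s)) < e" .
  qed
qed

lemma abs_continuous_on_interval_compose_lipschitz:
  fixes x :: "real \<Rightarrow> 'a::real_normed_vector" and \<phi> :: "'a \<Rightarrow> 'b::real_normed_vector"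
  assumes x: "abs_continuous_on_interval a b x"
    and \<phi>: "L-lipschitz_on (x ` {a..b}) \<phi>"
  shows "abs_continuous_on_interval a b (\<lambda>t. \<phi> (x t))"
  unfolding abs_continuous_on_interval_def
proof (intro allI impI)
  fix e :: real assume "e > 0"
  have L: "L \<ge> 0" using \<phi> lipschitz_on_nonneg by blast
  then have "e / (L + 1) > 0" using \<open>e > 0\<close> by simp
  with x obtain \<delta> where "\<delta> > 0" and
    \<delta>: "\<And>P. finite P \<Longrightarrow> (\<forall>(s, t)\<in>P. a \<le> s \<and> s \<le> t \<and> t \<le> b) \<Longrightarrow>
        pairwise (\<lambda>p q. {fst p<..<snd p} \<inter> {fst q<..<snd q} = {}) P \<Longrightarrow>
        (\<Sum>(s, t)\<in>P. t - s) < \<delta> \<Longrightarrow> (\<Sum>(s, t)\<in>P. norm (x t - x s)) < e / (L + 1)"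
    unfolding abs_continuous_on_interval_def by meson
  show "\<exists>\<delta>>0. \<forall>P. finite P \<longrightarrow>
        (\<forall>(s, t)\<in>P. a \<le> s \<and> s \<le> t \<and> t \<le> b) \<longrightarrow>
        pairwise (\<lambda>p q. {fst p<..<snd p} \<inter> {fst q<..<snd q} = {}) P \<longrightarrow>
        (\<Sum>(s, t)\<in>P. t - s) < \<delta> \<longrightarrow>
        (\<Sum>(s, t)\<in>P. norm (\<phi> (x t) - \<phi> (x s))) < e"
  proof (intro exI[of _ \<delta>] conjI allI impI \<open>\<delta> > 0\<close>)
    fix P :: "(real \<times> real) set"
    assume P: "finite P" "\<forall>(s, t)\<in>P. a \<le> s \<and> s \<le> t \<and> t \<le> b"
      "pairwise (\<lambda>p q. {fst p<..<snd p} \<inter> {fst q<..<snd q} = {}) P" "(\<Sum>(s, t)\<in>P. t - s) < \<delta>"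
    have "(\<Sum>(s, t)\<in>P. norm (\<phi> (x t) - \<phi> (x s))) \<le> (\<Sum>(s, t)\<in>P. L * norm (x t - x s))"
    proof (intro sum_mono, clarify)
      fix s t assume "(s, t) \<in> P"
      with P(2) have "a \<le> s" "s \<le> t" "t \<le> b" by auto
      then show "norm (\<phi> (x t) - \<phi> (x s)) \<le> L * norm (x t - x s)"
        using lipschitz_on_normD[OF \<phi>, of "x t" "x s"] by auto
    qed
    also have "\<dots> = L * (\<Sum>(s, t)\<in>P. norm (x t - x s))"
      by (simp add: sum_distrib_left case_prod_unfold)
    also have "\<dots> \<le> L * (e / (L + 1))" using \<delta>[OF P] L by (intro mult_left_mono) auto
    also have "\<dots> < e" using L \<open>e > 0\<close> by (simp add: field_simps)
    finally show "(\<Sum>(s, t)\<in>P. norm (\<phi> (x t) - \<phi> (x s))) < e" .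
  qed
qed

lemma abs_continuous_on_interval_diff:
  fixes x y :: "real \<Rightarrow> 'a::real_normed_vector"
  assumes x: "abs_continuous_on_interval a b x" and y: "abs_continuous_on_interval a b y"
  shows "abs_continuous_on_interval a b (\<lambda>t. x t - y t)"
  unfolding abs_continuous_on_interval_def
proof (intro allI impI)
  fix e :: real assume "e > 0"
  then have e2: "e / 2 > 0" by simp
  from x e2 obtain \<delta> where "\<delta> > 0" and
    \<delta>: "\<And>P. finite P \<Longrightarrow> (\<forall>(s, t)\<in>P. a \<le> s \<and> s \<le> t \<and> t \<le> b) \<Longrightarrow>
        pairwise (\<lambda>p q. {fst p<..<snd p} \<inter> {fst q<..<snd q} = {}) P \<Longrightarrow>
        (\<Sum>(s, t)\<in>P. t - s) < \<delta> \<Longrightarrow> (\<Sum>(s, t)\<in>P. norm (x t - x s)) < e / 2"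
    unfolding abs_continuous_on_interval_def by meson
  from y e2 obtain \<delta>' where "\<delta>' > 0" and
    \<delta>': "\<And>P. finite P \<Longrightarrow> (\<forall>(s, t)\<in>P. a \<le> s \<and> s \<le> t \<and> t \<le> b) \<Longrightarrow>
        pairwise (\<lambda>p q. {fst p<..<snd p} \<inter> {fst q<..<snd q} = {}) P \<Longrightarrow>
        (\<Sum>(s, t)\<in>P. t - s) < \<delta>' \<Longrightarrow> (\<Sum>(s, t)\<in>P. norm (y t - y s)) < e / 2"
    unfolding abs_continuous_on_interval_def by meson
  show "\<exists>\<delta>>0. \<forall>P. finite P \<longrightarrow>
        (\<forall>(s, t)\<in>P. a \<le> s \<and> s \<le> t \<and> t \<le> b) \<longrightarrow>
        pairwise (\<lambda>p q. {fst p<..<snd p} \<inter> {fst q<..<snd q} = {}) P \<longrightarrow>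
        (\<Sum>(s, t)\<in>P. t - s) < \<delta> \<longrightarrow>
        (\<Sum>(s, t)\<in>P. norm (x t - y t - (x s - y s))) < e"
  proof (intro exI[of _ "min \<delta> \<delta>'"] conjI allI impI)
    show "min \<delta> \<delta>' > 0" using \<open>\<delta> > 0\<close> \<open>\<delta>' > 0\<close> by simp
    fix P :: "(real \<times> real) set"
    assume P: "finite P" "\<forall>(s, t)\<in>P. a \<le> s \<and> s \<le> t \<and> t \<le> b"
      "pairwise (\<lambda>p q. {fst p<..<snd p} \<inter> {fst q<..<snd q} = {}) P" "(\<Sum>(s, t)\<in>P. t - s) < min \<delta> \<delta>'"
    have "(\<Sum>(s, t)\<in>P. norm (x t - y t - (x s - y s)))
        \<le> (\<Sum>(s, t)\<in>P. norm (x t - x s) + norm (y t - y s))"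
    proof (intro sum_mono, clarify)
      fix s t
      show "norm (x t - y t - (x s - y s)) \<le> norm (x t - x s) + norm (y t - y s)"
        using norm_triangle_ineq4[of "x t - x s" "y t - y s"] by (simp add: algebra_simps)
    qed
    also have "\<dots> = (\<Sum>(s, t)\<in>P. norm (x t - x s)) + (\<Sum>(s, t)\<in>P. norm (y t - y s))"
      by (simp add: sum.distrib case_prod_unfold)
    also have "\<dots> < e" using \<delta>[OF P(1-3)] \<delta>'[OF P(1-3)] P(4) by simp
    finally show "(\<Sum>(s, t)\<in>P. norm (x t - y t - (x s - y s))) < e" .
  qed
qed

text \<open>Henstock's argument: intervals tagged in the exceptional null set have small total
  length by the gauge that integrates its indicator to zero, so absolute continuity makes their
  increments negligible; all other tags are controlled by the derivative.\<close>

theorem fundamental_theorem_of_calculus_abs_continuous: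
  fixes x :: "real \<Rightarrow> 'a::banach"
  assumes ab: "a \<le> b" and ac: "abs_continuous_on_interval a b x" and Z: "negligible Z"
    and deriv: "\<And>t. t \<in> {a..b} - Z \<Longrightarrow> (x has_vector_derivative g t) (at t within {a..b})"
  shows "(g has_integral x b - x a) {a..b}"
proof -
  \<comment> \<open>Setting the integrand to 0 on \<open>Z\<close> makes the Riemann summands with
    tags in \<open>Z\<close> vanish, so that only the increments of \<open>x\<close> are left to
    estimate there.\<close>
  define g0 where "g0 t = (if t \<in> Z then 0 else g t)" for t
  have "(g0 has_integral x b - x a) {a..b}"
    unfolding has_integral_real
  proof (intro allI impI)
    fix e :: real assume "e > 0"
    \<comment> \<open>The \<open>+ 1\<close> keeps the denominator positive when
      \<open>a = b\<close>.\<close>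
    define e1 where "e1 = e / (2 * (b - a + 1))"
    have e1: "e1 > 0" using ab \<open>e > 0\<close> by (simp add: e1_def)
    have e1b: "e1 * (b - a) < e / 2"
      using ab \<open>e > 0\<close> by (simp add: e1_def field_simps)
    have "e / 2 > 0" using \<open>e > 0\<close> by simp
    with ac obtain \<delta> where "\<delta> > 0" and
      \<delta>: "\<And>P. finite P \<Longrightarrow> (\<forall>(s, t)\<in>P. a \<le> s \<and> s \<le> t \<and> t \<le> b) \<Longrightarrow>
          pairwise (\<lambda>p q. {fst p<..<snd p} \<inter> {fst q<..<snd q} = {}) P \<Longrightarrow>
          (\<Sum>(s, t)\<in>P. t - s) < \<delta> \<Longrightarrow> (\<Sum>(s, t)\<in>P. norm (x t - x s)) < e / 2"
      unfolding abs_continuous_on_interval_def by meson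
    have "(indicat_real Z has_integral 0) {a..b}"
      using Z unfolding negligible_def by (metis box_real(2))
    with \<open>\<delta> > 0\<close> obtain \<gamma>1 where \<gamma>1: "gauge \<gamma>1"
      "\<And>p. p tagged_division_of {a..b} \<Longrightarrow> \<gamma>1 fine p \<Longrightarrow>
         norm ((\<Sum>(t,K)\<in>p. measure lborel K *\<^sub>R indicat_real Z t) - 0) < \<delta>"
      unfolding has_integral_real by meson
    have "\<exists>d>0. t \<in> {a..b} - Z \<longrightarrow>
           (\<forall>y\<in>{a..b}. norm (y-t) < d \<longrightarrow> norm (x y - x t - (y-t) *\<^sub>R g t) \<le> e1 * norm (y-t))" for t
    proof (cases "t \<in> {a..b} - Z")
      case True
      from deriv[OF True] e1 show ?thesis
        unfolding has_vector_derivative_def has_derivative_within_alt by blast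
    next
      case False
      then show ?thesis using zero_less_one by blast
    qed
    then have "\<forall>t. \<exists>d. d > 0 \<and> (t \<in> {a..b} - Z \<longrightarrow>
           (\<forall>y\<in>{a..b}. norm (y-t) < d \<longrightarrow> norm (x y - x t - (y-t) *\<^sub>R g t) \<le> e1 * norm (y-t)))"
      by blast
    from choice[OF this] obtain d where
      d0: "\<forall>t. d t > 0 \<and> (t \<in> {a..b} - Z \<longrightarrow>
           (\<forall>y\<in>{a..b}. norm (y-t) < d t \<longrightarrow> norm (x y - x t - (y-t) *\<^sub>R g t) \<le> e1 * norm (y-t)))" ..
    have d: "0 < d t"
      "\<lbrakk>t \<in> {a..b} - Z; y \<in> {a..b}; norm (y-t) < d t\<rbrakk>
          \<Longrightarrow> norm (x y - x t - (y-t) *\<^sub>R g t) \<le> e1 * norm (y-t)" for t y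
      using spec[OF d0, of t] by (simp_all only: simp_thms Ball_def)
    show "\<exists>\<gamma>. gauge \<gamma> \<and> (\<forall>p. p tagged_division_of {a..b} \<and> \<gamma> fine p \<longrightarrow>
        norm ((\<Sum>(t,K)\<in>p. measure lborel K *\<^sub>R g0 t) - (x b - x a)) < e)"
    proof (rule exI[of _ "\<lambda>t. \<gamma>1 t \<inter> ball t (d t)"], safe)
      show "gauge (\<lambda>t. \<gamma>1 t \<inter> ball t (d t))"
        by (rule gauge_Int[OF \<gamma>1(1) gauge_ball_dependent]) (use d(1) in simp)
    next
      fix p assume p: "p tagged_division_of {a..b}" and "(\<lambda>t. \<gamma>1 t \<inter> ball t (d t)) fine p"
      then have fine: "\<gamma>1 fine p" "(\<lambda>t. ball t (d t)) fine p" by (simp_all add: fine_Int)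
      have fin: "finite p" using p by blast
      have ivl: "\<exists>u v. K = {u..v} \<and> u \<le> t \<and> t \<le> v \<and> a \<le> u \<and> v \<le> b" if mem: "(t, K) \<in> p" for t K
      proof -
        have tK: "t \<in> K" "K \<subseteq> {a..b}"
          using tagged_division_ofD(2,3)[OF p mem] by auto
        moreover obtain u v where K: "K = cbox u v"
          using tagged_division_ofD(4)[OF p mem] by auto
        ultimately show ?thesis
          by (intro exI[of _ u] exI[of _ v]) (auto simp: )
      qed
      have bnds: "Inf K \<le> Sup K" "a \<le> Inf K" "Sup K \<le> b" if "(t, K) \<in> p" for t K
        using ivl[OF that] by auto
      define q where "q = {(t, K) \<in> p. t \<in> Z}"
      have qp: "q \<subseteq> p" "finite q" using fin by (auto simp: q_def intro: finite_subset)
      have tele: "x b - x a = (\<Sum>(t,K)\<in>p. x (Sup K) - x (Inf K))" "b - a = (\<Sum>(t,K)\<in>p. Sup K - Inf K)"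
        using additive_tagged_division_1[OF ab p, of x] additive_tagged_division_1[OF ab p, of "\<lambda>t. t"]
        by auto
      define h where "h = (\<lambda>(t::real, K::real set). (Inf K, Sup K))"
      have zero: "Inf K = Sup K"
        if "(t, K) \<in> q" "(t', K') \<in> q" "(t, K) \<noteq> (t', K')" "{Inf K<..<Sup K} \<inter> {Inf K'<..<Sup K'} \<noteq> {}" for t K t' K'
      proof -
        have mem: "(t, K) \<in> p" "(t', K') \<in> p" using that qp by auto
        obtain u v where K: "K = {u..v}" "u \<le> v" using ivl[OF mem(1)] by auto
        obtain u' v' where K': "K' = {u'..v'}" "u' \<le> v'" using ivl[OF mem(2)] by auto
        have "interior K \<inter> interior K' = {}"
          using p mem that(3) by (rule tagged_division_ofD(5))
        with that(4) K K' show ?thesis by (auto simp: interior_atLeastAtMost_real)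
      qed
      \<comment> \<open>Absolute continuity speaks of sets of endpoint pairs, whereas
        \<open>q\<close> consists of tagged intervals, and \<open>h\<close> need not be injective on
        it. Two members with the same endpoints are degenerate, because interiors in a division are
        disjoint; degenerate pairs contribute \<open>F (s, s) = 0\<close>.\<close>
      have reindex: "(\<Sum>z\<in>h ` q. F z) = (\<Sum>z\<in>q. F (h z))" if "\<And>s. F (s, s) = 0" for F :: "real \<times> real \<Rightarrow> real"
      proof (subst sum.reindex_nontrivial[OF qp(2)])
        fix z w assume zw: "z \<in> q" "w \<in> q" "z \<noteq> w" "h z = h w"
        obtain t K t' K' where eq: "z = (t, K)" "w = (t', K')" by fastforce
        have "Inf K = Sup K"
        proof (rule ccontr)
          assume "Inf K \<noteq> Sup K"
          moreover have "Inf K \<le> Sup K" using bnds(1)[of t K] zw(1) eq qp by auto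
          ultimately have "Inf K < Sup K" by simp
          moreover have "Inf K' = Inf K" "Sup K' = Sup K" using zw(4) eq by (auto simp: h_def)
          ultimately have "{Inf K<..<Sup K} \<inter> {Inf K'<..<Sup K'} \<noteq> {}" by simp
          then have "Inf K = Sup K" using zero[of t K t' K'] zw eq by auto
          with \<open>Inf K \<noteq> Sup K\<close> show False by simp
        qed
        then show "F (h z) = 0" using that by (simp add: h_def eq)
      qed simp
      have cont: "measure lborel K = Sup K - Inf K" if "(t, K) \<in> p" for t K
        using ivl[OF that] by auto
      have "(\<Sum>(s, t)\<in>h ` q. norm (x t - x s)) < e / 2"
      proof (rule \<delta>)
        show "finite (h ` q)" using qp by simp
        show "\<forall>(s, t)\<in>h ` q. a \<le> s \<and> s \<le> t \<and> t \<le> b"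
        proof (clarsimp simp: h_def)
          fix t K assume "(t, K) \<in> q"
          with qp have "(t, K) \<in> p" by auto
          then show "a \<le> Inf K \<and> Inf K \<le> Sup K \<and> Sup K \<le> b" using bnds by auto
        qed
        show "pairwise (\<lambda>p q. {fst p<..<snd p} \<inter> {fst q<..<snd q} = {}) (h ` q)"
        proof (rule pairwiseI)
          fix P Q assume PQ: "P \<in> h ` q" "Q \<in> h ` q" "P \<noteq> Q"
          then obtain t K t' K' where eq: "(t, K) \<in> q" "(t', K') \<in> q" "P = (Inf K, Sup K)" "Q = (Inf K', Sup K')"
            by (auto simp: h_def)
          then have "(t, K) \<noteq> (t', K')" using PQ by auto
          with zero[OF eq(1,2)] eq show "{fst P<..<snd P} \<inter> {fst Q<..<snd Q} = {}" by fastforce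
        qed
        have "(\<Sum>(s, t)\<in>h ` q. t - s) = (\<Sum>(t, K)\<in>q. Sup K - Inf K)"
          by (subst reindex) (auto simp: h_def case_prod_unfold)
        also have "\<dots> = (\<Sum>(t, K)\<in>q. measure lborel K *\<^sub>R indicat_real Z t)"
          using qp cont by (intro sum.cong) (auto simp: q_def)
        also have "\<dots> = (\<Sum>(t, K)\<in>p. measure lborel K *\<^sub>R indicat_real Z t)"
          using qp fin by (intro sum.mono_neutral_left) (auto simp: q_def indicator_def)
        also have "\<dots> < \<delta>" using \<gamma>1(2)[OF p fine(1)] by simp
        finally show "(\<Sum>(s, t)\<in>h ` q. t - s) < \<delta>" .
      qed
      moreover have "(\<Sum>(s, t)\<in>h ` q. norm (x t - x s)) = (\<Sum>(t, K)\<in>q. norm (x (Sup K) - x (Inf K)))"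
        by (subst reindex) (auto simp: h_def case_prod_unfold)
      ultimately have small: "(\<Sum>(t, K)\<in>q. norm (x (Sup K) - x (Inf K))) < e / 2" by simp
      have good: "norm (measure lborel K *\<^sub>R g0 t - (x (Sup K) - x (Inf K))) \<le> e1 * (Sup K - Inf K)"
        if tK: "(t, K) \<in> p - q" for t K
      proof -
        obtain u v where K: "K = {u..v}" "u \<le> t" "t \<le> v" "a \<le> u" "v \<le> b" using ivl tK by blast
        have tZ: "t \<notin> Z" using tK by (auto simp: q_def)
        have "K \<subseteq> ball t (d t)" using fine(2) tK by (auto dest: fineD)
        moreover have "u \<in> K" "v \<in> K" using K by auto
        ultimately have "u \<in> ball t (d t)" "v \<in> ball t (d t)" by blast+
        then have du: "norm (u - t) < d t" and dv: "norm (v - t) < d t" by (auto simp: dist_real_def)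
        have "norm ((v - u) *\<^sub>R g t - (x v - x u))
            = norm (x u - x t - (u - t) *\<^sub>R g t - (x v - x t - (v - t) *\<^sub>R g t))"
          by (simp add: algebra_simps)
        also have "\<dots> \<le> norm (x u - x t - (u - t) *\<^sub>R g t) + norm (x v - x t - (v - t) *\<^sub>R g t)"
          by (rule norm_triangle_ineq4)
        also have "\<dots> \<le> e1 * norm (u - t) + e1 * norm (v - t)"
          using K tZ du dv by (intro add_mono d) auto
        also have "\<dots> = e1 * (v - u)" using K by (simp add: algebra_simps)
        finally show ?thesis using K tZ by (simp add: g0_def)
      qed
      have "norm ((\<Sum>(t,K)\<in>p. measure lborel K *\<^sub>R g0 t) - (x b - x a))
          = norm (\<Sum>(t,K)\<in>p. measure lborel K *\<^sub>R g0 t - (x (Sup K) - x (Inf K)))"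
        by (simp add: tele(1) sum_subtractf case_prod_unfold)
      also have "\<dots> \<le> (\<Sum>(t,K)\<in>p. norm (measure lborel K *\<^sub>R g0 t - (x (Sup K) - x (Inf K))))"
        by (rule order_trans[OF norm_sum]) (simp add: case_prod_unfold)
      also have "\<dots> = (\<Sum>(t,K)\<in>p - q. norm (measure lborel K *\<^sub>R g0 t - (x (Sup K) - x (Inf K))))
          + (\<Sum>(t,K)\<in>q. norm (measure lborel K *\<^sub>R g0 t - (x (Sup K) - x (Inf K))))"
        by (rule sum.subset_diff[OF qp(1) fin])
      also have "(\<Sum>(t,K)\<in>q. norm (measure lborel K *\<^sub>R g0 t - (x (Sup K) - x (Inf K))))
          = (\<Sum>(t, K)\<in>q. norm (x (Sup K) - x (Inf K)))"
        by (intro sum.cong) (auto simp: q_def g0_def norm_minus_commute)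
      also have "(\<Sum>(t,K)\<in>p - q. norm (measure lborel K *\<^sub>R g0 t - (x (Sup K) - x (Inf K))))
          \<le> (\<Sum>(t,K)\<in>p - q. e1 * (Sup K - Inf K))"
        using good by (intro sum_mono) auto
      also have "\<dots> \<le> (\<Sum>(t,K)\<in>p. e1 * (Sup K - Inf K))"
      proof (intro sum_mono2[OF fin])
        fix z assume "z \<in> p - (p - q)"
        then obtain t K where "z = (t, K)" "(t, K) \<in> p" using qp by (cases z) auto
        then show "0 \<le> (case z of (t, K) \<Rightarrow> e1 * (Sup K - Inf K))"
          using bnds(1)[of t K] e1 by auto
      qed auto
      also have "\<dots> = e1 * (b - a)"
        by (simp add: tele(2) sum_distrib_left case_prod_unfold)
      finally show "norm ((\<Sum>(t,K)\<in>p. measure lborel K *\<^sub>R g0 t) - (x b - x a)) < e"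
        using small e1b by simp
    qed
  qed
  then show ?thesis
    by (rule has_integral_spike[OF Z, rotated]) (simp add: g0_def)
qed

text \<open>This is the comparison principle behind all energy estimates below. Integrability of the
  derivative comes from the fundamental theorem; replacing the derivative by \<open>B\<close> on the
  exceptional set makes the comparison of integrands hold everywhere.\<close>

lemma abs_continuous_increment_le:
  fixes \<phi> :: "real \<Rightarrow> real"
  assumes ab: "a \<le> b" and ac: "abs_continuous_on_interval a b \<phi>" and Z: "negligible Z"
    and deriv: "\<And>t. t \<in> {a..b} - Z \<Longrightarrow> \<exists>d\<le>B t. (\<phi> has_vector_derivative d) (at t within {a..b})"
    and B: "(B has_integral I) {a..b}"
  shows "\<phi> b - \<phi> a \<le> I"
proof -
  obtain d where d: "\<And>t. t \<in> {a..b} - Z \<Longrightarrow> d t \<le> B t \<and> (\<phi> has_vector_derivative d t) (at t within {a..b})"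
    using deriv by metis
  define g where "g t = (if t \<in> Z then B t else d t)" for t
  have "(g has_integral \<phi> b - \<phi> a) {a..b}"
    by (rule fundamental_theorem_of_calculus_abs_continuous[OF ab ac Z]) (use d in \<open>auto simp: g_def\<close>)
  then show ?thesis
    by (rule has_integral_le[OF _ B]) (use d in \<open>auto simp: g_def\<close>)
qed

lemma abs_continuous_norm_increment_le:
  fixes x :: "real \<Rightarrow> 'a::euclidean_space"
  assumes ab: "a \<le> b" and ac: "abs_continuous_on_interval a b x" and Z: "negligible Z"
    and deriv: "\<And>t. t \<in> {a..b} - Z \<Longrightarrow> \<exists>d. norm d \<le> B t \<and> (x has_vector_derivative d) (at t within {a..b})"
    and B: "(B has_integral I) {a..b}" and B0: "\<And>t. t \<in> {a..b} \<Longrightarrow> 0 \<le> B t"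
  shows "norm (x b - x a) \<le> I"
proof -
  obtain d where d: "\<And>t. t \<in> {a..b} - Z \<Longrightarrow> norm (d t) \<le> B t \<and> (x has_vector_derivative d t) (at t within {a..b})"
    using deriv by metis
  define g where "g t = (if t \<in> Z then 0 else d t)" for t
  have g: "(g has_integral x b - x a) {a..b}"
    by (rule fundamental_theorem_of_calculus_abs_continuous[OF ab ac Z]) (use d in \<open>auto simp: g_def\<close>)
  have "norm (integral {a..b} g) \<le> integral {a..b} B"
    by (rule integral_norm_bound_integral)
       (use g B d B0 in \<open>auto simp: g_def integrable_on_def intro: has_integral_integrable\<close>)
  then show ?thesis
    using g B by (simp add: integral_unique)
qed

section \<open>Gronwall inequality and Lipschitz integral equations\<close>

text \<open>The majorant \<open>J\<close> has derivative
  \<open>\<alpha> * D \<le> \<alpha> * J\<close>, so \<open>J * exp (- A)\<close> is nonincreasing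
  and stays below its initial value \<open>c\<close>.\<close>

lemma gronwall_integral:
  fixes D \<alpha> :: "real \<Rightarrow> real"
  assumes D: "continuous_on {a..b} D" and \<alpha>: "continuous_on {a..b} \<alpha>"
    and \<alpha>0: "\<And>t. t \<in> {a..b} \<Longrightarrow> \<alpha> t \<ge> 0"
    and le: "\<And>t. t \<in> {a..b} \<Longrightarrow> D t \<le> c + integral {a..t} (\<lambda>s. \<alpha> s * D s)"
    and t: "t \<in> {a..b}"
  shows "D t \<le> c * exp (integral {a..t} \<alpha>)"
proof -
  define A where "A s = integral {a..s} \<alpha>" for s
  define J where "J s = c + integral {a..s} (\<lambda>s. \<alpha> s * D s)" for s
  have A': "(A has_real_derivative \<alpha> s) (at s within {a..b})" if "s \<in> {a..b}" for s
    unfolding A_def has_real_derivative_iff_has_vector_derivative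
    by (rule integral_has_vector_derivative[OF \<alpha> that])
  have J': "(J has_real_derivative \<alpha> s * D s) (at s within {a..b})" if "s \<in> {a..b}" for s
  proof -
    have "((\<lambda>s. integral {a..s} (\<lambda>s. \<alpha> s * D s)) has_real_derivative \<alpha> s * D s) (at s within {a..b})"
      unfolding has_real_derivative_iff_has_vector_derivative
      by (intro integral_has_vector_derivative[OF _ that] continuous_intros D \<alpha>)
    then show ?thesis unfolding J_def by (auto intro!: derivative_eq_intros)
  qed
  have "((\<lambda>s. exp (- A s) * (\<alpha> s * D s) - exp (- A s) * \<alpha> s * J s)
      has_integral J t * exp (- A t) - J a * exp (- A a)) {a..t}"
  proof (rule fundamental_theorem_of_calculus)
    fix s assume s: "s \<in> {a..t}"
    have "((\<lambda>s. J s * exp (- A s)) has_real_derivative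
        exp (- A s) * (\<alpha> s * D s) - exp (- A s) * \<alpha> s * J s) (at s within {a..b})"
      using s t by (auto intro!: derivative_eq_intros A' J' simp: algebra_simps)
    then show "((\<lambda>s. J s * exp (- A s)) has_vector_derivative
        exp (- A s) * (\<alpha> s * D s) - exp (- A s) * \<alpha> s * J s) (at s within {a..t})"
      unfolding has_real_derivative_iff_has_vector_derivative
      by (rule has_vector_derivative_within_subset) (use t in auto)
  qed (use t in auto)
  moreover have "((\<lambda>s::real. 0::real) has_integral 0) {a..t}" by simp
  ultimately have "J t * exp (- A t) - J a * exp (- A a) \<le> 0"
  proof (rule has_integral_le)
    fix s assume "s \<in> {a..t}"
    then have "s \<in> {a..b}" using t by auto
    then have "exp (- A s) * \<alpha> s * (D s - J s) \<le> 0"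
      using \<alpha>0 le unfolding J_def by (intro mult_nonneg_nonpos) auto
    then show "exp (- A s) * (\<alpha> s * D s) - exp (- A s) * \<alpha> s * J s \<le> 0"
      by (simp add: algebra_simps)
  qed
  then have "J t * exp (- A t) \<le> c" by (simp add: A_def J_def)
  then have "J t \<le> c * exp (A t)" by (simp add: exp_minus field_simps)
  with le[OF t] show ?thesis by (simp add: J_def A_def)
qed

text \<open>Picard iteration on the whole interval at once: the unknown is multiplied by the weight
  \<open>exp (- l * (t - a))\<close>, for which the integral operator contracts with factor
  \<open>L / l \<le> 1/2\<close>. Dependence on time enters only through integrability along
  continuous curves, so right-hand sides that jump in time are covered.\<close>

lemma integral_equation_lipschitz_solution:
  fixes F :: "real \<Rightarrow> 'a::euclidean_space \<Rightarrow> 'a"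
  assumes ab: "a \<le> b"
    and Lip: "\<And>t. t \<in> {a..b} \<Longrightarrow> L-lipschitz_on UNIV (F t)"
    and int: "\<And>x. continuous_on {a..b} x \<Longrightarrow> (\<lambda>s. F s (x s)) integrable_on {a..b}"
  obtains x where "continuous_on {a..b} x"
    "\<And>t. t \<in> {a..b} \<Longrightarrow> x t = \<xi> + integral {a..t} (\<lambda>s. F s (x s))"
proof -
  have L: "L \<ge> 0" using Lip[of a] ab by (auto dest: lipschitz_on_nonneg)
  define l where "l = 2 * L + 1"
  have l: "l > 0" "L / l \<le> 1/2" using L by (auto simp: l_def field_simps)
  define H where "H y r = F r (exp (l * (r - a)) *\<^sub>R apply_bcontfun y r)" for y :: "real \<Rightarrow>\<^sub>C 'a" and r
  define \<Phi>0 where "\<Phi>0 y s = exp (- l * (s - a)) *\<^sub>R (\<xi> + integral {a..s} (H y))" for y s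
  \<comment> \<open>Clamping the argument to \<open>{a..b}\<close> extends functions on the interval
    to bounded continuous functions on the whole line, where Banach's fixed point theorem is
    available as a statement about a complete type.\<close>
  define cl where "cl t = max a (min b t)" for t
  define \<Phi> where "\<Phi> y = Bcontfun (\<lambda>t. \<Phi>0 y (cl t))" for y
  have cl: "cl t \<in> {a..b}" for t using ab by (auto simp: cl_def)
  have H_int: "H y integrable_on {a..b}" for y
    unfolding H_def by (rule int) (intro continuous_intros continuous_on_apply_bcontfun)
  have cont0: "continuous_on {a..b} (\<Phi>0 y)" for y
    unfolding \<Phi>0_def by (intro continuous_intros indefinite_integral_continuous_1 H_int)
  have "(\<lambda>t. \<Phi>0 y (cl t)) \<in> bcontfun" for y
  proof -
    have "continuous_on UNIV (\<lambda>t. \<Phi>0 y (cl t))"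
      by (rule continuous_on_compose2[OF cont0[of y]])
         (use cl in \<open>auto simp: cl_def intro!: continuous_intros\<close>)
    moreover have "bounded (range (\<lambda>t. \<Phi>0 y (cl t)))"
      by (rule bounded_subset[of "\<Phi>0 y ` {a..b}"])
         (use cl in \<open>auto intro!: compact_imp_bounded compact_continuous_image cont0\<close>)
    ultimately show ?thesis by (simp add: bcontfun_def)
  qed
  then have \<Phi>_app: "apply_bcontfun (\<Phi> y) t = \<Phi>0 y (cl t)" for y t
    by (simp add: \<Phi>_def Bcontfun_inverse)
  have "\<forall>y z. dist (\<Phi> y) (\<Phi> z) \<le> 1/2 * dist y z"
  proof (intro allI dist_bound)
    fix y z :: "real \<Rightarrow>\<^sub>C 'a" and t
    define s where "s = cl t"
    have s: "s \<in> {a..b}" using cl by (simp add: s_def)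
    define d where "d = dist y z"
    have Hs: "H y integrable_on {a..s}" "H z integrable_on {a..s}"
      using s by (auto intro!: integrable_on_subinterval[OF H_int])
    have E: "((\<lambda>r. L * d * exp (l * (r - a))) has_integral
        L * d * (exp (l * (s - a)) / l) - L * d * (exp (l * (a - a)) / l)) {a..s}"
      using s l by (intro fundamental_theorem_of_calculus)
         (auto intro!: derivative_eq_intros simp: has_real_derivative_iff_has_vector_derivative[symmetric])
    have "norm (integral {a..s} (\<lambda>r. H y r - H z r)) \<le> integral {a..s} (\<lambda>r. L * d * exp (l * (r - a)))"
    proof (rule integral_norm_bound_integral)
      show "(\<lambda>r. H y r - H z r) integrable_on {a..s}" by (intro integrable_diff Hs)
      show "(\<lambda>r. L * d * exp (l * (r - a))) integrable_on {a..s}" using E by blast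
      fix r assume r: "r \<in> {a..s}"
      have "norm (H y r - H z r) \<le> L * norm (exp (l * (r - a)) *\<^sub>R y r - exp (l * (r - a)) *\<^sub>R z r)"
        unfolding H_def using r s by (intro lipschitz_on_normD[OF Lip]) auto
      also have "\<dots> = L * (exp (l * (r - a)) * dist (y r) (z r))"
        by (simp add: dist_norm flip: scaleR_diff_right)
      also have "\<dots> \<le> L * (exp (l * (r - a)) * d)"
        using L by (intro mult_left_mono) (auto simp: d_def dist_bounded)
      finally show "norm (H y r - H z r) \<le> L * d * exp (l * (r - a))" by (simp add: mult_ac)
    qed
    also have "\<dots> \<le> L * d * (exp (l * (s - a)) / l)"
      unfolding integral_unique[OF E] using L l by (simp add: d_def)
    finally have *: "norm (integral {a..s} (\<lambda>r. H y r - H z r)) \<le> L * d * (exp (l * (s - a)) / l)" .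
    have "dist (\<Phi> y t) (\<Phi> z t) = exp (- l * (s - a)) * norm (integral {a..s} (\<lambda>r. H y r - H z r))"
      using Hs by (simp add: \<Phi>_app flip: s_def)
        (simp add: \<Phi>0_def dist_norm integral_diff flip: scaleR_diff_right)
    also have "\<dots> \<le> exp (- l * (s - a)) * (L * d * (exp (l * (s - a)) / l))"
      by (intro mult_left_mono *) simp
    also have "\<dots> = L / l * d * (exp (- l * (s - a)) * exp (l * (s - a)))" by simp
    also have "\<dots> = L / l * d" by (simp flip: exp_add)
    also have "\<dots> \<le> 1/2 * d" using l by (intro mult_right_mono) (auto simp: d_def)
    finally show "dist (\<Phi> y t) (\<Phi> z t) \<le> 1/2 * dist y z" by (simp add: d_def)
  qed
  then obtain y where y: "\<Phi> y = y"
    using banach_fix_type[of "1/2" \<Phi>] by auto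
  define x where "x t = exp (l * (t - a)) *\<^sub>R apply_bcontfun y t" for t
  show ?thesis
  proof
    show "continuous_on {a..b} x"
      unfolding x_def by (intro continuous_intros continuous_on_apply_bcontfun)
    fix t assume t: "t \<in> {a..b}"
    then have "cl t = t" by (auto simp: cl_def)
    with \<Phi>_app[of y t] y have "apply_bcontfun y t = \<Phi>0 y t" by simp
    moreover have "H y = (\<lambda>s. F s (x s))" by (simp add: H_def x_def fun_eq_iff)
    ultimately show "x t = \<xi> + integral {a..t} (\<lambda>s. F s (x s))"
      by (simp add: x_def \<Phi>0_def flip: exp_add)
  qed
qed

section \<open>Gradients and the penalty\<close>

lemma GDERIV_unique:
  assumes "GDERIV \<phi> x :> D" "GDERIV \<phi> x :> D'"
  shows "D = D'"
proof -
  have "(\<lambda>h. inner h D) = (\<lambda>h. inner h D')"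
    using assms unfolding gderiv_def by (rule has_derivative_unique)
  then have "inner (D - D') D = inner (D - D') D'" by (rule fun_cong)
  then have "inner (D - D') (D - D') = 0" by (simp add: inner_diff_right)
  then show ?thesis by simp
qed

lemma gradient_eqI: "GDERIV \<phi> x :> D \<Longrightarrow> gradient \<phi> x = D"
  unfolding gradient_def by (rule the_equality) (auto intro: GDERIV_unique)

lemma GDERIV_gradient:
  fixes \<phi> :: "'a::euclidean_space \<Rightarrow> real"
  assumes "\<phi> differentiable (at x)"
  shows "GDERIV \<phi> x :> gradient \<phi> x"
proof -
  obtain \<phi>' where \<phi>': "(\<phi> has_derivative \<phi>') (at x)" using assms by (auto simp: differentiable_def)
  \<comment> \<open>The vector \<open>adjoint \<phi>' 1\<close> is the Riesz representer of the
    derivative.\<close>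
  then have "\<phi>' = (\<lambda>h. inner h (adjoint \<phi>' 1))"
    by (auto simp: adjoint_works has_derivative_linear)
  with \<phi>' have "GDERIV \<phi> x :> adjoint \<phi>' 1" by (simp add: gderiv_def)
  with gradient_eqI[OF this] show ?thesis by simp
qed

lemma C11_GDERIV: "C11 \<phi> \<Longrightarrow> GDERIV \<phi> x :> gradient \<phi> x"
  by (simp add: C11_def GDERIV_gradient)

lemma C11_continuous_on_gradient:
  assumes "C11 \<phi>"
  shows "continuous_on S (gradient \<phi>)"
proof (rule continuous_at_imp_continuous_on, rule ballI)
  fix x
  obtain e L where "e > 0" "L-lipschitz_on (ball x e) (gradient \<phi>)"
    using assms unfolding C11_def by blast
  then have "continuous_on (ball x e) (gradient \<phi>)" by (auto intro: lipschitz_on_continuous_on)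
  then show "isCont (gradient \<phi>) x"
    using \<open>e > 0\<close> by (simp add: continuous_on_eq_continuous_at)
qed

lemma GDERIV_isCont: "GDERIV \<phi> x :> D \<Longrightarrow> isCont \<phi> x"
  unfolding gderiv_def by (rule has_derivative_continuous)

lemma GDERIV_sum:
  "finite I \<Longrightarrow> (\<And>i. i \<in> I \<Longrightarrow> GDERIV (\<phi> i) x :> D i) \<Longrightarrow> GDERIV (\<lambda>x. \<Sum>i\<in>I. \<phi> i x) x :> (\<Sum>i\<in>I. D i)"
  unfolding gderiv_def inner_sum_right by (rule has_derivative_sum)

lemma GDERIV_compose_has_vector_derivative:
  assumes "GDERIV \<phi> (x t) :> D" "(x has_vector_derivative d) (at t within S)"
  shows "((\<lambda>t. \<phi> (x t)) has_vector_derivative inner d D) (at t within S)"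
proof -
  have "(\<phi> has_derivative (\<lambda>h. inner h D)) (at (x t) within x ` S)"
    using assms(1) unfolding gderiv_def by (rule has_derivative_at_withinI)
  from diff_chain_within[OF assms(2)[unfolded has_vector_derivative_def] this]
  show ?thesis by (simp add: has_vector_derivative_def o_def mult.commute)
qed

lemma GDERIV_lipschitz_on_convex:
  assumes "convex S" "\<And>x. x \<in> S \<Longrightarrow> GDERIV \<phi> x :> D x" "\<And>x. x \<in> S \<Longrightarrow> norm (D x) \<le> B" "0 \<le> B"
  shows "B-lipschitz_on S \<phi>"
proof (rule bounded_derivative_imp_lipschitz[OF _ assms(1) _ assms(4)])
  fix x assume x: "x \<in> S"
  show "(\<phi> has_derivative (\<lambda>h. inner h (D x))) (at x within S)"
    using assms(2)[OF x] unfolding gderiv_def by (rule has_derivative_at_withinI)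
  show "onorm (\<lambda>h. inner h (D x)) \<le> B"
  proof (rule onorm_bound[OF assms(4)])
    fix h
    have "norm (inner h (D x)) \<le> norm h * norm (D x)" using Cauchy_Schwarz_ineq2 by simp
    also have "\<dots> \<le> norm h * B" using assms(3)[OF x] by (intro mult_left_mono) auto
    finally show "norm (inner h (D x)) \<le> B * norm h" by (simp add: mult.commute)
  qed
qed

text \<open>The set \<open>K\<close>, later the image of a trajectory, need not be convex; a ball
  containing it is, and there the gradient is bounded by compactness.\<close>

lemma C1_lipschitz_on_bounded:
  fixes \<phi> :: "'a::euclidean_space \<Rightarrow> real"
  assumes \<phi>: "\<And>x. GDERIV \<phi> x :> D x" and D: "continuous_on UNIV D" and K: "bounded K"
  obtains L where "L-lipschitz_on K \<phi>"
proof -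
  obtain R where R: "K \<subseteq> cball 0 R" using K by (auto simp: bounded_iff subset_eq)
  have "bounded (D ` cball 0 R)"
    by (intro compact_imp_bounded compact_continuous_image continuous_on_subset[OF D]) auto
  then obtain B where "B > 0" and B': "\<forall>y\<in>D ` cball 0 R. norm y \<le> B"
    unfolding bounded_pos by blast
  have B: "norm (D x) \<le> B" if "x \<in> cball 0 R" for x
    using B' that by blast
  have "B-lipschitz_on (cball 0 R) \<phi>"
    by (rule GDERIV_lipschitz_on_convex[OF convex_cball \<phi> B]) (use \<open>B > 0\<close> in auto)
  from that[OF lipschitz_on_subset[OF this R]] show ?thesis .
qed

definition penalty :: "nat \<Rightarrow> (nat \<Rightarrow> 'a \<Rightarrow> real) \<Rightarrow> real \<Rightarrow> 'a \<Rightarrow> real" where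
  "penalty r \<psi> g x = (\<Sum>i=1..r. g * exp (g * \<psi> i x))"

text \<open>This is the term subtracted in \<open>solves\<close>. It is the gradient of
  \<open>penalty / g\<close>, that is of \<open>exp (g * psi_gamma)\<close>; the gradient of
  \<open>penalty\<close> itself carries one more factor \<open>g\<close>.\<close>

definition penalty_force :: "nat \<Rightarrow> (nat \<Rightarrow> 'a::euclidean_space \<Rightarrow> real) \<Rightarrow> real \<Rightarrow> 'a \<Rightarrow> 'a" where
  "penalty_force r \<psi> g x = (\<Sum>i=1..r. (g * exp (g * \<psi> i x)) *\<^sub>R gradient (\<psi> i) x)"

locale regular_constraints =
  fixes r :: nat and \<psi> :: "nat \<Rightarrow> 'a::euclidean_space \<Rightarrow> real" and \<eta> Mbar\<psi> M\<psi> :: real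
  assumes r_ge_1: "r \<ge> 1"
    and \<psi>_C11: "\<forall>i\<in>{1..r}. C11 (\<psi> i)"
    and \<psi>_compact: "\<forall>i\<in>{1..r}. compact {x. \<psi> i x \<le> 0}"
    and nonempty: "constraint_set r \<psi> \<noteq> {}"
    and \<eta>_pos: "\<eta> > 0"
    and \<psi>_qual: "\<forall>c l. active r \<psi> c \<noteq> {} \<and> (\<forall>i\<in>active r \<psi> c. l i \<ge> 0) \<and>
                    (\<Sum>i\<in>active r \<psi> c. l i) = 1 \<longrightarrow>
                  norm (\<Sum>i\<in>active r \<psi> c. l i *\<^sub>R gradient (\<psi> i) c) > 2 * \<eta>"
    and Mbar\<psi>_ge: "Mbar\<psi> \<ge> 2 * \<eta>"
    and grad_bound: "\<forall>i\<in>{1..r}. \<forall>x\<in>constraint_set r \<psi>. norm (gradient (\<psi> i) x) \<le> Mbar\<psi>"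
    and M\<psi>_pos: "M\<psi> > 0"
    and grad_lip: "\<forall>i\<in>{1..r}. (2 * M\<psi>)-lipschitz_on (convex hull (constraint_set r \<psi>)) (gradient (\<psi> i))"
begin

abbreviation "C \<equiv> constraint_set r \<psi>"
abbreviation "E \<equiv> penalty r \<psi>"
abbreviation "G \<equiv> penalty_force r \<psi>"

lemma mem_C_iff: "x \<in> C \<longleftrightarrow> (\<forall>i\<in>{1..r}. \<psi> i x \<le> 0)"
  by (simp add: constraint_set_def)

lemma GDERIV_\<psi>: "i \<in> {1..r} \<Longrightarrow> GDERIV (\<psi> i) x :> gradient (\<psi> i) x"
  using \<psi>_C11 C11_GDERIV by blast

lemma continuous_on_\<psi>: "i \<in> {1..r} \<Longrightarrow> continuous_on S (\<psi> i)"
  by (intro continuous_at_imp_continuous_on ballI) (rule GDERIV_isCont[OF GDERIV_\<psi>])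

lemma continuous_on_gradient_\<psi>: "i \<in> {1..r} \<Longrightarrow> continuous_on S (gradient (\<psi> i))"
  using \<psi>_C11 C11_continuous_on_gradient by blast

lemma compact_C: "compact C"
proof -
  have "C = {x. \<psi> 1 x \<le> 0} \<inter> (\<Inter>i\<in>{1..r}. {x. \<psi> i x \<le> 0})"
    using r_ge_1 by (auto simp: mem_C_iff)
  moreover have "closed (\<Inter>i\<in>{1..r}. {x. \<psi> i x \<le> 0})"
    using \<psi>_compact by (intro closed_INT) (auto intro: compact_imp_closed)
  ultimately show ?thesis using \<psi>_compact r_ge_1 by (simp add: compact_Int_closed)
qed

lemma Mbar\<psi>_pos: "Mbar\<psi> > 0"
  using Mbar\<psi>_ge \<eta>_pos by linarith

lemma continuous_on_E: "continuous_on S (E g)"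
  unfolding penalty_def by (intro continuous_intros continuous_on_\<psi>)

lemma continuous_on_G: "continuous_on S (G g)"
  unfolding penalty_force_def by (intro continuous_intros continuous_on_\<psi> continuous_on_gradient_\<psi>)

lemma GDERIV_exp_\<psi>:
  assumes "i \<in> {1..r}"
  shows "GDERIV (\<lambda>x. exp (g * \<psi> i x)) x :> (g * exp (g * \<psi> i x)) *\<^sub>R gradient (\<psi> i) x"
proof (rule GDERIV_DERIV_compose[OF GDERIV_\<psi>[OF assms]])
  show "((\<lambda>s. exp (g * s)) has_real_derivative g * exp (g * \<psi> i x)) (at (\<psi> i x))"
    by (auto intro!: derivative_eq_intros)
qed

lemma GDERIV_sum_exp: "GDERIV (\<lambda>x. \<Sum>i=1..r. exp (g * \<psi> i x)) x :> G g x"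
  unfolding penalty_force_def by (rule GDERIV_sum) (auto intro: GDERIV_exp_\<psi>)

lemma E_eq: "E g x = g * (\<Sum>i=1..r. exp (g * \<psi> i x))"
  by (simp add: penalty_def sum_distrib_left)

lemma sum_exp_pos: "(\<Sum>i=1..r. exp (g * \<psi> i x)) > 0"
  using r_ge_1 by (intro sum_pos) auto

lemma E_pos: "g > 0 \<Longrightarrow> E g x > 0"
  unfolding E_eq by (intro mult_pos_pos sum_exp_pos)

lemma GDERIV_E: "GDERIV (E g) x :> g *\<^sub>R G g x"
  unfolding E_eq by (rule GDERIV_DERIV_compose[OF GDERIV_sum_exp]) (auto intro!: derivative_eq_intros)

lemma exp_psi_gamma: "g > 0 \<Longrightarrow> exp (g * psi_gamma r \<psi> g x) = (\<Sum>i=1..r. exp (g * \<psi> i x))"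
  by (simp add: psi_gamma_def sum_exp_pos del: One_nat_def)

lemma gradient_exp_psi_gamma:
  "g > 0 \<Longrightarrow> gradient (\<lambda>x. exp (g * psi_gamma r \<psi> g x)) x = G g x"
  by (intro gradient_eqI) (simp add: exp_psi_gamma GDERIV_sum_exp del: One_nat_def)

lemma exp_le_E:
  assumes "g > 0" "i \<in> {1..r}"
  shows "g * exp (g * \<psi> i x) \<le> E g x"
  unfolding penalty_def using assms by (intro member_le_sum) auto

text \<open>A single violated constraint already makes its own summand exceed \<open>g\<close>.
  Hence a trajectory can be kept in \<open>C\<close> by controlling the one function
  \<open>E\<close> instead of every \<psi> i.\<close>

lemma mem_C_if_E_le:
  assumes "g > 0" "E g x \<le> g"
  shows "x \<in> C"
  unfolding mem_C_iff
proof
  fix i assume "i \<in> {1..r}"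
  from order_trans[OF exp_le_E[OF assms(1) this, of x] assms(2)]
  have "g * exp (g * \<psi> i x) \<le> g * 1" by (simp only: mult_1_right)
  then have "exp (g * \<psi> i x) \<le> 1" using \<open>g > 0\<close> by (rule mult_left_le_imp_le)
  with \<open>g > 0\<close> show "\<psi> i x \<le> 0" by (simp add: mult_le_0_iff)
qed

text \<open>The value \<open>alpha\<close> is chosen such that
  \<open>exp (- g * alpha) = 2 * M / (\<eta> * g)\<close>. So \<open>C_gamma\<close> is the sublevel
  set of \<open>E\<close> at the very level beyond which the penalty force dominates the
  dynamics.\<close>

lemma mem_C_gamma_iff:
  assumes "M > 0" "g > 0"
  shows "x \<in> C_gamma r \<psi> M \<eta> g \<longleftrightarrow> E g x \<le> 2 * M / \<eta>"
proof -
  define S where "S = (\<Sum>i=1..r. exp (g * \<psi> i x))"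
  have S: "S > 0" unfolding S_def by (rule sum_exp_pos)
  have q: "\<eta> * g / (2 * M) > 0" using assms \<eta>_pos by simp
  have "x \<in> C_gamma r \<psi> M \<eta> g \<longleftrightarrow> ln S \<le> - ln (\<eta> * g / (2 * M))"
  proof -
    have "x \<in> C_gamma r \<psi> M \<eta> g \<longleftrightarrow> ln S / g \<le> - ln (\<eta> * g / (2 * M)) / g"
      by (simp add: C_gamma_def psi_gamma_def alpha_def S_def)
    then show ?thesis
      using divide_le_cancel[of "ln S" g "- ln (\<eta> * g / (2 * M))"] assms by simp
  qed
  also have "- ln (\<eta> * g / (2 * M)) = ln (2 * M / (\<eta> * g))"
    using q by (simp flip: ln_inverse)
  also have "ln S \<le> ln (2 * M / (\<eta> * g)) \<longleftrightarrow> S \<le> 2 * M / (\<eta> * g)"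
    using S assms \<eta>_pos by simp
  also have "\<dots> \<longleftrightarrow> E g x \<le> 2 * M / \<eta>"
    using assms \<eta>_pos by (simp add: E_eq S_def field_simps)
  finally show ?thesis .
qed

lemma norm_G_le:
  assumes "g > 0" "x \<in> C"
  shows "norm (G g x) \<le> Mbar\<psi> * E g x"
proof -
  have "norm (G g x) \<le> (\<Sum>i=1..r. norm ((g * exp (g * \<psi> i x)) *\<^sub>R gradient (\<psi> i) x))"
    unfolding penalty_force_def by (rule norm_sum)
  also have "\<dots> \<le> (\<Sum>i=1..r. (g * exp (g * \<psi> i x)) * Mbar\<psi>)"
    using assms grad_bound by (intro sum_mono) (auto simp: abs_mult)
  finally show ?thesis by (simp add: penalty_def sum_distrib_left mult.commute)
qed

lemma \<psi>_mean_value: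
  assumes i: "i \<in> {1..r}"
  obtains t where "0 < t" "t < 1" "\<psi> i (x + h) - \<psi> i x = inner h (gradient (\<psi> i) (x + t *\<^sub>R h))"
proof -
  define \<theta> where "\<theta> t = \<psi> i (x + t *\<^sub>R h)" for t
  have \<theta>': "(\<theta> has_real_derivative inner h (gradient (\<psi> i) (x + t *\<^sub>R h))) (at t)" for t
    unfolding has_real_derivative_iff_has_vector_derivative \<theta>_def
    by (rule GDERIV_compose_has_vector_derivative[OF GDERIV_\<psi>[OF i]])
       (auto intro!: derivative_eq_intros)
  then obtain t where "0 < t" "t < 1"
    and "\<theta> 1 - \<theta> 0 = (1 - 0) * inner h (gradient (\<psi> i) (x + t *\<^sub>R h))"
    using MVT2[of 0 1 \<theta> "\<lambda>t. inner h (gradient (\<psi> i) (x + t *\<^sub>R h))"] by auto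
  then show ?thesis using that by (simp add: \<theta>_def)
qed

text \<open>A first-order expansion in which the gradient may be taken at either endpoint; the
  hypomonotonicity estimate uses both versions. The intermediate point lies on the segment, possibly
  outside \<open>C\<close>, which is why the Lipschitz bound on the convex hull enters.\<close>

lemma \<psi>_increment:
  assumes i: "i \<in> {1..r}" and xy: "x \<in> C" "y \<in> C" and z: "z \<in> {x, y}"
  shows "\<bar>\<psi> i y - \<psi> i x - inner (y - x) (gradient (\<psi> i) z)\<bar> \<le> 2 * M\<psi> * (norm (y - x))\<^sup>2"
proof -
  obtain t where t: "0 < t" "t < 1"
    and eq: "\<psi> i y - \<psi> i x = inner (y - x) (gradient (\<psi> i) (x + t *\<^sub>R (y - x)))"
    using \<psi>_mean_value[OF i, of x "y - x"] by auto
  define w where "w = x + t *\<^sub>R (y - x)"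
  have w: "w \<in> convex hull C"
  proof -
    have "w = (1 - t) *\<^sub>R x + t *\<^sub>R y" by (simp add: w_def algebra_simps)
    also have "\<dots> \<in> convex hull C"
      using xy t by (intro convexD[OF convex_convex_hull]) (auto intro: hull_inc)
    finally show ?thesis .
  qed
  have zC: "z \<in> convex hull C" using xy z by (auto intro: hull_inc)
  have "norm (w - z) \<le> norm (y - x)"
  proof (cases "z = x")
    case True
    then show ?thesis using t by (simp add: w_def mult_left_le_one_le)
  next
    case False
    then have "w - z = (t - 1) *\<^sub>R (y - x)" using z by (simp add: w_def algebra_simps)
    then show ?thesis using t by (simp add: mult_left_le_one_le)
  qed
  then have "2 * M\<psi> * norm (w - z) \<le> 2 * M\<psi> * norm (y - x)"
    using M\<psi>_pos by (intro mult_left_mono) auto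
  moreover have "norm (gradient (\<psi> i) w - gradient (\<psi> i) z) \<le> 2 * M\<psi> * norm (w - z)"
    using grad_lip i w zC by (intro lipschitz_on_normD) auto
  ultimately have "norm (gradient (\<psi> i) w - gradient (\<psi> i) z) \<le> 2 * M\<psi> * norm (y - x)"
    by linarith
  then have "norm (y - x) * norm (gradient (\<psi> i) w - gradient (\<psi> i) z) \<le> norm (y - x) * (2 * M\<psi> * norm (y - x))"
    by (intro mult_left_mono) auto
  moreover have "\<psi> i y - \<psi> i x - inner (y - x) (gradient (\<psi> i) z)
      = inner (y - x) (gradient (\<psi> i) w - gradient (\<psi> i) z)"
    by (simp add: eq w_def inner_diff_right)
  ultimately show ?thesis
    using Cauchy_Schwarz_ineq2[of "y - x" "gradient (\<psi> i) w - gradient (\<psi> i) z"]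
    by (simp add: power2_eq_square mult_ac)
qed

text \<open>No convexity of \<open>C\<close> is available, so the segment from \<open>x\<close> to \<open>y\<close> may leave \<open>C\<close>, where the
  penalty is huge. Only the \<open>\<psi> i\<close> are expanded along the segment; the exponential weights enter
  through their values at the two endpoints and monotonicity.\<close>

lemma penalty_force_hypomonotone:
  assumes g: "g > 0" and xy: "x \<in> C" "y \<in> C"
  shows "inner (G g y - G g x) (y - x) \<ge> - (2 * M\<psi> * (E g x + E g y)) * (norm (y - x))\<^sup>2"
proof -
  define n where "n = 2 * M\<psi> * (norm (y - x))\<^sup>2"
  have "- ((g * exp (g * \<psi> i x) + g * exp (g * \<psi> i y)) * n)
      \<le> (g * exp (g * \<psi> i y)) * inner (gradient (\<psi> i) y) (y - x)
        - (g * exp (g * \<psi> i x)) * inner (gradient (\<psi> i) x) (y - x)" if i: "i \<in> {1..r}" for i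
  proof -
    define p q where "p = g * exp (g * \<psi> i x)" and "q = g * exp (g * \<psi> i y)"
    define d where "d = \<psi> i y - \<psi> i x"
    have pq: "p > 0" "q > 0" using g by (auto simp: p_def q_def)
    have 1: "inner (gradient (\<psi> i) y) (y - x) \<ge> d - n"
      using \<psi>_increment[OF i xy, of y] by (simp add: d_def n_def inner_commute)
    have 2: "inner (gradient (\<psi> i) x) (y - x) \<le> d + n"
      using \<psi>_increment[OF i xy, of x] by (simp add: d_def n_def inner_commute)
    have 3: "(q - p) * d \<ge> 0"
    proof (cases "d \<ge> 0")
      case True
      then have "q \<ge> p" using g by (simp add: p_def q_def d_def)
      with True show ?thesis by simp
    next
      case False
      then have "q \<le> p" using g by (simp add: p_def q_def d_def)
      with False show ?thesis by (simp add: mult_nonpos_nonpos)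
    qed
    have "q * inner (gradient (\<psi> i) y) (y - x) \<ge> q * (d - n)" "p * inner (gradient (\<psi> i) x) (y - x) \<le> p * (d + n)"
      using 1 2 pq by (auto intro: mult_left_mono)
    with 3 show ?thesis unfolding p_def[symmetric] q_def[symmetric] by (simp add: algebra_simps)
  qed
  then have "(\<Sum>i=1..r. - ((g * exp (g * \<psi> i x) + g * exp (g * \<psi> i y)) * n))
      \<le> (\<Sum>i=1..r. (g * exp (g * \<psi> i y)) * inner (gradient (\<psi> i) y) (y - x)
        - (g * exp (g * \<psi> i x)) * inner (gradient (\<psi> i) x) (y - x))"
    by (rule sum_mono)
  also have "\<dots> = inner (G g y - G g x) (y - x)"
    by (simp add: penalty_force_def inner_diff_left inner_sum_left sum_subtractf)
  also have "(\<Sum>i=1..r. - ((g * exp (g * \<psi> i x) + g * exp (g * \<psi> i y)) * n)) = - ((E g x + E g y) * n)"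
    by (simp add: penalty_def sum_negf sum.distrib flip: sum_distrib_right)
  finally show ?thesis by (simp add: n_def algebra_simps)
qed

end

section \<open>The constraint qualification and the lower bound for the penalty force\<close>

lemma mem_convex_hull_finite_imageD:
  assumes "finite A" "y \<in> convex hull (f ` A)"
  shows "\<exists>l. (\<forall>i\<in>A. l i \<ge> 0) \<and> sum l A = 1 \<and> y = (\<Sum>i\<in>A. l i *\<^sub>R f i)"
proof -
  \<comment> \<open>Different indices may have the same image, while a convex hull only provides
    weights on points. One index is kept for each point, and the others receive weight 0.\<close>
  obtain A' where A': "A' \<subseteq> A" "inj_on f A'" "f ` A = f ` A'"
    using subset_image_inj[of "f ` A" f A] by auto
  obtain u where u: "\<forall>x\<in>f ` A'. 0 \<le> u x" "sum u (f ` A') = 1" "(\<Sum>x\<in>f ` A'. u x *\<^sub>R x) = y"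
  proof -
    have "finite (f ` A')" using assms(1) A'(1) finite_subset by blast
    then have "y \<in> {y. \<exists>u. (\<forall>x\<in>f ` A'. 0 \<le> u x) \<and> sum u (f ` A') = 1 \<and> (\<Sum>x\<in>f ` A'. u x *\<^sub>R x) = y}"
      using assms(2) unfolding A'(3) by (simp only: convex_hull_finite)
    then show ?thesis using that by blast
  qed
  define l where "l i = (if i \<in> A' then u (f i) else 0)" for i
  have "sum l A = sum l A'"
    using assms(1) A'(1) by (intro sum.mono_neutral_right) (auto simp: l_def)
  also have "\<dots> = 1" using u(2) A'(2) by (simp add: sum.reindex l_def)
  finally have "sum l A = 1" .
  moreover have "(\<Sum>i\<in>A. l i *\<^sub>R f i) = (\<Sum>i\<in>A'. l i *\<^sub>R f i)"
    using assms(1) A'(1) by (intro sum.mono_neutral_right) (auto simp: l_def)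
  then have "(\<Sum>i\<in>A. l i *\<^sub>R f i) = y"
    using u(3) A'(2) by (simp add: sum.reindex l_def)
  ultimately show ?thesis
    using u(1) by (intro exI[of _ l]) (auto simp: l_def)
qed

context regular_constraints
begin

lemma finite_active [simp]: "finite (active r \<psi> c)"
  by (simp add: active_def)

lemma active_subset: "i \<in> active r \<psi> c \<Longrightarrow> i \<in> {1..r}"
  by (simp add: active_def)

text \<open>Both sides are homogeneous in the coefficients, so the qualification condition, stated
  for coefficients of sum 1, extends to all nonnegative ones. The inequality becomes weak because
  the sum may vanish.\<close>

lemma norm_active_combination_ge:
  assumes "\<And>i. i \<in> active r \<psi> c \<Longrightarrow> e i \<ge> 0"
  shows "norm (\<Sum>i\<in>active r \<psi> c. e i *\<^sub>R gradient (\<psi> i) c) \<ge> 2 * \<eta> * (\<Sum>i\<in>active r \<psi> c. e i)"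
proof (cases "(\<Sum>i\<in>active r \<psi> c. e i) = 0")
  case False
  define S where "S = (\<Sum>i\<in>active r \<psi> c. e i)"
  have "S \<ge> 0" unfolding S_def using assms by (intro sum_nonneg) auto
  with False have S: "S > 0" by (simp add: S_def)
  have "active r \<psi> c \<noteq> {}" using False by auto
  moreover have "(\<Sum>i\<in>active r \<psi> c. e i / S) = 1"
    using S by (simp add: S_def flip: sum_divide_distrib)
  ultimately have "norm (\<Sum>i\<in>active r \<psi> c. (e i / S) *\<^sub>R gradient (\<psi> i) c) > 2 * \<eta>"
    using \<psi>_qual assms S by simp
  moreover have "(\<Sum>i\<in>active r \<psi> c. e i *\<^sub>R gradient (\<psi> i) c)
      = S *\<^sub>R (\<Sum>i\<in>active r \<psi> c. (e i / S) *\<^sub>R gradient (\<psi> i) c)"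
    using S by (simp add: scaleR_sum_right)
  ultimately show ?thesis using S by (simp add: S_def[symmetric] mult.commute)
qed simp

text \<open>Counterexamples for ever larger \<open>g\<close> have base points accumulating at some
  \<open>c\<close> in \<open>C\<close>. Near \<open>c\<close> the constraints inactive at
  \<open>c\<close> carry vanishing weight and the other gradients are close to their values at
  \<open>c\<close>, so the qualification condition at \<open>c\<close>, with its constant
  \<open>2 * \<eta>\<close>, leaves room for the perturbations.\<close>

lemma norm_penalty_force_ge:
  assumes m: "m > 0"
  obtains g0 where "\<And>g x. g \<ge> g0 \<Longrightarrow> x \<in> C \<Longrightarrow> E g x \<ge> m \<Longrightarrow> norm (G g x) \<ge> \<eta> * E g x"
proof (rule ccontr)
  assume "\<not> thesis"
  then have "\<exists>g x. g \<ge> g0 \<and> x \<in> C \<and> E g x \<ge> m \<and> norm (G g x) < \<eta> * E g x" for g0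
    using that[of g0] by (meson not_le)
  then have "\<forall>n. \<exists>p. fst p \<ge> real (Suc n) \<and> snd p \<in> C \<and> E (fst p) (snd p) \<ge> m \<and>
      norm (G (fst p) (snd p)) < \<eta> * E (fst p) (snd p)"
    by (metis fst_conv snd_conv)
  then obtain p where p: "\<And>n. fst (p n) \<ge> real (Suc n)" "\<And>n. snd (p n) \<in> C"
    "\<And>n. E (fst (p n)) (snd (p n)) \<ge> m"
    "\<And>n. norm (G (fst (p n)) (snd (p n))) < \<eta> * E (fst (p n)) (snd (p n))"
    by metis
  obtain c \<rho> where c: "c \<in> C" "strict_mono (\<rho> :: nat \<Rightarrow> nat)" "((\<lambda>n. snd (p n)) \<circ> \<rho>) \<longlonglongrightarrow> c"
    using compact_C p(2) unfolding compact_def by metis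
  define g where "g n = fst (p (\<rho> n))" for n
  define x where "x n = snd (p (\<rho> n))" for n
  have x: "x \<longlonglongrightarrow> c" "\<And>n. x n \<in> C" using c p by (auto simp: x_def[abs_def] o_def)
  have g_ge: "g n \<ge> real (Suc n)" for n
    using p(1)[of "\<rho> n"] seq_suble[OF c(2), of n] by (simp add: g_def)
  have g_pos: "g n > 0" for n using g_ge[of n] by (simp add: order.strict_trans2[of 0 "real (Suc n)"])
  have g_lim: "filterlim g at_top sequentially"
    by (rule filterlim_at_top_mono[OF filterlim_compose[OF filterlim_real_sequentially filterlim_Suc]])
       (use g_ge in auto)
  define A where "A = active r \<psi> c"
  define I where "I = {1..r} - A"
  define e where "e n i = g n * exp (g n * \<psi> i (x n))" for n i
  have e0: "e n i > 0" for n i using g_pos by (simp add: e_def)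
  have A: "A \<subseteq> {1..r}" "finite A" "finite I" by (auto simp: A_def I_def active_def)
  \<comment> \<open>Chosen such that
    \<open>r * \<epsilon> * (2 * \<eta> + Mbar\<psi>) = \<eta> / 4\<close>, the share of the error
    granted to the inactive constraints.\<close>
  define \<epsilon> where "\<epsilon> = \<eta> / (4 * real r * (2 * \<eta> + Mbar\<psi>))"
  have \<epsilon>: "\<epsilon> > 0" using \<eta>_pos Mbar\<psi>_pos r_ge_1 by (simp add: \<epsilon>_def)
  have ev1: "\<forall>\<^sub>F n in sequentially. \<forall>i\<in>{1..r}. norm (gradient (\<psi> i) (x n) - gradient (\<psi> i) c) \<le> \<eta> / 4"
  proof (intro eventually_ball_finite ballI)
    fix i assume "i \<in> {1..r}"
    then have "isCont (gradient (\<psi> i)) c"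
      using continuous_on_gradient_\<psi>[of i UNIV] by (simp add: continuous_on_eq_continuous_at)
    then have "(\<lambda>n. gradient (\<psi> i) (x n)) \<longlonglongrightarrow> gradient (\<psi> i) c"
      using x(1) by (rule isCont_tendsto_compose)
    from tendstoD[OF this, of "\<eta> / 4"] \<eta>_pos
    show "\<forall>\<^sub>F n in sequentially. norm (gradient (\<psi> i) (x n) - gradient (\<psi> i) c) \<le> \<eta> / 4"
      by (auto simp: dist_norm elim!: eventually_mono)
  qed simp
  \<comment> \<open>The inactive weights tend to 0 in absolute terms, since
    \<open>g * exp (- d * g)\<close> does. The lower bound \<open>m\<close> on \<open>E\<close>
    turns this into smallness relative to \<open>E\<close>.\<close>
  have ev2: "\<forall>\<^sub>F n in sequentially. \<forall>i\<in>I. e n i \<le> \<epsilon> * m"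
  proof (intro eventually_ball_finite ballI A)
    fix i assume i: "i \<in> I"
    then have "\<psi> i c < 0" using c(1) by (auto simp: I_def A_def active_def mem_C_iff less_le)
    define d where "d = - \<psi> i c / 2"
    have d: "d > 0" using \<open>\<psi> i c < 0\<close> by (simp add: d_def)
    have "isCont (\<psi> i) c" using i by (intro GDERIV_isCont[OF GDERIV_\<psi>]) (simp add: I_def)
    then have "(\<lambda>n. \<psi> i (x n)) \<longlonglongrightarrow> \<psi> i c" using x(1) by (rule isCont_tendsto_compose)
    then have "\<forall>\<^sub>F n in sequentially. \<psi> i (x n) < - d"
      by (rule order_tendstoD) (use d in \<open>simp add: d_def\<close>)
    moreover have "filterlim (\<lambda>n. d * g n) at_top sequentially"
      using g_lim d by (intro filterlim_tendsto_pos_mult_at_top[OF tendsto_const]) auto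
    then have "(\<lambda>n. (d * g n) ^ 1 / exp (d * g n)) \<longlonglongrightarrow> 0"
      by (rule filterlim_compose[OF tendsto_power_div_exp_0])
    then have "\<forall>\<^sub>F n in sequentially. (d * g n) ^ 1 / exp (d * g n) < \<epsilon> * m * d"
      by (rule order_tendstoD) (use \<epsilon> m d in auto)
    ultimately show "\<forall>\<^sub>F n in sequentially. e n i \<le> \<epsilon> * m"
    proof eventually_elim
      case (elim n)
      have "g n * \<psi> i (x n) \<le> g n * (- d)" using elim(1) g_pos[of n] by (intro mult_left_mono) auto
      then have "e n i \<le> g n * exp (- (d * g n))"
        using g_pos[of n] by (simp add: e_def mult.commute)
      moreover have "d * (g n * exp (- (d * g n))) < d * (\<epsilon> * m)"
        using elim(2) by (simp add: exp_minus field_simps)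
      ultimately show ?case using d by simp
    qed
  qed
  obtain n where n1: "\<And>i. i \<in> {1..r} \<Longrightarrow> norm (gradient (\<psi> i) (x n) - gradient (\<psi> i) c) \<le> \<eta> / 4"
    and n2: "\<And>i. i \<in> I \<Longrightarrow> e n i \<le> \<epsilon> * m"
  proof -
    from eventually_happens'[OF sequentially_bot eventually_conj[OF ev1 ev2]] obtain n where
      "\<forall>i\<in>{1..r}. norm (gradient (\<psi> i) (x n) - gradient (\<psi> i) c) \<le> \<eta> / 4" "\<forall>i\<in>I. e n i \<le> \<epsilon> * m"
      by blast
    then show ?thesis by (intro that) blast+
  qed
  define En where "En = E (g n) (x n)"
  have En: "En \<ge> m" "norm (G (g n) (x n)) < \<eta> * En" using p by (auto simp: En_def g_def x_def)
  define SA SI where "SA = (\<Sum>i\<in>A. e n i)" and "SI = (\<Sum>i\<in>I. e n i)"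
  have disj: "{1..r} = A \<union> I" "A \<inter> I = {}" using A by (auto simp: I_def)
  have sumE: "En = SA + SI"
    unfolding En_def penalty_def disj(1) SA_def SI_def e_def using A disj by (intro sum.union_disjoint)
  have "SI \<le> (\<Sum>i\<in>I. \<epsilon> * En)"
    unfolding SI_def using n2 En(1) \<epsilon> by (intro sum_mono) (smt (verit) mult_left_mono)
  also have "\<dots> = real (card I) * (\<epsilon> * En)" by simp
  also have "\<dots> \<le> real r * (\<epsilon> * En)"
  proof -
    have "card I \<le> card {1..r}" by (intro card_mono) (auto simp: I_def)
    then show ?thesis using \<epsilon> En(1) m by (intro mult_right_mono) auto
  qed
  finally have SI: "SI \<le> real r * (\<epsilon> * En)" .
  have SA0: "SA \<ge> 0" unfolding SA_def using e0 by (intro sum_nonneg) (auto intro: less_imp_le)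
  have SI0: "SI \<ge> 0" unfolding SI_def using e0 by (intro sum_nonneg) (auto intro: less_imp_le)
  have Geq: "G (g n) (x n) = (\<Sum>i\<in>A. e n i *\<^sub>R gradient (\<psi> i) c)
      + (\<Sum>i\<in>A. e n i *\<^sub>R (gradient (\<psi> i) (x n) - gradient (\<psi> i) c)) + (\<Sum>i\<in>I. e n i *\<^sub>R gradient (\<psi> i) (x n))"
    (is "_ = ?P + ?Q + ?R")
  proof -
    have "G (g n) (x n) = (\<Sum>i\<in>A. e n i *\<^sub>R gradient (\<psi> i) (x n)) + ?R"
      unfolding penalty_force_def disj(1) e_def using A disj by (intro sum.union_disjoint)
    then show ?thesis by (simp add: scaleR_diff_right sum_subtractf)
  qed
  have P: "norm ?P \<ge> 2 * \<eta> * SA"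
    unfolding A_def SA_def using e0 by (intro norm_active_combination_ge) (auto intro: less_imp_le)
  have "norm ?Q \<le> (\<Sum>i\<in>A. norm (e n i *\<^sub>R (gradient (\<psi> i) (x n) - gradient (\<psi> i) c)))" by (rule norm_sum)
  also have "\<dots> \<le> (\<Sum>i\<in>A. e n i * (\<eta> / 4))"
    using n1 A(1) e0 by (intro sum_mono) (auto intro!: mult_left_mono simp: less_imp_le)
  finally have Q: "norm ?Q \<le> SA * (\<eta> / 4)" by (simp add: SA_def sum_distrib_right sum_divide_distrib)
  have "norm ?R \<le> (\<Sum>i\<in>I. norm (e n i *\<^sub>R gradient (\<psi> i) (x n)))" by (rule norm_sum)
  also have "\<dots> \<le> (\<Sum>i\<in>I. e n i * Mbar\<psi>)"
    using grad_bound x(2) e0 by (intro sum_mono) (auto intro!: mult_left_mono simp: less_imp_le I_def)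
  finally have R: "norm ?R \<le> SI * Mbar\<psi>" by (simp add: SI_def sum_distrib_right)
  have "norm ?P \<le> norm (?P + ?Q + ?R) + norm ?Q + norm ?R"
    using norm_triangle_ineq4[of "?P + ?Q + ?R" "?Q + ?R"] norm_triangle_ineq[of ?Q ?R]
    by (simp add: algebra_simps)
  then have "2 * \<eta> * SA \<le> \<eta> * En + SA * (\<eta> / 4) + SI * Mbar\<psi>"
    using P Q R En(2)[unfolded Geq] by linarith
  \<comment> \<open>Adding \<open>2 * \<eta> * SI\<close> to both sides completes \<open>SA\<close>
    to \<open>En\<close>. The right-hand side will turn out to be at most
    \<open>(3/2) * \<eta> * En\<close>.\<close>
  then have "2 * \<eta> * En \<le> \<eta> * En + SA * (\<eta> / 4) + SI * (2 * \<eta> + Mbar\<psi>)"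
    unfolding sumE by (simp add: algebra_simps)
  also have "SI * (2 * \<eta> + Mbar\<psi>) \<le> real r * (\<epsilon> * En) * (2 * \<eta> + Mbar\<psi>)"
    using SI \<eta>_pos Mbar\<psi>_pos by (intro mult_right_mono) auto
  also have "\<dots> = \<eta> / 4 * En"
  proof -
    define Q where "Q = 2 * \<eta> + Mbar\<psi>"
    have "Q > 0" using \<eta>_pos Mbar\<psi>_pos by (simp add: Q_def)
    then have "real r * \<epsilon> * Q = \<eta> / 4" using r_ge_1 unfolding \<epsilon>_def Q_def[symmetric] by simp
    then show ?thesis unfolding Q_def[symmetric] by (simp add: mult_ac)
  qed
  also have "SA * (\<eta> / 4) \<le> En * (\<eta> / 4)"
    using SI0 sumE \<eta>_pos by (intro mult_right_mono) auto
  finally have "\<eta> * En \<le> 0" by (simp add: mult.commute)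
  moreover have "\<eta> * En > 0" using \<eta>_pos En(1) m by (intro mult_pos_pos) auto
  ultimately show False by simp
qed

section \<open>Inward directions, the Clarke tangent cone and the initial points\<close>

lemma ex_inward_direction:
  obtains v where "\<And>i. i \<in> active r \<psi> c \<Longrightarrow> inner (gradient (\<psi> i) c) v < 0"
proof -
  \<comment> \<open>The qualification condition says that 0 is not in the convex hull of the active
    gradients. The normal of a hyperplane separating 0 from the hull, with its sign reversed, points
    strictly inward for all active constraints at once.\<close>
  define S where "S = convex hull ((\<lambda>i. gradient (\<psi> i) c) ` active r \<psi> c)"
  have "0 \<notin> S"
  proof
    assume "0 \<in> S"
    then obtain l where l: "\<forall>i\<in>active r \<psi> c. l i \<ge> 0" "sum l (active r \<psi> c) = 1"
      "0 = (\<Sum>i\<in>active r \<psi> c. l i *\<^sub>R gradient (\<psi> i) c)"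
      using mem_convex_hull_finite_imageD[of "active r \<psi> c" 0 "\<lambda>i. gradient (\<psi> i) c"]
      by (auto simp: S_def)
    have "norm (\<Sum>i\<in>active r \<psi> c. l i *\<^sub>R gradient (\<psi> i) c) \<ge> 2 * \<eta> * sum l (active r \<psi> c)"
      using l(1) by (intro norm_active_combination_ge) auto
    with l(2,3) \<eta>_pos show False by simp
  qed
  moreover have "compact S"
    unfolding S_def by (intro finite_imp_compact_convex_hull) simp
  ultimately obtain a b where "inner a 0 < b" "\<forall>x\<in>S. inner a x > b"
    using separating_hyperplane_closed_point[of S 0] compact_imp_closed[of S] convex_convex_hull
    unfolding S_def by metis
  moreover have "gradient (\<psi> i) c \<in> S" if "i \<in> active r \<psi> c" for i
    unfolding S_def using that by (intro hull_inc) simp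
  ultimately have "inner (gradient (\<psi> i) c) (- a) < 0" if "i \<in> active r \<psi> c" for i
    using that by (force simp: inner_commute)
  then show ?thesis by (rule that)
qed

text \<open>Strict differentiability in sequential form, with base point and direction both varying:
  the mean value theorem and continuity of the gradient give the limit. Moving base points are what
  the definition of the Clarke cone requires.\<close>

lemma \<psi>_difference_quotient:
  assumes i: "i \<in> {1..r}" and y: "y \<longlonglongrightarrow> c" and \<tau>: "\<And>n. \<tau> n > (0::real)" "\<tau> \<longlonglongrightarrow> 0" and w: "w \<longlonglongrightarrow> v"
  shows "(\<lambda>n. (\<psi> i (y n + \<tau> n *\<^sub>R w n) - \<psi> i (y n)) / \<tau> n) \<longlonglongrightarrow> inner v (gradient (\<psi> i) c)"
proof -
  have "\<exists>t. 0 < t \<and> t < 1 \<and> (\<psi> i (y n + \<tau> n *\<^sub>R w n) - \<psi> i (y n)) / \<tau> n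
      = inner (w n) (gradient (\<psi> i) (y n + t *\<^sub>R (\<tau> n *\<^sub>R w n)))" for n
  proof -
    obtain t where "0 < t" "t < 1"
      "\<psi> i (y n + \<tau> n *\<^sub>R w n) - \<psi> i (y n) = inner (\<tau> n *\<^sub>R w n) (gradient (\<psi> i) (y n + t *\<^sub>R (\<tau> n *\<^sub>R w n)))"
      using \<psi>_mean_value[OF i] by metis
    then show ?thesis using \<tau>(1)[of n] by (intro exI[of _ t]) simp
  qed
  then obtain t where t: "\<And>n. 0 < t n" "\<And>n. t n < 1"
    and eq: "\<And>n. (\<psi> i (y n + \<tau> n *\<^sub>R w n) - \<psi> i (y n)) / \<tau> n
      = inner (w n) (gradient (\<psi> i) (y n + t n *\<^sub>R (\<tau> n *\<^sub>R w n)))"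
    by metis
  have "(\<lambda>n. \<tau> n *\<^sub>R w n) \<longlonglongrightarrow> 0 *\<^sub>R v" by (intro tendsto_intros \<tau> w)
  then have lim0: "(\<lambda>n. norm (\<tau> n *\<^sub>R w n)) \<longlonglongrightarrow> 0" by (intro tendsto_norm_zero) simp
  have "\<forall>n. norm (t n *\<^sub>R (\<tau> n *\<^sub>R w n)) \<le> norm (\<tau> n *\<^sub>R w n)"
  proof
    fix n show "norm (t n *\<^sub>R (\<tau> n *\<^sub>R w n)) \<le> norm (\<tau> n *\<^sub>R w n)"
      using t[of n] mult_right_mono[of "t n" 1 "norm (\<tau> n *\<^sub>R w n)"] by (simp add: abs_mult)
  qed
  from Lim_null_comparison[OF always_eventually[OF this] lim0]
  have "(\<lambda>n. t n *\<^sub>R (\<tau> n *\<^sub>R w n)) \<longlonglongrightarrow> 0" .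
  then have lim: "(\<lambda>n. y n + t n *\<^sub>R (\<tau> n *\<^sub>R w n)) \<longlonglongrightarrow> c"
    using tendsto_add[OF y] by fastforce
  have "isCont (gradient (\<psi> i)) c"
    using continuous_on_gradient_\<psi>[OF i, of UNIV] by (simp add: continuous_on_eq_continuous_at)
  then have "(\<lambda>n. gradient (\<psi> i) (y n + t n *\<^sub>R (\<tau> n *\<^sub>R w n))) \<longlonglongrightarrow> gradient (\<psi> i) c"
    using lim by (rule isCont_tendsto_compose)
  then show ?thesis unfolding eq by (intro tendsto_intros w)
qed

lemma tendsto_\<psi>:
  "i \<in> {1..r} \<Longrightarrow> y \<longlonglongrightarrow> c \<Longrightarrow> (\<lambda>n. \<psi> i (y n)) \<longlonglongrightarrow> \<psi> i c"
  by (rule isCont_tendsto_compose[OF GDERIV_isCont[OF GDERIV_\<psi>]])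

lemma inactive_neg: "c \<in> C \<Longrightarrow> i \<in> {1..r} \<Longrightarrow> i \<notin> active r \<psi> c \<Longrightarrow> \<psi> i c < 0"
  by (auto simp: active_def mem_C_iff less_le)

text \<open>That tangent vectors satisfy the inequalities is seen from the constant sequence
  \<open>c\<close>. Conversely, a vector satisfying only weak inequalities is first tilted by
  \<open>\<epsilon> *\<^sub>R v'\<close> with \<open>v'\<close> strictly inward; the tilted vector
  is eventually admissible along any sequence.\<close>

lemma clarke_tangent_cone_C:
  assumes c: "c \<in> C"
  shows "clarke_tangent_cone C c = {v. \<forall>i\<in>active r \<psi> c. inner (gradient (\<psi> i) c) v \<le> 0}"
proof (intro equalityI subsetI CollectI ballI)
  fix v i assume v: "v \<in> clarke_tangent_cone C c" and i: "i \<in> active r \<psi> c"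
  define \<tau> where "\<tau> n = 1 / real (Suc n)" for n
  have \<tau>: "\<tau> \<longlonglongrightarrow> 0" "\<And>n. \<tau> n > 0"
    using LIMSEQ_inverse_real_of_nat by (auto simp: \<tau>_def[abs_def] inverse_eq_divide)
  then have "\<exists>w. w \<longlonglongrightarrow> v \<and> (\<forall>n. c + \<tau> n *\<^sub>R w n \<in> C)"
    using v c unfolding clarke_tangent_cone_def by (auto dest!: spec[of _ "\<lambda>_. c"] spec[of _ \<tau>])
  then obtain w where w: "w \<longlonglongrightarrow> v" "\<And>n. c + \<tau> n *\<^sub>R w n \<in> C" by blast
  have "(\<lambda>n. (\<psi> i (c + \<tau> n *\<^sub>R w n) - \<psi> i c) / \<tau> n) \<longlonglongrightarrow> inner v (gradient (\<psi> i) c)"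
    by (rule \<psi>_difference_quotient[OF active_subset[OF i] tendsto_const \<tau>(2,1) w(1)])
  moreover have "(\<psi> i (c + \<tau> n *\<^sub>R w n) - \<psi> i c) / \<tau> n \<le> 0" for n
    using w(2)[of n] \<tau>(2)[of n] i unfolding mem_C_iff by (auto simp: active_def divide_le_0_iff)
  ultimately have "inner v (gradient (\<psi> i) c) \<le> 0"
    using LIMSEQ_le_const2 by blast
  then show "inner (gradient (\<psi> i) c) v \<le> 0" by (simp add: inner_commute)
next
  fix v assume v: "v \<in> {v. \<forall>i\<in>active r \<psi> c. inner (gradient (\<psi> i) c) v \<le> 0}"
  obtain v' where v': "\<And>i. i \<in> active r \<psi> c \<Longrightarrow> inner (gradient (\<psi> i) c) v' < 0"
    using ex_inward_direction by blast
  show "v \<in> clarke_tangent_cone C c"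
    unfolding clarke_tangent_cone_def
  proof (intro CollectI allI impI, elim conjE)
    fix y :: "nat \<Rightarrow> 'a" and \<tau> :: "nat \<Rightarrow> real"
    assume y: "\<forall>n. y n \<in> C" "y \<longlonglongrightarrow> c" and \<tau>: "\<forall>n. \<tau> n > 0" "\<tau> \<longlonglongrightarrow> 0"
    have ev: "\<forall>\<^sub>F n in sequentially. y n + \<tau> n *\<^sub>R (v + \<epsilon> *\<^sub>R v') \<in> C" if \<epsilon>: "\<epsilon> > 0" for \<epsilon>
      unfolding mem_C_iff
    proof (intro eventually_ball_finite ballI)
      fix i assume i: "i \<in> {1..r}"
      define w where "w = v + \<epsilon> *\<^sub>R v'"
      show "\<forall>\<^sub>F n in sequentially. \<psi> i (y n + \<tau> n *\<^sub>R (v + \<epsilon> *\<^sub>R v')) \<le> 0"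
      proof (cases "i \<in> active r \<psi> c")
        case True
        have "inner (gradient (\<psi> i) c) v \<le> 0" using v True by auto
        moreover have "\<epsilon> * inner (gradient (\<psi> i) c) v' < 0"
          using v'[OF True] \<epsilon> by (rule mult_pos_neg[rotated])
        ultimately have "inner w (gradient (\<psi> i) c) < 0"
          by (simp add: w_def inner_add_right inner_commute)
        moreover have "(\<lambda>n. (\<psi> i (y n + \<tau> n *\<^sub>R w) - \<psi> i (y n)) / \<tau> n) \<longlonglongrightarrow> inner w (gradient (\<psi> i) c)"
          using \<tau> by (intro \<psi>_difference_quotient i y tendsto_const) auto
        ultimately have "\<forall>\<^sub>F n in sequentially. (\<psi> i (y n + \<tau> n *\<^sub>R w) - \<psi> i (y n)) / \<tau> n < 0"
          by (simp add: order_tendstoD)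
        then show ?thesis
        proof (rule eventually_mono)
          fix n assume "(\<psi> i (y n + \<tau> n *\<^sub>R w) - \<psi> i (y n)) / \<tau> n < 0"
          then have "\<psi> i (y n + \<tau> n *\<^sub>R w) < \<psi> i (y n)"
            using \<tau>(1) by (auto simp: divide_less_0_iff not_less less_imp_le dest: spec[of _ n])
          also have "\<psi> i (y n) \<le> 0" using y(1) i by (simp add: mem_C_iff)
          finally show "\<psi> i (y n + \<tau> n *\<^sub>R (v + \<epsilon> *\<^sub>R v')) \<le> 0" by (simp add: w_def)
        qed
      next
        case False
        have "(\<lambda>n. y n + \<tau> n *\<^sub>R w) \<longlonglongrightarrow> c + 0 *\<^sub>R w" by (intro tendsto_intros y \<tau>)
        then have "(\<lambda>n. \<psi> i (y n + \<tau> n *\<^sub>R w)) \<longlonglongrightarrow> \<psi> i c" by (intro tendsto_\<psi> i) simp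
        from order_tendstoD(2)[OF this inactive_neg[OF c i False]]
        show ?thesis by (auto simp: w_def elim!: eventually_mono)
      qed
    qed simp
    \<comment> \<open>One sequence \<open>w\<close> has to serve all \<epsilon> and to be admissible
      for every index. The admissible direction closest to \<open>v\<close> is; it exists since 0 is
      admissible, and it converges to \<open>v\<close> because every tilted vector eventually
      competes with it.\<close>
    define S where "S n = {w. y n + \<tau> n *\<^sub>R w \<in> C}" for n
    define w where "w n = closest_point (S n) v" for n
    have S: "closed (S n)" "S n \<noteq> {}" for n
    proof -
      have "S n = (\<lambda>w. y n + \<tau> n *\<^sub>R w) -` C" by (auto simp: S_def)
      then show "closed (S n)"
        using compact_imp_closed[OF compact_C] by (auto intro!: continuous_closed_vimage continuous_intros)
      show "S n \<noteq> {}" using y(1) by (auto simp: S_def intro!: exI[of _ 0])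
    qed
    have "w \<longlonglongrightarrow> v"
    proof (rule tendstoI)
      fix e :: real assume "e > 0"
      define \<epsilon> where "\<epsilon> = e / (2 * (norm v' + 1))"
      have \<epsilon>: "\<epsilon> > 0" "\<epsilon> * norm v' < e"
      proof -
        have "norm v' + 1 > 0" by (simp add: add_nonneg_pos)
        then show "\<epsilon> > 0" using \<open>e > 0\<close> by (simp add: \<epsilon>_def)
        have "\<epsilon> * norm v' \<le> \<epsilon> * (norm v' + 1)" using \<open>\<epsilon> > 0\<close> by (intro mult_left_mono) auto
        also have "\<dots> = e / 2" using \<open>norm v' + 1 > 0\<close> by (simp add: \<epsilon>_def field_simps)
        finally show "\<epsilon> * norm v' < e" using \<open>e > 0\<close> by simp
      qed
      from ev[OF \<epsilon>(1)] show "\<forall>\<^sub>F n in sequentially. dist (w n) v < e"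
      proof (rule eventually_mono)
        fix n assume "y n + \<tau> n *\<^sub>R (v + \<epsilon> *\<^sub>R v') \<in> C"
        then have "v + \<epsilon> *\<^sub>R v' \<in> S n" by (simp add: S_def)
        from closest_point_le[OF S(1) this, of v] show "dist (w n) v < e"
          using \<epsilon> by (simp add: w_def dist_commute) (simp add: dist_norm)
      qed
    qed
    moreover have "w n \<in> S n" for n unfolding w_def by (intro closest_point_in_set S)
    ultimately show "\<exists>w. w \<longlonglongrightarrow> v \<and> (\<forall>n. y n + \<tau> n *\<^sub>R w n \<in> C)" by (auto simp: S_def)
  qed
qed

text \<open>In the sum over the projections \<open>q j\<close>, the summand with
  \<open>j = i\<close> contributes a strictly negative amount, and the others contribute nothing
  positive because they lie in the tangent cone. Hence one direction points strictly inward for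
  every active constraint.\<close>

lemma inward_dir_inward:
  assumes c: "c \<in> C" and i: "i \<in> active r \<psi> c"
  shows "inner (inward_dir r \<psi> c) (gradient (\<psi> i) c) < 0"
proof -
  define K where "K = clarke_tangent_cone C c"
  have K: "K = {v. \<forall>i\<in>active r \<psi> c. inner (gradient (\<psi> i) c) v \<le> 0}"
    unfolding K_def by (rule clarke_tangent_cone_C[OF c])
  have KI: "K = (\<Inter>i\<in>active r \<psi> c. {v. inner (gradient (\<psi> i) c) v \<le> 0})" by (auto simp: K)
  have "closed K" unfolding KI by (intro closed_INT) (auto intro: closed_halfspace_le)
  have "convex K" unfolding KI by (intro convex_INT) (auto intro: convex_halfspace_le)
  have "0 \<in> K" by (simp add: K)
  define q where "q j = closest_point K (- gradient (\<psi> j) c)" for j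
  have qK: "q j \<in> K" for j
    unfolding q_def using \<open>closed K\<close> \<open>0 \<in> K\<close> by (intro closest_point_in_set) auto
  obtain v where v: "\<And>i. i \<in> active r \<psi> c \<Longrightarrow> inner (gradient (\<psi> i) c) v < 0"
    using ex_inward_direction by blast
  have neg: "inner (gradient (\<psi> i) c) (q i) < 0"
  proof -
    define p where "p = - gradient (\<psi> i) c"
    \<comment> \<open>Testing the projection inequality with \<open>q i + v\<close> excludes
      \<open>q i = 0\<close>, since \<open>p\<close> has a positive inner product with
      \<open>v\<close>. Testing it with 0 gives
      \<open>inner p (q i) \<ge> inner (q i) (q i)\<close>.\<close>
    have "q i + v \<in> K" using qK[of i] v by (auto simp: K inner_add_right add_nonpos_nonpos less_imp_le)
    from closest_point_dot[OF \<open>convex K\<close> \<open>closed K\<close> this, of p]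
    have "inner p v \<le> inner (q i) v" by (simp add: q_def p_def inner_diff_left)
    moreover have "inner p v > 0" using v[OF i] by (simp add: p_def)
    ultimately have "q i \<noteq> 0" by auto
    moreover from closest_point_dot[OF \<open>convex K\<close> \<open>closed K\<close> \<open>0 \<in> K\<close>, of p]
    have "inner p (q i) \<ge> inner (q i) (q i)" by (simp add: q_def p_def inner_diff_left)
    ultimately have "inner p (q i) > 0" by (smt (verit) inner_gt_zero_iff)
    then show ?thesis by (simp add: p_def)
  qed
  have "inner (inward_dir r \<psi> c) (gradient (\<psi> i) c) = (\<Sum>j\<in>active r \<psi> c. inner (gradient (\<psi> i) c) (q j))"
    by (simp add: inward_dir_def q_def K_def inner_sum_right inner_commute[of _ "gradient (\<psi> i) c"])
  also have "\<dots> < 0"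
  proof -
    have "(\<Sum>j\<in>active r \<psi> c. inner (gradient (\<psi> i) c) (q j))
        = inner (gradient (\<psi> i) c) (q i) + (\<Sum>j\<in>active r \<psi> c - {i}. inner (gradient (\<psi> i) c) (q j))"
      by (rule sum.remove[OF finite_active i])
    moreover have "(\<Sum>j\<in>active r \<psi> c - {i}. inner (gradient (\<psi> i) c) (q j)) \<le> 0"
      using qK i by (intro sum_nonpos) (auto simp: K)
    ultimately show ?thesis using neg by linarith
  qed
  finally show ?thesis .
qed

text \<open>Moving away from \<open>c\<close> against an inward direction raises an active
  constraint above 0 at once, so \<open>C\<close> is left arbitrarily close to
  \<open>c\<close>.\<close>

lemma active_empty_if_interior:
  assumes "c \<in> interior C"
  shows "active r \<psi> c = {}"
proof (rule ccontr)
  assume "active r \<psi> c \<noteq> {}"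
  then obtain i where i: "i \<in> active r \<psi> c" by blast
  obtain v where "\<And>i. i \<in> active r \<psi> c \<Longrightarrow> inner (gradient (\<psi> i) c) v < 0"
    using ex_inward_direction by blast
  then have v: "inner (- v) (gradient (\<psi> i) c) > 0" using i by (simp add: inner_commute)
  define \<tau> where "\<tau> n = 1 / real (Suc n)" for n
  have \<tau>: "\<tau> \<longlonglongrightarrow> 0" "\<And>n. \<tau> n > 0"
    using LIMSEQ_inverse_real_of_nat by (auto simp: \<tau>_def[abs_def] inverse_eq_divide)
  have "(\<lambda>n. (\<psi> i (c + \<tau> n *\<^sub>R (- v)) - \<psi> i c) / \<tau> n) \<longlonglongrightarrow> inner (- v) (gradient (\<psi> i) c)"
    by (intro \<psi>_difference_quotient active_subset[OF i] tendsto_const \<tau>)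
  from order_tendstoD(1)[OF this v]
  have "\<forall>\<^sub>F n in sequentially. 0 < (\<psi> i (c + \<tau> n *\<^sub>R (- v)) - \<psi> i c) / \<tau> n" .
  moreover have "(\<lambda>n. c + \<tau> n *\<^sub>R (- v)) \<longlonglongrightarrow> c + 0 *\<^sub>R (- v)" by (intro tendsto_intros \<tau>)
  then have "\<forall>\<^sub>F n in sequentially. c + \<tau> n *\<^sub>R (- v) \<in> interior C"
    using assms by (intro topological_tendstoD[of _ c]) auto
  ultimately have "\<forall>\<^sub>F n in sequentially. False"
  proof eventually_elim
    case (elim n)
    have "\<psi> i c = 0" using i by (simp add: active_def)
    with elim(1) \<tau>(2)[of n] have "\<psi> i (c + \<tau> n *\<^sub>R (- v)) > 0" by (simp add: zero_less_divide_iff)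
    moreover have "c + \<tau> n *\<^sub>R (- v) \<in> C" using elim(2) interior_subset by blast
    ultimately show False using active_subset[OF i] by (auto simp: mem_C_iff not_less[symmetric])
  qed
  then show False by simp
qed

lemma eventually_E_less:
  assumes \<gamma>: "filterlim \<gamma> at_top sequentially"
    and lim: "\<And>i. i \<in> {1..r} \<Longrightarrow> filterlim (\<lambda>k. \<gamma> k * \<psi> i (y k)) at_bot sequentially"
  shows "\<forall>\<^sub>F k in sequentially. E (\<gamma> k) (y k) < \<gamma> k"
proof -
  have "(\<lambda>k. \<Sum>i=1..r. exp (\<gamma> k * \<psi> i (y k))) \<longlonglongrightarrow> (\<Sum>i=1..r. 0)"
    by (intro tendsto_sum filterlim_compose[OF exp_at_bot] lim)
  then have "\<forall>\<^sub>F k in sequentially. (\<Sum>i=1..r. exp (\<gamma> k * \<psi> i (y k))) < 1"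
    by (rule order_tendstoD) simp
  moreover have "\<forall>\<^sub>F k in sequentially. \<gamma> k > 0"
    using \<gamma> by (rule filterlim_at_top_dense[THEN iffD1, rule_format])
  ultimately show ?thesis by eventually_elim (simp add: E_eq)
qed

text \<open>The shift \<open>s k\<close> tends to 0, but \<open>\<gamma> k * s k\<close> tends to
  infinity logarithmically. At an active constraint \<open>\<gamma> k * \<psi> i\<close> behaves
  like \<open>\<gamma> k * s k\<close> times a negative slope; at an inactive one it behaves like
  \<open>\<gamma> k\<close> times a negative value. In both cases the exponential vanishes in the
  limit, so \<open>E / \<gamma> k\<close> tends to 0.\<close>

lemma eventually_E_initial_point_less:
  assumes M: "M > 0" and \<gamma>_large: "\<And>k. \<gamma> k > 2 * M / \<eta>" and \<gamma>: "filterlim \<gamma> at_top sequentially"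
    and x0: "x0 \<in> C"
  shows "\<forall>\<^sub>F k in sequentially. E (\<gamma> k) (initial_point r \<psi> M \<eta> M\<psi> x0 (\<gamma> k)) < \<gamma> k"
proof -
  have inactive: "filterlim (\<lambda>k. \<gamma> k * \<psi> i (y k)) at_bot sequentially"
    if "i \<in> {1..r}" "i \<notin> active r \<psi> x0" "y \<longlonglongrightarrow> x0" for i y
  proof -
    have "filterlim (\<lambda>k. \<psi> i (y k) * \<gamma> k) at_bot sequentially"
      using that by (intro filterlim_tendsto_neg_mult_at_bot[OF tendsto_\<psi> inactive_neg[OF x0] \<gamma>])
    then show ?thesis by (simp add: mult.commute)
  qed
  show ?thesis
  proof (cases "x0 \<in> frontier C")
    case False
    then have "x0 \<in> interior C" using x0 closure_subset by (auto simp: frontier_def)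
    then have "active r \<psi> x0 = {}" by (rule active_empty_if_interior)
    then have "filterlim (\<lambda>k. \<gamma> k * \<psi> i x0) at_bot sequentially" if "i \<in> {1..r}" for i
      using inactive[OF that] by simp
    from eventually_E_less[OF \<gamma> this] False show ?thesis by (simp add: initial_point_def)
  next
    case True
    define w where "w = inward_dir r \<psi> x0 /\<^sub>R norm (inward_dir r \<psi> x0)"
    define s where "s k = sigma r M \<eta> M\<psi> (\<gamma> k)" for k
    define cs where "cs = real r * M\<psi> / (2 * \<eta>\<^sup>2)"
    have cs: "cs > 0" using r_ge_1 M\<psi>_pos \<eta>_pos by (simp add: cs_def)
    \<comment> \<open>With this abbreviation \<open>alpha M \<eta> g = ln (a * g) / g\<close>, and
      the lower bound on \<open>\<gamma> k\<close> reads \<open>a * \<gamma> k > 1\<close>.\<close>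
    define a where "a = \<eta> / (2 * M)"
    have a: "a > 0" using M \<eta>_pos by (simp add: a_def)
    have \<gamma>_pos: "\<gamma> k > 0" for k
      using \<gamma>_large[of k] M \<eta>_pos by (smt (verit) divide_pos_pos)
    have a\<gamma>: "a * \<gamma> k > 1" for k
      using \<gamma>_large[of k] M \<eta>_pos by (simp add: a_def field_simps)
    have lnr: "ln (real r) \<ge> 0" using r_ge_1 by simp
    have s_eq: "s k = cs * (ln (real r) + ln (a * \<gamma> k)) / \<gamma> k" for k
      by (simp add: s_def sigma_def alpha_def cs_def a_def add_divide_distrib distrib_left)
    have s_pos: "s k > 0" for k
      unfolding s_eq using cs lnr a\<gamma>[of k] \<gamma>_pos[of k] by (intro divide_pos_pos mult_pos_pos add_nonneg_pos) auto
    have \<gamma>s: "filterlim (\<lambda>k. \<gamma> k * s k) at_top sequentially"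
    proof -
      have "filterlim (\<lambda>k. cs * (ln (real r) + ln (a * \<gamma> k))) at_top sequentially"
        by (intro filterlim_tendsto_pos_mult_at_top[OF tendsto_const cs]
            filterlim_tendsto_add_at_top[OF tendsto_const] filterlim_compose[OF ln_at_top]
            filterlim_tendsto_pos_mult_at_top[OF tendsto_const a] \<gamma>)
      moreover have "\<gamma> k * s k = cs * (ln (real r) + ln (a * \<gamma> k))" for k
        using \<gamma>_pos[of k] by (simp add: s_eq)
      ultimately show ?thesis by simp
    qed
    have "s \<longlonglongrightarrow> 0"
    proof -
      have "(\<lambda>k. cs * (ln (real r) + ln a) * inverse (\<gamma> k) + cs * (ln (\<gamma> k) / \<gamma> k)) \<longlonglongrightarrow>
          cs * (ln (real r) + ln a) * 0 + cs * 0"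
        by (intro tendsto_intros filterlim_compose[OF ln_x_over_x_tendsto_0 \<gamma>]
            filterlim_compose[OF tendsto_inverse_0_at_top \<gamma>] tendsto_inverse_0_at_top \<gamma>)
      moreover have "s k = cs * (ln (real r) + ln a) * inverse (\<gamma> k) + cs * (ln (\<gamma> k) / \<gamma> k)" for k
        using a \<gamma>_pos[of k] by (simp add: s_eq ln_mult field_simps)
      ultimately show ?thesis by (simp add: s_eq[abs_def])
    qed
    then have lim: "(\<lambda>k. x0 + s k *\<^sub>R w) \<longlonglongrightarrow> x0"
      using tendsto_add[OF tendsto_const tendsto_scaleR[OF _ tendsto_const], of s 0 sequentially x0 w] by simp
    have "filterlim (\<lambda>k. \<gamma> k * \<psi> i (x0 + s k *\<^sub>R w)) at_bot sequentially" if i: "i \<in> {1..r}" for i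
    proof (cases "i \<in> active r \<psi> x0")
      case False
      then show ?thesis using inactive[OF i _ lim] by simp
    next
      case True
      have d: "inner (inward_dir r \<psi> x0) (gradient (\<psi> i) x0) < 0" by (rule inward_dir_inward[OF x0 True])
      then have "inward_dir r \<psi> x0 \<noteq> 0" by auto
      with d have w: "inner w (gradient (\<psi> i) x0) < 0"
        by (simp add: w_def mult_pos_neg)
      have "(\<lambda>k. (\<psi> i (x0 + s k *\<^sub>R w) - \<psi> i x0) / s k) \<longlonglongrightarrow> inner w (gradient (\<psi> i) x0)"
        by (intro \<psi>_difference_quotient i tendsto_const s_pos \<open>s \<longlonglongrightarrow> 0\<close>)
      from filterlim_tendsto_neg_mult_at_bot[OF this w \<gamma>s]
      show ?thesis using True s_pos by (simp add: active_def less_imp_neq[symmetric] mult.commute)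
    qed
    from eventually_E_less[OF \<gamma> this] True show ?thesis
      by (simp add: initial_point_def s_def w_def)
  qed
qed

end

section \<open>Trajectories of the penalized system\<close>

lemma abs_continuous_on_interval_compose_C1:
  fixes x :: "real \<Rightarrow> 'a::euclidean_space"
  assumes x: "abs_continuous_on_interval a b x"
    and \<phi>: "\<And>p. GDERIV \<phi> p :> D p" and D: "continuous_on UNIV D"
  shows "abs_continuous_on_interval a b (\<lambda>t. \<phi> (x t))"
proof -
  have "bounded (x ` {a..b})"
    by (intro compact_imp_bounded compact_continuous_image
        abs_continuous_on_interval_imp_continuous_on[OF x]) auto
  from C1_lipschitz_on_bounded[OF \<phi> D this] obtain L where "L-lipschitz_on (x ` {a..b}) \<phi>" .
  then show ?thesis by (rule abs_continuous_on_interval_compose_lipschitz[OF x])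
qed

text \<open>Here \<open>s\<close> is the last time before \<open>t1\<close> at which
  \<open>e\<close> is at most \<open>c\<close>, and \<open>t\<close> is so close to it that
  \<open>e\<close> has not reached \<open>d\<close>. The upper bound matters: with
  \<open>d = g\<close> the trajectory is still in \<open>C\<close>, where its dynamics is
  known.\<close>

lemma continuous_first_crossing:
  fixes e :: "real \<Rightarrow> real"
  assumes e: "continuous_on {0..T} e" and "e 0 \<le> c" "c < d" and t1: "t1 \<in> {0..T}" "e t1 > c"
  obtains s t where "0 \<le> s" "s < t" "t \<le> T" "e s \<le> c" "\<And>\<tau>. s < \<tau> \<Longrightarrow> \<tau> \<le> t \<Longrightarrow> c < e \<tau> \<and> e \<tau> < d"
proof -
  define S where "S = {\<tau> \<in> {0..t1}. e \<tau> \<le> c}"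
  have e1: "continuous_on {0..t1} e" using e by (rule continuous_on_subset) (use t1 in auto)
  have "compact S"
  proof -
    have "closed S" unfolding S_def
      by (intro continuous_on_closed_Collect_le e1 continuous_on_const closed_atLeastAtMost)
    moreover have "bounded S" by (rule bounded_subset[of "{0..t1}"]) (auto simp: S_def)
    ultimately show ?thesis by (simp add: compact_eq_bounded_closed)
  qed
  moreover have "0 \<in> S" using assms by (simp add: S_def)
  ultimately obtain s where s: "s \<in> S" "\<And>\<tau>. \<tau> \<in> S \<Longrightarrow> \<tau> \<le> s"
    using compact_attains_sup[of S] by blast
  have s01: "0 \<le> s" "s \<le> t1" "e s \<le> c" using s(1) by (auto simp: S_def)
  have "s \<noteq> t1" using s01 t1 by auto
  with s01 have "s < t1" by simp
  have "e s < d" using s01 assms by simp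
  moreover have "s \<in> {0..t1}" using s01 by simp
  ultimately obtain \<delta> where \<delta>: "\<delta> > 0" "\<And>\<tau>. \<tau> \<in> {0..t1} \<Longrightarrow> dist \<tau> s < \<delta> \<Longrightarrow> dist (e \<tau>) (e s) < d - e s"
    using e1[unfolded continuous_on_iff, rule_format, of s "d - e s"] by auto
  define t where "t = min t1 (s + \<delta> / 2)"
  show ?thesis
  proof
    show "0 \<le> s" "e s \<le> c" by (fact s01)+
    show "s < t" using \<open>s < t1\<close> \<delta> by (simp add: t_def)
    show "t \<le> T" using t1 by (auto simp: t_def)
    fix \<tau> assume \<tau>: "s < \<tau>" "\<tau> \<le> t"
    then have "\<tau> \<in> {0..t1}" "dist \<tau> s < \<delta>" using s01 \<delta>(1) by (auto simp: t_def dist_real_def)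
    moreover have "\<tau> \<notin> S" using s(2) \<tau> by force
    ultimately show "c < e \<tau> \<and> e \<tau> < d" using \<delta>(2)[of \<tau>] by (auto simp: S_def dist_real_def)
  qed
qed

locale penalized_system = regular_constraints r \<psi> \<eta> Mbar\<psi> M\<psi>
  for r :: nat and \<psi> :: "nat \<Rightarrow> 'a::euclidean_space \<Rightarrow> real" and \<eta> Mbar\<psi> M\<psi> :: real +
  fixes T M :: real and f :: "'a \<times> 'b::euclidean_space \<Rightarrow> 'a" and U :: "'b set"
  assumes T_pos: "T > 0" and M_pos: "M > 0" and U_nonempty: "U \<noteq> {}" and U_compact: "compact U"
    and f_cont: "continuous_on (constraint_set r \<psi> \<times> U) f"
    and f_lip: "\<forall>u\<in>U. M-lipschitz_on UNIV (\<lambda>x. f (x, u))"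
    and f_bound: "\<forall>x\<in>constraint_set r \<psi>. \<forall>u\<in>U. norm (f (x, u)) \<le> M"
    and f_convex: "\<forall>x. convex ((\<lambda>u. f (x, u)) ` U)"
begin

text \<open>The dynamics is only prescribed while the trajectory is in \<open>C\<close>; this covers the solutions
  of the auxiliary globally Lipschitz equation used for existence as well.\<close>

definition trajectory :: "real \<Rightarrow> (real \<Rightarrow> 'a) \<Rightarrow> bool" where
  "trajectory g x \<longleftrightarrow> abs_continuous_on_interval 0 T x \<and>
     (\<exists>Z. negligible Z \<and> (\<forall>t\<in>{0..T} - Z. x t \<in> C \<longrightarrow>
        (\<exists>F. norm F \<le> M \<and> (x has_vector_derivative (F - G g (x t))) (at t within {0..T}))))"

text \<open>Where \<open>E\<close> is at least \<open>2 * M / \<eta>\<close>, the force has norm at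
  least \<open>2 * M\<close> and outweighs the dynamics, which is bounded by \<open>M\<close>; so
  \<open>E\<close> cannot increase there. A crossing of the level \<open>c\<close> would require
  such an increase.\<close>

lemma trajectory_stays:
  assumes g: "g > 2 * M / \<eta>"
    and large: "\<And>p. p \<in> C \<Longrightarrow> E g p \<ge> 2 * M / \<eta> \<Longrightarrow> norm (G g p) \<ge> \<eta> * E g p"
    and x: "trajectory g x" and x0: "E g (x 0) < g" and t: "t \<in> {0..T}"
  shows "E g (x t) < g"
proof (rule ccontr)
  assume "\<not> E g (x t) < g"
  define c where "c = max (E g (x 0)) (2 * M / \<eta>)"
  have c: "E g (x 0) \<le> c" "c < g" "2 * M / \<eta> \<le> c" using g x0 by (auto simp: c_def)
  have g0: "g > 0" using g M_pos \<eta>_pos by (smt (verit) divide_pos_pos)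
  have ac: "abs_continuous_on_interval 0 T x" using x by (simp add: trajectory_def)
  obtain Z where Z: "negligible Z" "\<And>t. t \<in> {0..T} - Z \<Longrightarrow> x t \<in> C \<Longrightarrow>
        (\<exists>F. norm F \<le> M \<and> (x has_vector_derivative (F - G g (x t))) (at t within {0..T}))"
    using x unfolding trajectory_def by blast
  define e where "e t = E g (x t)" for t
  have ace: "abs_continuous_on_interval 0 T e"
    unfolding e_def by (intro abs_continuous_on_interval_compose_C1[OF ac GDERIV_E] continuous_intros continuous_on_G)
  have "e t > c" using \<open>\<not> E g (x t) < g\<close> c by (simp add: e_def)
  from continuous_first_crossing[OF abs_continuous_on_interval_imp_continuous_on[OF ace] _ c(2) t this]
  obtain s t where st: "0 \<le> s" "s < t" "t \<le> T" "e s \<le> c"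
    "\<And>\<tau>. s < \<tau> \<Longrightarrow> \<tau> \<le> t \<Longrightarrow> c < e \<tau> \<and> e \<tau> < g"
    using c(1) by (auto simp: e_def)
  have "e t - e s \<le> 0"
  \<comment> \<open>The left endpoint joins the exceptional set, since only at times after
    \<open>s\<close> is \<open>e\<close> known to exceed \<open>c\<close>.\<close>
  proof (rule abs_continuous_increment_le[where \<phi> = e and a = s and b = t and Z = "insert s Z" and B = "\<lambda>_. 0"])
    show "s \<le> t" using st by simp
    show "abs_continuous_on_interval s t e"
      by (rule abs_continuous_on_interval_subset[OF ace]) (use st in auto)
    show "negligible (insert s Z)" using Z by simp
    show "((\<lambda>_. 0) has_integral 0) {s..t}" by simp
    fix \<tau> assume \<tau>: "\<tau> \<in> {s..t} - insert s Z"
    then have e\<tau>: "c < e \<tau>" "e \<tau> < g" using st(5)[of \<tau>] by auto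
    then have xC: "x \<tau> \<in> C" using mem_C_if_E_le[OF g0, of "x \<tau>"] by (simp add: e_def)
    have "\<tau> \<in> {0..T} - Z" using \<tau> st by auto
    from Z(2)[OF this xC] obtain F where F: "norm F \<le> M"
      "(x has_vector_derivative (F - G g (x \<tau>))) (at \<tau> within {0..T})" by blast
    have "(x has_vector_derivative (F - G g (x \<tau>))) (at \<tau> within {s..t})"
      by (rule has_vector_derivative_within_subset[OF F(2)]) (use st in auto)
    then have d: "(e has_vector_derivative inner (F - G g (x \<tau>)) (g *\<^sub>R G g (x \<tau>))) (at \<tau> within {s..t})"
      unfolding e_def by (rule GDERIV_compose_has_vector_derivative[OF GDERIV_E])
    have "norm (G g (x \<tau>)) \<ge> \<eta> * E g (x \<tau>)" using large[OF xC] c(3) e\<tau> by (simp add: e_def)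
    moreover have "\<eta> * E g (x \<tau>) \<ge> 2 * M"
    proof -
      have "2 * M / \<eta> \<le> E g (x \<tau>)" using c(3) e\<tau> by (simp add: e_def)
      then show ?thesis using \<eta>_pos by (simp add: field_simps)
    qed
    ultimately have "M \<le> norm (G g (x \<tau>))" using M_pos by linarith
    have "inner F (G g (x \<tau>)) \<le> norm F * norm (G g (x \<tau>))" by (rule norm_cauchy_schwarz)
    also have "\<dots> \<le> norm (G g (x \<tau>)) * norm (G g (x \<tau>))"
      using F(1) \<open>M \<le> norm (G g (x \<tau>))\<close> by (intro mult_right_mono) auto
    finally have "inner (F - G g (x \<tau>)) (G g (x \<tau>)) \<le> 0"
      by (simp add: inner_diff_left dot_square_norm power2_eq_square)
    then have "inner (F - G g (x \<tau>)) (g *\<^sub>R G g (x \<tau>)) \<le> 0"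
      using g0 by (simp add: mult_nonneg_nonpos)
    with d show "\<exists>d\<le>0. (e has_vector_derivative d) (at \<tau> within {s..t})" by blast
  qed
  moreover have "e t > c" using st(2) st(5)[of t] by simp
  ultimately show False using st(4) by simp
qed

text \<open>Although the penalty term may be as large as \<open>g\<close> initially, its time integral is bounded
  independently of \<open>g\<close>: it is paid for by the decrease of \<open>psi_gamma\<close>.\<close>

lemma ex_integral_penalty_bound:
  obtains K where "K > 0"
    and "\<And>g x. g > 2 * M / \<eta> \<Longrightarrow>
      (\<And>p. p \<in> C \<Longrightarrow> E g p \<ge> 2 * M / \<eta> \<Longrightarrow> norm (G g p) \<ge> \<eta> * E g p) \<Longrightarrow>
      trajectory g x \<Longrightarrow> E g (x 0) < g \<Longrightarrow> integral {0..T} (\<lambda>t. E g (x t)) \<le> K"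
proof -
  have 1: "1 \<in> {1..r}" using r_ge_1 by simp
  have "bounded (\<psi> 1 ` C)"
    by (intro compact_imp_bounded compact_continuous_image continuous_on_\<psi> 1 compact_C)
  then obtain B where B: "B > 0" "\<forall>y\<in>\<psi> 1 ` C. norm y \<le> B" unfolding bounded_pos by blast
  \<comment> \<open>The term \<open>2 * M * \<eta>\<close> absorbs \<open>\<eta>\<^sup>2 * E\<close>
    where \<open>E < 2 * M / \<eta>\<close> and no lower bound on the force is available. The term
    \<open>M * Mbar\<psi>\<close> bounds the contribution of the dynamics to the derivative of the
    potential.\<close>
  define K2 where "K2 = 2 * M * \<eta> + M * Mbar\<psi>"
  define K where "K = (K2 * T + B) / \<eta>\<^sup>2"
  have K2: "K2 > 0" using M_pos \<eta>_pos Mbar\<psi>_pos by (simp add: K2_def add_pos_pos)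
  show ?thesis
  proof
    show "K > 0" using K2 T_pos B \<eta>_pos by (simp add: K_def add_pos_pos)
    fix g x assume g: "g > 2 * M / \<eta>"
      and large: "\<And>p. p \<in> C \<Longrightarrow> E g p \<ge> 2 * M / \<eta> \<Longrightarrow> norm (G g p) \<ge> \<eta> * E g p"
      and x: "trajectory g x" and x0: "E g (x 0) < g"
    have g0: "g > 0" using g M_pos \<eta>_pos by (smt (verit) divide_pos_pos)
    have xC: "x t \<in> C" if "t \<in> {0..T}" for t
      using trajectory_stays[OF g large x x0 that] mem_C_if_E_le[OF g0] by simp
    have ac: "abs_continuous_on_interval 0 T x" using x by (simp add: trajectory_def)
    have x_cont: "continuous_on {0..T} x" by (rule abs_continuous_on_interval_imp_continuous_on[OF ac])
    obtain Z where Z: "negligible Z" "\<And>t. t \<in> {0..T} - Z \<Longrightarrow> x t \<in> C \<Longrightarrow>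
          (\<exists>F. norm F \<le> M \<and> (x has_vector_derivative (F - G g (x t))) (at t within {0..T}))"
      using x unfolding trajectory_def by blast
    \<comment> \<open>This is \<open>psi_gamma\<close> plus \<open>ln g / g\<close>. Along a
      trajectory its derivative is the inner product of the velocity with \<open>G\<close>, divided
      by \<open>E\<close>; dividing by \<open>E\<close> leaves a dissipation that is linear in
      \<open>E\<close>.\<close>
    define \<Lambda> where "\<Lambda> p = ln (E g p) / g" for p
    have \<Lambda>': "GDERIV \<Lambda> p :> (1 / E g p) *\<^sub>R G g p" for p
    proof -
      have "GDERIV (\<lambda>p. ln (E g p) / g) p :> (1 / (g * E g p)) *\<^sub>R (g *\<^sub>R G g p)"
        by (rule GDERIV_DERIV_compose[OF GDERIV_E])
           (use g0 E_pos[OF g0, of p] in \<open>auto intro!: derivative_eq_intros simp: field_simps\<close>)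
      then show ?thesis using g0 by (simp add: \<Lambda>_def[abs_def])
    qed
    have E_cont: "continuous_on {0..T} (\<lambda>t. E g (x t))"
      by (rule continuous_on_compose2[OF continuous_on_E[of UNIV] x_cont]) auto
    have "\<Lambda> (x T) - \<Lambda> (x 0) \<le> K2 * (T - 0) - \<eta>\<^sup>2 * integral {0..T} (\<lambda>t. E g (x t))"
    proof (rule abs_continuous_increment_le[where \<phi> = "\<lambda>t. \<Lambda> (x t)" and a = 0 and b = T and Z = Z
          and B = "\<lambda>t. K2 - \<eta>\<^sup>2 * E g (x t)"])
      show "0 \<le> T" using T_pos by simp
      show "abs_continuous_on_interval 0 T (\<lambda>t. \<Lambda> (x t))"
        by (intro abs_continuous_on_interval_compose_C1[OF ac \<Lambda>'] continuous_intros continuous_on_G continuous_on_E)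
           (use E_pos[OF g0] in \<open>auto simp: less_imp_neq[symmetric]\<close>)
      show "negligible Z" by (fact Z)
      have "((\<lambda>t. K2) has_integral K2 * (T - 0)) {0..T}"
        using has_integral_const_real[of K2 0 T] T_pos by (simp add: mult.commute)
      moreover have "((\<lambda>t. \<eta>\<^sup>2 * E g (x t)) has_integral \<eta>\<^sup>2 * integral {0..T} (\<lambda>t. E g (x t))) {0..T}"
        by (intro has_integral_mult_right integrable_integral integrable_continuous_real E_cont)
      ultimately show "((\<lambda>t. K2 - \<eta>\<^sup>2 * E g (x t)) has_integral
          K2 * (T - 0) - \<eta>\<^sup>2 * integral {0..T} (\<lambda>t. E g (x t))) {0..T}"
        by (rule has_integral_diff)
      fix t assume t: "t \<in> {0..T} - Z"
      then have tC: "x t \<in> C" using xC by simp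
      from Z(2)[OF t tC] obtain F where F: "norm F \<le> M"
        "(x has_vector_derivative (F - G g (x t))) (at t within {0..T})" by blast
      define n e where "n = norm (G g (x t))" and "e = E g (x t)"
      have e: "e > 0" "n \<le> Mbar\<psi> * e"
        using E_pos[OF g0, of "x t"] norm_G_le[OF g0 tC] by (auto simp: e_def n_def)
      have n: "n \<ge> 0" by (simp add: n_def)
      have "inner F (G g (x t)) \<le> norm F * n" unfolding n_def by (rule norm_cauchy_schwarz)
      also have "\<dots> \<le> M * n" using F(1) n by (rule mult_right_mono)
      finally have "inner (F - G g (x t)) (G g (x t)) \<le> M * n - n * n"
        by (simp add: inner_diff_left dot_square_norm power2_eq_square n_def)
      also have "\<dots> \<le> (K2 - \<eta>\<^sup>2 * e) * e"
      proof (cases "e \<ge> 2 * M / \<eta>")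
        case True
        then have "n \<ge> \<eta> * e" using large[OF tC] by (simp add: e_def n_def)
        moreover have "\<eta> * e \<ge> 2 * M" using True \<eta>_pos by (simp add: field_simps)
        \<comment> \<open>The map \<open>s * (s - M)\<close> is increasing for
          \<open>s \<ge> M\<close>, and \<open>\<eta> * e\<close> is already beyond that
          threshold.\<close>
        ultimately have "(\<eta> * e) * (\<eta> * e - M) \<le> n * (n - M)"
          using M_pos \<eta>_pos e by (intro mult_mono) auto
        then have "M * n - n * n \<le> M * \<eta> * e - \<eta>\<^sup>2 * e * e"
          by (simp add: algebra_simps power2_eq_square)
        also have "M * \<eta> * e \<le> K2 * e"
          using e M_pos \<eta>_pos Mbar\<psi>_pos by (intro mult_right_mono) (auto simp: K2_def)
        finally show ?thesis by (simp add: algebra_simps)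
      next
        case False
        have "M * n \<le> M * (Mbar\<psi> * e)"
          by (rule mult_left_mono[OF e(2)]) (use M_pos in simp)
        moreover have "n * n \<ge> 0" by simp
        moreover have "\<eta>\<^sup>2 * e \<le> 2 * M * \<eta>"
        proof -
          have "\<eta> * e \<le> 2 * M" using False \<eta>_pos by (simp add: field_simps)
          from mult_left_mono[OF this, of \<eta>] show ?thesis
            using \<eta>_pos by (simp add: power2_eq_square mult_ac)
        qed
        then have "(2 * M * \<eta> - \<eta>\<^sup>2 * e) * e \<ge> 0" using e by simp
        moreover have "(K2 - \<eta>\<^sup>2 * e) * e = (2 * M * \<eta> - \<eta>\<^sup>2 * e) * e + M * (Mbar\<psi> * e)"
          by (simp add: K2_def algebra_simps)
        ultimately show ?thesis by linarith
      qed
      finally have "inner (F - G g (x t)) ((1 / E g (x t)) *\<^sub>R G g (x t)) \<le> K2 - \<eta>\<^sup>2 * E g (x t)"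
        using e(1) unfolding e_def by (simp add: divide_le_eq)
      with GDERIV_compose_has_vector_derivative[OF \<Lambda>' F(2)]
      show "\<exists>d\<le>K2 - \<eta>\<^sup>2 * E g (x t). ((\<lambda>t. \<Lambda> (x t)) has_vector_derivative d) (at t within {0..T})"
        by blast
    qed
    moreover have "\<Lambda> (x 0) \<le> ln g / g"
      using x0 E_pos[OF g0, of "x 0"] g0 by (simp add: \<Lambda>_def divide_right_mono)
    \<comment> \<open>Keeping only the first summand of \<open>E\<close> bounds the potential from
      below. The terms \<open>ln g / g\<close> of the two endpoint bounds cancel, so nothing
      depending on \<open>g\<close> survives.\<close>
    moreover have "\<Lambda> (x T) \<ge> ln g / g - B"
    proof -
      have TC: "x T \<in> C" using xC T_pos by simp
      have "ln (g * exp (g * \<psi> 1 (x T))) \<le> ln (E g (x T))"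
        using exp_le_E[OF g0 1, of "x T"] g0 by (subst ln_le_cancel_iff) (auto intro: E_pos)
      then have "ln g + g * \<psi> 1 (x T) \<le> ln (E g (x T))" using g0 by (simp add: ln_mult)
      then have "(ln g + g * \<psi> 1 (x T)) / g \<le> \<Lambda> (x T)"
        using g0 unfolding \<Lambda>_def by (intro divide_right_mono) auto
      moreover have "(ln g + g * \<psi> 1 (x T)) / g = ln g / g + \<psi> 1 (x T)"
        using g0 by (simp add: add_divide_distrib)
      moreover have "\<bar>\<psi> 1 (x T)\<bar> \<le> B" using B(2) TC by auto
      ultimately show ?thesis by linarith
    qed
    ultimately have "\<eta>\<^sup>2 * integral {0..T} (\<lambda>t. E g (x t)) \<le> K2 * T + B" by simp
    then show "integral {0..T} (\<lambda>t. E g (x t)) \<le> K"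
      using \<eta>_pos by (simp add: K_def field_simps)
  qed
qed

lemma solves_trajectory:
  assumes x: "solves T f r \<psi> g \<xi> u x" and u: "AE t in lebesgue_on {0..T}. u t \<in> U"
  shows "trajectory g x"
proof -
  have "AE t in lebesgue_on {0..T}. u t \<in> U \<and>
      (x has_vector_derivative (f (x t, u t) - G g (x t))) (at t within {0..T})"
    using x u by (auto simp: solves_def penalty_force_def)
  then obtain Z where "negligible Z" "\<forall>t\<in>{0..T} - Z. u t \<in> U \<and>
      (x has_vector_derivative (f (x t, u t) - G g (x t))) (at t within {0..T})"
    by (subst (asm) AE_lebesgue_on_negligible_iff) auto
  then show ?thesis
    using x f_bound unfolding trajectory_def solves_def by blast
qed

end

section \<open>Existence of solutions for step controls\<close>

lemma lipschitz_on_scaleR_bounded: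
  fixes a :: "'c::metric_space \<Rightarrow> real" and b :: "'c \<Rightarrow> 'd::real_normed_vector"
  assumes a: "La-lipschitz_on S a" and b: "Lb-lipschitz_on S b"
    and A: "\<And>x. x \<in> S \<Longrightarrow> \<bar>a x\<bar> \<le> A" and B: "\<And>x. x \<in> S \<Longrightarrow> norm (b x) \<le> B"
    and AB: "A \<ge> 0" "B \<ge> 0"
  shows "(A * Lb + La * B)-lipschitz_on S (\<lambda>x. a x *\<^sub>R b x)"
proof (rule lipschitz_onI)
  have L: "La \<ge> 0" "Lb \<ge> 0" using a b lipschitz_on_nonneg by auto
  then show "A * Lb + La * B \<ge> 0" using AB by simp
  fix x y assume xy: "x \<in> S" "y \<in> S"
  have "dist (a x *\<^sub>R b x) (a y *\<^sub>R b y) = norm (a x *\<^sub>R (b x - b y) + (a x - a y) *\<^sub>R b y)"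
    by (simp add: dist_norm algebra_simps)
  also have "\<dots> \<le> norm (a x *\<^sub>R (b x - b y)) + norm ((a x - a y) *\<^sub>R b y)" by (rule norm_triangle_ineq)
  also have "\<dots> = \<bar>a x\<bar> * dist (b x) (b y) + dist (a x) (a y) * norm (b y)"
    by (simp add: dist_norm)
  also have "\<dots> \<le> A * (Lb * dist x y) + (La * dist x y) * B"
    using lipschitz_onD[OF a xy] lipschitz_onD[OF b xy] A[OF xy(1)] B[OF xy(2)] AB L
    by (intro add_mono mult_mono) auto
  also have "\<dots> = (A * Lb + La * B) * dist x y" by (simp add: algebra_simps)
  finally show "dist (a x *\<^sub>R b x) (a y *\<^sub>R b y) \<le> (A * Lb + La * B) * dist x y" .
qed

lemma lipschitz_on_sum:
  fixes \<phi> :: "'i \<Rightarrow> 'c::metric_space \<Rightarrow> 'd::real_normed_vector"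
  assumes "finite I" "\<And>i. i \<in> I \<Longrightarrow> \<exists>L. L-lipschitz_on S (\<phi> i)"
  shows "\<exists>L. L-lipschitz_on S (\<lambda>x. \<Sum>i\<in>I. \<phi> i x)"
  using assms
proof (induction I)
  case empty
  show ?case by (auto intro: lipschitz_on_constant)
next
  case (insert i I)
  from insert obtain L where "L-lipschitz_on S (\<phi> i)" by blast
  moreover from insert obtain L' where "L'-lipschitz_on S (\<lambda>x. \<Sum>i\<in>I. \<phi> i x)" by blast
  ultimately have "(L + L')-lipschitz_on S (\<lambda>x. \<phi> i x + (\<Sum>i\<in>I. \<phi> i x))" by (rule lipschitz_on_add)
  with insert show ?case by auto
qed

text \<open>Steps are counted from 0 here: step \<open>j\<close> is
  \<open>[j * h, (j + 1) * h)\<close>, which is the interval with index \<open>j + 1\<close> in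
  \<open>pc_controls\<close>.\<close>

lemma floor_step:
  fixes h :: real
  assumes "h > 0" "real j * h \<le> t" "t < (real j + 1) * h"
  shows "nat \<lfloor>t / h\<rfloor> = j"
proof -
  have "\<lfloor>t / h\<rfloor> = int j" using assms by (intro floor_unique) (auto simp: field_simps)
  then show ?thesis by simp
qed

lemma ex_step:
  fixes h :: real
  assumes "h > 0" "0 \<le> t" "t < real N * h"
  obtains j where "j < N" "real j * h \<le> t" "t < (real j + 1) * h"
proof
  define j where "j = nat \<lfloor>t / h\<rfloor>"
  have "t / h \<ge> 0" using assms by simp
  then have j: "real j \<le> t / h" "t / h < real j + 1" unfolding j_def by linarith+
  then show "real j * h \<le> t" "t < (real j + 1) * h" using assms by (simp_all add: field_simps)
  then have "real j * h < real N * h" using assms by linarith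
  then show "j < N" using assms by simp
qed

lemma integrable_on_steps:
  fixes \<kappa> :: "real \<Rightarrow> 'd::banach"
  assumes "h \<ge> 0" "\<And>j. j < N \<Longrightarrow> \<kappa> integrable_on {real j * h..(real j + 1) * h}"
  shows "\<kappa> integrable_on {0..real N * h}"
  using assms(2)
proof (induction N)
  case 0
  show ?case using integrable_on_refl[of \<kappa> 0] by simp
next
  case (Suc N)
  have "\<kappa> integrable_on {0..real N * h}" using Suc by simp
  moreover have "\<kappa> integrable_on {real N * h..real (Suc N) * h}"
    using Suc.prems[of N] by (simp add: add.commute)
  ultimately show ?case
    by (rule Henstock_Kurzweil_Integration.integrable_combine[rotated 2]) (use assms(1) in \<open>auto simp: mult_right_mono\<close>)
qed

context penalized_system
begin

text \<open>The constant depends on \<open>g\<close>. This is harmless, since it serves only to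
  construct solutions and never enters an error estimate.\<close>

lemma G_lipschitz_hull: "\<exists>L. L-lipschitz_on (convex hull C) (G g)"
  unfolding penalty_force_def
proof (rule lipschitz_on_sum)
  fix i assume i: "i \<in> {1..r}"
  have H: "compact (convex hull C)" by (rule compact_convex_hull[OF compact_C])
  define a where "a x = g * exp (g * \<psi> i x)" for x
  have a': "GDERIV a x :> (g * (g * exp (g * \<psi> i x))) *\<^sub>R gradient (\<psi> i) x" for x
    unfolding a_def
    by (rule GDERIV_DERIV_compose[OF GDERIV_\<psi>[OF i]]) (auto intro!: derivative_eq_intros)
  have "continuous_on UNIV (\<lambda>x. (g * (g * exp (g * \<psi> i x))) *\<^sub>R gradient (\<psi> i) x)"
    by (intro continuous_intros continuous_on_\<psi> continuous_on_gradient_\<psi> i)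
  from C1_lipschitz_on_bounded[OF a' this compact_imp_bounded[OF H]]
  obtain La where La: "La-lipschitz_on (convex hull C) a" .
  have "bounded (a ` (convex hull C))"
    unfolding a_def
    by (intro compact_imp_bounded compact_continuous_image continuous_intros continuous_on_\<psi> i H)
  then obtain A where A: "A > 0" "\<forall>y\<in>a ` (convex hull C). norm y \<le> A" unfolding bounded_pos by blast
  have "bounded (gradient (\<psi> i) ` (convex hull C))"
    by (intro compact_imp_bounded compact_continuous_image continuous_on_gradient_\<psi> i H)
  then obtain B where B: "B > 0" "\<forall>y\<in>gradient (\<psi> i) ` (convex hull C). norm y \<le> B"
    unfolding bounded_pos by blast
  have "(2 * M\<psi>)-lipschitz_on (convex hull C) (gradient (\<psi> i))" using grad_lip i by blast
  from lipschitz_on_scaleR_bounded[OF La this, of A B] A B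
  have "(A * (2 * M\<psi>) + La * B)-lipschitz_on (convex hull C) (\<lambda>x. a x *\<^sub>R gradient (\<psi> i) x)" by auto
  then show "\<exists>L. L-lipschitz_on (convex hull C) (\<lambda>x. (g * exp (g * \<psi> i x)) *\<^sub>R gradient (\<psi> i) x)"
    unfolding a_def by blast
qed simp

lemma norm_f_le: "u \<in> U \<Longrightarrow> c \<in> C \<Longrightarrow> norm (f (x, u)) \<le> M + M * norm (x - c)"
proof -
  assume u: "u \<in> U" and c: "c \<in> C"
  have "norm (f (x, u) - f (c, u)) \<le> M * norm (x - c)"
    using f_lip u by (intro lipschitz_on_normD) auto
  moreover have "norm (f (c, u)) \<le> M" using f_bound u c by blast
  ultimately show ?thesis using norm_triangle_sub[of "f (x, u)" "f (c, u)"] by linarith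
qed

lemma continuous_on_f: "u \<in> U \<Longrightarrow> continuous_on S x \<Longrightarrow> continuous_on S (\<lambda>s. f (x s, u))"
  by (rule continuous_on_compose2[OF lipschitz_on_continuous_on[of M UNIV "\<lambda>x. f (x, u)"]])
     (use f_lip in auto)

text \<open>The penalty force is not globally Lipschitz, so it is composed with the projection onto
  the convex hull of \<open>C\<close>, which changes nothing on \<open>C\<close>. The global
  solution of the modified equation is a \<open>trajectory\<close>, hence stays in \<open>C\<close>,
  and therefore solves the original equation.\<close>

lemma ex_solution_step_control:
  fixes w :: "nat \<Rightarrow> 'b"
  assumes g: "g > 2 * M / \<eta>"
    and large: "\<And>p. p \<in> C \<Longrightarrow> E g p \<ge> 2 * M / \<eta> \<Longrightarrow> norm (G g p) \<ge> \<eta> * E g p"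
    and \<xi>: "E g \<xi> < g" and N: "N \<ge> 1" and w: "\<And>j. w j \<in> U"
  shows "\<exists>x. solves T f r \<psi> g \<xi> (\<lambda>t. w (nat \<lfloor>t / (T / real N)\<rfloor>)) x"
proof -
  define h where "h = T / real N"
  have h: "h > 0" "real N * h = T" using N T_pos by (auto simp: h_def)
  define v where "v t = w (nat \<lfloor>t / h\<rfloor>)" for t
  have vU: "v t \<in> U" for t using w by (simp add: v_def)
  have g0: "g > 0" using g M_pos \<eta>_pos by (smt (verit) divide_pos_pos)
  have \<xi>C: "\<xi> \<in> C" using mem_C_if_E_le[OF g0] \<xi> by simp
  define H where "H = convex hull C"
  have H: "closed H" "convex H" "H \<noteq> {}"
    using compact_imp_closed[OF compact_convex_hull[OF compact_C]] nonempty by (auto simp: H_def)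
  have CH: "C \<subseteq> H" unfolding H_def by (rule hull_subset)
  obtain L where L: "L-lipschitz_on H (G g)" using G_lipschitz_hull unfolding H_def by blast
  define G' where "G' p = G g (closest_point H p)" for p
  have G'_C: "G' p = G g p" if "p \<in> C" for p
    using closest_point_self[of p H] that CH by (auto simp: G'_def)
  have L0: "L \<ge> 0" using L lipschitz_on_nonneg by blast
  have G'_lip: "L-lipschitz_on UNIV G'"
  proof (rule lipschitz_onI[OF _ L0])
    fix p q :: 'a
    have "dist (G' p) (G' q) \<le> L * dist (closest_point H p) (closest_point H q)"
      unfolding G'_def by (intro lipschitz_onD[OF L] closest_point_in_set H)
    also have "\<dots> \<le> L * dist p q"
      using closest_point_lipschitz[OF H(2,1,3)] L0 by (intro mult_left_mono) auto
    finally show "dist (G' p) (G' q) \<le> L * dist p q" .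
  qed
  have G'_cont: "continuous_on S (\<lambda>s. G' (x s))" if "continuous_on S x" for S :: "real set" and x
    by (rule continuous_on_compose2[OF lipschitz_on_continuous_on[OF G'_lip] that]) auto
  define F where "F s p = f (p, v s) - G' p" for s p
  have F_lip: "(M + L)-lipschitz_on UNIV (F t)" for t
    unfolding F_def using f_lip vU by (intro lipschitz_on_diff G'_lip) auto
  have F_int: "(\<lambda>s. F s (x s)) integrable_on {0..T}" if x: "continuous_on {0..T} x" for x
    unfolding h(2)[symmetric]
  proof (rule integrable_on_steps)
    fix j assume j: "j < N"
    define a b where "a = real j * h" and "b = (real j + 1) * h"
    have "b \<le> real N * h" using j h unfolding b_def by (intro mult_right_mono) auto
    then have sub: "{a..b} \<subseteq> {0..T}" using h by (auto simp: a_def order_trans[rotated])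
    have xab: "continuous_on {a..b} x" using x sub by (rule continuous_on_subset)
    have "(\<lambda>s. f (x s, w j) - G' (x s)) integrable_on {a..b}"
      by (intro integrable_continuous_real continuous_intros continuous_on_f G'_cont xab w)
    then have "(\<lambda>s. F s (x s)) integrable_on {a..b}"
    proof (rule integrable_spike_finite[of "{b}", rotated 2])
      fix s assume "s \<in> {a..b} - {b}"
      then have "nat \<lfloor>s / h\<rfloor> = j" using h by (intro floor_step) (auto simp: a_def b_def)
      then show "F s (x s) = f (x s, w j) - G' (x s)" by (simp add: F_def v_def)
    qed simp
    then show "(\<lambda>s. F s (x s)) integrable_on {real j * h..(real j + 1) * h}" by (simp add: a_def b_def)
  qed (use h in simp)
  obtain x where x: "continuous_on {0..T} x"
    "\<And>t. t \<in> {0..T} \<Longrightarrow> x t = \<xi> + integral {0..t} (\<lambda>s. F s (x s))"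
    using integral_equation_lipschitz_solution[of 0 T "M + L" F \<xi>] T_pos F_lip F_int by auto
  define y where "y s = F s (x s)" for s
  have y_int: "y integrable_on {0..T}" unfolding y_def by (rule F_int[OF x(1)])
  obtain B where B: "B \<ge> 0" "\<And>s. s \<in> {0..T} \<Longrightarrow> norm (y s) \<le> B"
  proof -
    have "bounded ((\<lambda>s. x s - \<xi>) ` {0..T})"
      by (intro compact_imp_bounded compact_continuous_image continuous_intros x) auto
    then obtain B1 where B1: "B1 > 0" "\<And>s. s \<in> {0..T} \<Longrightarrow> norm (x s - \<xi>) \<le> B1"
      unfolding bounded_pos by auto
    have "bounded ((\<lambda>s. G' (x s)) ` {0..T})"
      by (intro compact_imp_bounded compact_continuous_image G'_cont x) auto
    then obtain B2 where B2: "B2 > 0" "\<And>s. s \<in> {0..T} \<Longrightarrow> norm (G' (x s)) \<le> B2"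
      unfolding bounded_pos by auto
    show ?thesis
    proof
      show "M + M * B1 + B2 \<ge> 0" using M_pos B1(1) B2(1) by simp
      fix s assume s: "s \<in> {0..T}"
      have "norm (y s) \<le> norm (f (x s, v s)) + norm (G' (x s))"
        unfolding y_def F_def by (rule norm_triangle_ineq4)
      also have "\<dots> \<le> (M + M * norm (x s - \<xi>)) + B2"
        by (intro add_mono norm_f_le vU \<xi>C B2 s)
      also have "\<dots> \<le> M + M * B1 + B2" using B1(2)[OF s] M_pos by simp
      finally show "norm (y s) \<le> M + M * B1 + B2" .
    qed
  qed
  have x_lip: "B-lipschitz_on {0..T} x"
  proof (rule lipschitz_on_leI[OF _ B(1)])
    fix s t assume st: "s \<in> {0..T}" "t \<in> {0..T}" "s \<le> t"
    have int: "y integrable_on {0..t}" "y integrable_on {s..t}"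
      using st by (auto intro!: integrable_on_subinterval[OF y_int])
    have "x t - x s = integral {s..t} y"
      using Henstock_Kurzweil_Integration.integral_combine[OF _ st(3) int(1)] st x(2)
      by (auto simp: y_def[abs_def] algebra_simps)
    moreover have "norm (integral {s..t} y) \<le> B * (t - s)"
      using has_integral_bound[OF B(1), of y "integral {s..t} y" s t] int(2) B(2) st by auto
    ultimately have "norm (x t - x s) \<le> B * (t - s)" by simp
    then show "dist (x s) (x t) \<le> B * dist s t"
      using st by (simp add: dist_commute[of "x s"] dist_norm[of "x t"] dist_real_def)
  qed
  have ac: "abs_continuous_on_interval 0 T x"
    by (rule lipschitz_on_imp_abs_continuous_on_interval[OF x_lip])
  \<comment> \<open>The control jumps at the grid points. They include \<open>T = N * h\<close>,
    where \<open>nat \<lfloor>t / h\<rfloor>\<close> is already \<open>N\<close>, beyond the last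
    step.\<close>
  define Z where "Z = (\<lambda>j. real j * h) ` {..N}"
  have Z: "negligible Z" unfolding Z_def by (intro negligible_finite) simp
  have deriv: "(x has_vector_derivative y t) (at t within {0..T})" if t: "t \<in> {0..T} - Z" for t
  proof -
    have "t \<noteq> T" using t h by (force simp: Z_def)
    then have "t < real N * h" using t h by auto
    with h t obtain j where j: "j < N" "real j * h \<le> t" "t < (real j + 1) * h"
      using ex_step[of h t N] by auto
    moreover have "t \<noteq> real j * h" using t j by (auto simp: Z_def)
    ultimately have tj: "real j * h < t" by simp
    have tS: "t \<in> {real j * h <..< (real j + 1) * h}" using tj j by simp
    have eq: "f (x s, w j) - G' (x s) = y s" if "s \<in> {real j * h <..< (real j + 1) * h}" for s
    proof -
      have "nat \<lfloor>s / h\<rfloor> = j" using h that by (intro floor_step) auto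
      then show ?thesis by (simp add: y_def F_def v_def)
    qed
    have "continuous_on {0..T} (\<lambda>s. f (x s, w j) - G' (x s))"
      by (intro continuous_intros continuous_on_f G'_cont x w)
    then have "((\<lambda>s. f (x s, w j) - G' (x s)) \<longlongrightarrow> f (x t, w j) - G' (x t)) (at t within {0..T})"
      using t by (auto simp: continuous_on_def)
    then have "(y \<longlongrightarrow> y t) (at t within {0..T})"
      unfolding eq[OF tS]
      by (rule Lim_transform_within_openin[where S = "{0..T} \<inter> {real j * h <..< (real j + 1) * h}"])
         (use tS t eq in \<open>auto intro: openin_open_Int\<close>)
    then have cont: "continuous (at t within {0..T}) y" by (simp add: continuous_within)
    have "((\<lambda>t. integral {0..t} y) has_vector_derivative y t) (at t within {0..T})"
      using integral_has_vector_derivative_continuous_at[OF y_int, of t "{}"] cont t by simp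
    then have "((\<lambda>t. \<xi> + integral {0..t} y) has_vector_derivative y t) (at t within {0..T})"
      by (auto intro!: derivative_eq_intros)
    then show ?thesis
      by (rule has_vector_derivative_transform[rotated 2]) (use t x(2) in \<open>auto simp: y_def[abs_def]\<close>)
  qed
  have traj: "trajectory g x"
    unfolding trajectory_def
  proof (intro conjI ac exI[of _ Z] Z ballI impI)
    fix t assume t: "t \<in> {0..T} - Z" "x t \<in> C"
    have "norm (f (x t, v t)) \<le> M" using f_bound t vU by blast
    moreover have "y t = f (x t, v t) - G g (x t)" using G'_C t by (simp add: y_def F_def)
    ultimately show "\<exists>F. norm F \<le> M \<and> (x has_vector_derivative F - G g (x t)) (at t within {0..T})"
      using deriv[OF t(1)] by auto
  qed
  have x0: "x 0 = \<xi>" using x(2)[of 0] T_pos by simp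
  have xC: "x t \<in> C" if "t \<in> {0..T}" for t
    using trajectory_stays[OF g large traj _ that] x0 \<xi> mem_C_if_E_le[OF g0] by (simp add: less_imp_le)
  have "solves T f r \<psi> g \<xi> v x"
    unfolding solves_def
  proof (intro conjI ac x0)
    have "(x has_vector_derivative f (x t, v t) - (\<Sum>i=1..r. (g * exp (g * \<psi> i (x t))) *\<^sub>R gradient (\<psi> i) (x t)))
        (at t within {0..T})" if "t \<in> {0..T} - Z" for t
      using deriv[OF that] G'_C[OF xC] that by (simp add: y_def F_def penalty_force_def)
    then show "AE t in lebesgue_on {0..T}. (x has_vector_derivative f (x t, v t) -
        (\<Sum>i=1..r. (g * exp (g * \<psi> i (x t))) *\<^sub>R gradient (\<psi> i) (x t))) (at t within {0..T})"
      using Z by (subst AE_lebesgue_on_negligible_iff) auto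
  qed
  then show ?thesis unfolding v_def[abs_def] h_def by blast
qed

end

section \<open>Sampled controls\<close>

lemma sum_integral_steps:
  fixes \<rho> :: "real \<Rightarrow> 'd::banach"
  assumes "h \<ge> 0" "\<rho> integrable_on {0..real N * h}"
  shows "(\<Sum>j<N. integral {real j * h..(real j + 1) * h} \<rho>) = integral {0..real N * h} \<rho>"
  using assms(2)
proof (induction N)
  case 0
  show ?case by simp
next
  case (Suc N)
  have le: "0 \<le> real N * h" "real N * h \<le> real (Suc N) * h" using assms(1) by (auto simp: mult_right_mono)
  have "\<rho> integrable_on {0..real N * h}"
    by (rule integrable_on_subinterval[OF Suc.prems]) (use le in auto)
  with Suc.IH Henstock_Kurzweil_Integration.integral_combine[OF le Suc.prems]
  show ?case by (simp add: add.commute)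
qed

text \<open>Up to time \<open>t\<close> there are only complete steps, apart from a single
  interrupted one; the surcharge \<open>B\<close> is therefore paid once and not once per
  step.\<close>

lemma integral_steps_le:
  fixes \<kappa> :: "real \<Rightarrow> real"
  assumes h: "h > 0" and A: "\<And>j. j < N \<Longrightarrow> A j \<ge> 0" and B: "B \<ge> 0"
    and int: "\<And>j. j < N \<Longrightarrow> \<kappa> integrable_on {real j * h..(real j + 1) * h}"
    and full: "\<And>j. j < N \<Longrightarrow> integral {real j * h..(real j + 1) * h} \<kappa> \<le> A j"
    and partial: "\<And>j t. j < N \<Longrightarrow> t \<in> {real j * h..(real j + 1) * h} \<Longrightarrow> integral {real j * h..t} \<kappa> \<le> A j + B"
    and t: "t \<in> {0..real N * h}"
  shows "integral {0..t} \<kappa> \<le> (\<Sum>j<N. A j) + B"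
proof (cases "t = real N * h")
  case True
  have "integral {0..t} \<kappa> = (\<Sum>j<N. integral {real j * h..(real j + 1) * h} \<kappa>)"
    using True h int by (simp add: sum_integral_steps integrable_on_steps)
  also have "\<dots> \<le> (\<Sum>j<N. A j)" using full by (intro sum_mono) auto
  finally show ?thesis using B by simp
next
  case False
  with t h obtain j where j: "j < N" "real j * h \<le> t" "t < (real j + 1) * h"
    using ex_step[of h t N] by auto
  have int0: "\<kappa> integrable_on {0..real j * h}"
    using h int j(1) by (intro integrable_on_steps) auto
  have "\<kappa> integrable_on {real j * h..t}"
    by (rule integrable_on_subinterval[OF int[OF j(1)]]) (use j in auto)
  with int0 have "\<kappa> integrable_on {0..t}"
    by (rule Henstock_Kurzweil_Integration.integrable_combine[rotated 2]) (use h j in auto)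
  then have "integral {0..t} \<kappa> = integral {0..real j * h} \<kappa> + integral {real j * h..t} \<kappa>"
    using Henstock_Kurzweil_Integration.integral_combine[of 0 "real j * h" t \<kappa>] h j by simp
  also have "integral {0..real j * h} \<kappa> = (\<Sum>i<j. integral {real i * h..(real i + 1) * h} \<kappa>)"
    using h int0 by (simp add: sum_integral_steps)
  also have "\<dots> \<le> (\<Sum>i<j. A i)" using full j(1) by (intro sum_mono) auto
  also have "integral {real j * h..t} \<kappa> \<le> A j + B" using partial[OF j(1), of t] j by auto
  also have "(\<Sum>i<j. A i) + (A j + B) = (\<Sum>i<Suc j. A i) + B" by simp
  also have "(\<Sum>i<Suc j. A i) \<le> (\<Sum>i<N. A i)" using A j(1) by (intro sum_mono2) auto
  finally show ?thesis by simp
qed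

text \<open>A hyperplane strictly separating the mean from \<open>S\<close> would separate it from
  all values of \<phi>, and integrating that inequality gives a contradiction.\<close>

lemma integral_mean_mem_convex:
  fixes \<phi> :: "real \<Rightarrow> 'd::euclidean_space"
  assumes "convex S" "closed S" "a < b" "\<phi> integrable_on {a..b}" "\<And>t. t \<in> {a..b} \<Longrightarrow> \<phi> t \<in> S"
  shows "integral {a..b} \<phi> /\<^sub>R (b - a) \<in> S"
proof (rule ccontr)
  assume "integral {a..b} \<phi> /\<^sub>R (b - a) \<notin> S"
  then obtain p q where pq: "inner p (integral {a..b} \<phi> /\<^sub>R (b - a)) < q" "\<forall>s\<in>S. inner p s > q"
    using separating_hyperplane_closed_point[OF assms(1,2)] by metis
  have I: "((\<lambda>t. inner p (\<phi> t)) has_integral inner p (integral {a..b} \<phi>)) {a..b}"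
    using has_integral_linear[OF integrable_integral[OF assms(4)] bounded_linear_inner_right[of p]]
    by (simp add: o_def)
  have J: "((\<lambda>t. q) has_integral q * (b - a)) {a..b}"
    using has_integral_const_real[of q a b] assms(3) by (simp add: mult.commute)
  have "q * (b - a) \<le> inner p (integral {a..b} \<phi>)"
    by (rule has_integral_le[OF J I]) (use pq(2) assms(5) in \<open>auto intro: less_imp_le\<close>)
  with pq(1) assms(3) show False by (simp add: field_simps)
qed

context penalized_system
begin

text \<open>A control takes values in \<open>U\<close> only almost everywhere, whereas the bounds on
  \<open>f\<close> hold over \<open>U\<close>. Redefining it on a null set removes the exceptions
  without affecting the differential equation.\<close>

lemma control_representative:
  assumes "u \<in> controls T U"
  obtains v where "\<And>t. v t \<in> U" "v \<in> borel_measurable (lebesgue_on {0..T})"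
    "AE t in lebesgue_on {0..T}. v t = u t"
proof -
  have u: "u \<in> borel_measurable (lebesgue_on {0..T})" "AE t in lebesgue_on {0..T}. u t \<in> U"
    using assms by (auto simp: controls_def)
  obtain w where w: "w \<in> U" using U_nonempty by blast
  define v where "v t = (if u t \<in> U then u t else w)" for t
  have UB: "U \<in> sets borel" by (rule borel_closed[OF compact_imp_closed[OF U_compact]])
  show ?thesis
  proof
    show "v t \<in> U" for t using w by (simp add: v_def)
    have "{t \<in> space (lebesgue_on {0..T}). u t \<in> U} \<in> sets (lebesgue_on {0..T})"
      using measurable_sets[OF u(1) UB] by (simp add: vimage_def Int_def conj_commute)
    then show "v \<in> borel_measurable (lebesgue_on {0..T})"
      unfolding v_def by (intro measurable_If u(1)) auto
    show "AE t in lebesgue_on {0..T}. v t = u t"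
      using u(2) by eventually_elim (simp add: v_def)
  qed
qed

lemma f_control_integrable:
  assumes z: "z \<in> C" and vU: "\<And>t. v t \<in> U" and v: "v \<in> borel_measurable (lebesgue_on {0..T})"
  shows "(\<lambda>s. f (z, v s)) integrable_on {0..T}"
proof (rule measurable_bounded_by_integrable_imp_integrable)
  have UB: "U \<in> sets borel" by (rule borel_closed[OF compact_imp_closed[OF U_compact]])
  have "continuous_on U (\<lambda>w. f (z, w))"
    by (rule continuous_on_compose2[OF f_cont]) (use z in \<open>auto intro!: continuous_intros\<close>)
  \<comment> \<open>Continuity in the control is known only on \<open>U\<close>. Extension by 0
    yields a Borel function on the whole space, which can be composed with the measurable
    \<open>v\<close>.\<close>
  then have "(\<lambda>w. indicator U w *\<^sub>R f (z, w)) \<in> borel_measurable borel"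
    by (rule borel_measurable_continuous_on_indicator[OF UB])
  from measurable_compose[OF v this] vU
  show "(\<lambda>s. f (z, v s)) \<in> borel_measurable (lebesgue_on {0..T})" by simp
  show "(\<lambda>s. M) integrable_on {0..T}" by (rule integrable_const_ivl)
  show "norm (f (z, v s)) \<le> M" for s using f_bound z vU by blast
qed simp

lemma ex_averaged_control:
  assumes z: "z \<in> C" and vU: "\<And>t. v t \<in> U" and v: "v \<in> borel_measurable (lebesgue_on {0..T})"
    and ab: "0 \<le> a" "a < b" "b \<le> T"
  obtains w where "w \<in> U" "integral {a..b} (\<lambda>s. f (z, v s)) = (b - a) *\<^sub>R f (z, w)"
proof -
  have "compact ((\<lambda>w. f (z, w)) ` U)"
    by (intro compact_continuous_image U_compact continuous_on_compose2[OF f_cont])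
       (use z in \<open>auto intro!: continuous_intros\<close>)
  then have "integral {a..b} (\<lambda>s. f (z, v s)) /\<^sub>R (b - a) \<in> (\<lambda>w. f (z, w)) ` U"
    using f_convex vU ab
    by (intro integral_mean_mem_convex compact_imp_closed integrable_on_subinterval[OF f_control_integrable[OF z vU v]])
       auto
  then obtain w where w: "w \<in> U" "f (z, w) = integral {a..b} (\<lambda>s. f (z, v s)) /\<^sub>R (b - a)" by auto
  show ?thesis by (rule that[OF w(1)]) (use ab in \<open>simp add: w(2)\<close>)
qed

text \<open>Bounds the integral of a majorant of the speeds of both compared trajectories:
  \<open>M\<close> for the dynamics, and \<open>Mbar\<psi> * E\<close> for the force along each of
  the two, hence the factor 2.\<close>

definition travel_bound :: "real \<Rightarrow> real" where
  "travel_bound K = M * T + 2 * Mbar\<psi> * K"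

text \<open>The bracket collects the freezing errors, proportional to the distance travelled, and
  the surcharge \<open>8 * R * M\<close> for one interrupted step. The exponential is the Gronwall
  factor. No occurrence of \<open>g\<close> remains.\<close>

definition error_const :: "real \<Rightarrow> real \<Rightarrow> real" where
  "error_const R K = ((8 * R * M + 8 * M) * travel_bound K + 8 * R * M) * exp (2 * M * T + 8 * M\<psi> * K)"

text \<open>The velocities are not bounded uniformly in \<open>g\<close>, but the total variation of the
  trajectories is, and the sampling errors of the individual steps only have to be summed up.\<close>

lemma sampled_control_error:
  fixes w :: "nat \<Rightarrow> 'b"
  assumes g: "g > 0" and N: "N \<ge> 1" and h_def: "h = T / real N"
    and vU: "\<And>t. v t \<in> U" and v: "v \<in> borel_measurable (lebesgue_on {0..T})" and w: "\<And>j. w j \<in> U"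
    and xC: "\<And>t. t \<in> {0..T} \<Longrightarrow> x t \<in> C" and yC: "\<And>t. t \<in> {0..T} \<Longrightarrow> y t \<in> C"
    and acx: "abs_continuous_on_interval 0 T x" and acy: "abs_continuous_on_interval 0 T y"
    and xy0: "x 0 = y 0" and Z: "negligible Z"
    and x': "\<And>t. t \<in> {0..T} - Z \<Longrightarrow>
        (x has_vector_derivative (f (x t, v t) - G g (x t))) (at t within {0..T})"
    and y': "\<And>t. t \<in> {0..T} - Z \<Longrightarrow>
        (y has_vector_derivative (f (y t, w (nat \<lfloor>t / h\<rfloor>)) - G g (y t))) (at t within {0..T})"
    and mean: "\<And>j. j < N \<Longrightarrow> integral {real j * h..(real j + 1) * h} (\<lambda>s. f (x (real j * h), v s))
        = h *\<^sub>R f (x (real j * h), w j)"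
    and Kx: "integral {0..T} (\<lambda>t. E g (x t)) \<le> K" and Ky: "integral {0..T} (\<lambda>t. E g (y t)) \<le> K"
    and R: "\<And>p. p \<in> C \<Longrightarrow> norm p \<le> R" and t: "t \<in> {0..T}"
  shows "(norm (x t - y t))\<^sup>2 \<le> error_const R K * h"
proof -
  have h: "h > 0" "real N * h = T" using N T_pos by (auto simp: h_def)
  have R0: "R \<ge> 0" using order_trans[OF norm_ge_zero R[OF xC[of 0]]] T_pos by simp
  have x_cont: "continuous_on {0..T} x" and y_cont: "continuous_on {0..T} y"
    by (intro abs_continuous_on_interval_imp_continuous_on acx acy)+
  have Ex_cont: "continuous_on {0..T} (\<lambda>t. E g (x t))" and Ey_cont: "continuous_on {0..T} (\<lambda>t. E g (y t))"
    using x_cont y_cont by (auto intro: continuous_on_compose2[OF continuous_on_E[of UNIV]])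
  \<comment> \<open>One majorant for the speeds of both trajectories, so that a single number
    \<open>\<omega> j\<close> bounds both displacements on step \<open>j\<close>.\<close>
  define \<rho> where "\<rho> t = M + Mbar\<psi> * (E g (x t) + E g (y t))" for t
  have \<rho>_cont: "continuous_on {0..T} \<rho>" unfolding \<rho>_def by (intro continuous_intros Ex_cont Ey_cont)
  have \<rho>_int: "\<rho> integrable_on {0..T}" by (rule integrable_continuous_real[OF \<rho>_cont])
  have \<rho>0: "\<rho> t \<ge> 0" for t
    using E_pos[OF g] M_pos Mbar\<psi>_pos by (simp add: \<rho>_def add_nonneg_nonneg less_imp_le)
  have ExI: "(\<lambda>t. E g (x t)) integrable_on {0..T}" and EyI: "(\<lambda>t. E g (y t)) integrable_on {0..T}"
    by (intro integrable_continuous_real Ex_cont Ey_cont)+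
  have \<rho>_le: "integral {0..T} \<rho> \<le> travel_bound K"
  proof -
    have "(\<rho> has_integral M * T + Mbar\<psi> * (integral {0..T} (\<lambda>t. E g (x t)) + integral {0..T} (\<lambda>t. E g (y t)))) {0..T}"
      unfolding \<rho>_def
      using has_integral_const_real[of M 0 T] T_pos
      by (intro has_integral_add has_integral_mult_right integrable_integral ExI EyI) (simp add: mult.commute)
    moreover have "Mbar\<psi> * (integral {0..T} (\<lambda>t. E g (x t)) + integral {0..T} (\<lambda>t. E g (y t))) \<le> Mbar\<psi> * (K + K)"
      using Kx Ky Mbar\<psi>_pos by (intro mult_left_mono) auto
    ultimately show ?thesis by (simp add: integral_unique travel_bound_def algebra_simps)
  qed
  define \<omega> where "\<omega> j = integral {real j * h..(real j + 1) * h} \<rho>" for j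
  have step_sub: "{real j * h..(real j + 1) * h} \<subseteq> {0..T}" if "j < N" for j
  proof -
    have "(real j + 1) * h \<le> real N * h" using that h by (intro mult_right_mono) auto
    then show ?thesis using h by (auto intro: order_trans)
  qed
  have \<omega>0: "\<omega> j \<ge> 0" if "j < N" for j
    unfolding \<omega>_def using \<rho>0 integrable_on_subinterval[OF \<rho>_int step_sub[OF that]]
    by (intro integral_nonneg) auto
  have \<omega>_sum: "(\<Sum>j<N. \<omega> j) \<le> travel_bound K"
    using sum_integral_steps[of h \<rho> N] h \<rho>_int \<rho>_le by (simp add: \<omega>_def)
  have disp: "norm (\<xi> s - \<xi> (real j * h)) \<le> \<omega> j"
    if j: "j < N" and s: "s \<in> {real j * h..(real j + 1) * h}"
      and ac: "abs_continuous_on_interval 0 T \<xi>"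
      and \<xi>': "\<And>t. t \<in> {0..T} - Z \<Longrightarrow> \<exists>d. norm d \<le> \<rho> t \<and> (\<xi> has_vector_derivative d) (at t within {0..T})"
    for \<xi> :: "real \<Rightarrow> 'a" and s j
  proof -
    have sub: "{real j * h..s} \<subseteq> {0..T}" using step_sub[OF j] s by auto
    have \<rho>s: "\<rho> integrable_on {real j * h..s}" by (rule integrable_on_subinterval[OF \<rho>_int sub])
    have "norm (\<xi> s - \<xi> (real j * h)) \<le> integral {real j * h..s} \<rho>"
    proof (rule abs_continuous_norm_increment_le[where Z = Z and B = \<rho>])
      show "real j * h \<le> s" using s by simp
      then have "0 \<le> real j * h" "s \<le> T" using sub by auto
      then show "abs_continuous_on_interval (real j * h) s \<xi>"
        by (rule abs_continuous_on_interval_subset[OF ac])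
      show "negligible Z" by (fact Z)
      show "(\<rho> has_integral integral {real j * h..s} \<rho>) {real j * h..s}"
        by (rule integrable_integral[OF \<rho>s])
      show "0 \<le> \<rho> t" for t by (rule \<rho>0)
      fix t assume "t \<in> {real j * h..s} - Z"
      with sub have "t \<in> {0..T} - Z" by auto
      from \<xi>'[OF this] show "\<exists>d. norm d \<le> \<rho> t \<and> (\<xi> has_vector_derivative d) (at t within {real j * h..s})"
        using has_vector_derivative_within_subset[OF _ sub] by blast
    qed
    also have "\<dots> \<le> \<omega> j"
      unfolding \<omega>_def using s \<rho>s \<rho>0
      by (intro integral_subset_le integrable_on_subinterval[OF \<rho>_int step_sub[OF j]]) auto
    finally show ?thesis .
  qed
  have vel: "norm (f (p, a) - G g p) \<le> M + Mbar\<psi> * E g p" if "p \<in> C" "a \<in> U" for p a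
  proof -
    have "norm (f (p, a)) \<le> M" using f_bound that by blast
    then show ?thesis using norm_triangle_ineq4[of "f (p, a)" "G g p"] norm_G_le[OF g that(1)] by linarith
  qed
  have \<rho>_ge: "M + Mbar\<psi> * E g (x t) \<le> \<rho> t" "M + Mbar\<psi> * E g (y t) \<le> \<rho> t" for t
    using E_pos[OF g] Mbar\<psi>_pos by (auto simp: \<rho>_def less_imp_le)
  have disp_x: "norm (x s - x (real j * h)) \<le> \<omega> j" if "j < N" "s \<in> {real j * h..(real j + 1) * h}" for j s
  proof (rule disp[OF that acx])
    fix t assume t: "t \<in> {0..T} - Z"
    have "norm (f (x t, v t) - G g (x t)) \<le> \<rho> t"
      using vel[OF xC vU, of t t] \<rho>_ge(1)[of t] t by simp
    with x'[OF t] show "\<exists>d. norm d \<le> \<rho> t \<and> (x has_vector_derivative d) (at t within {0..T})" by blast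
  qed
  have disp_y: "norm (y s - y (real j * h)) \<le> \<omega> j" if "j < N" "s \<in> {real j * h..(real j + 1) * h}" for j s
  proof (rule disp[OF that acy])
    fix t assume t: "t \<in> {0..T} - Z"
    have "norm (f (y t, w (nat \<lfloor>t / h\<rfloor>)) - G g (y t)) \<le> \<rho> t"
      using vel[OF yC w, of t "nat \<lfloor>t / h\<rfloor>"] \<rho>_ge(2)[of t] t by simp
    with y'[OF t] show "\<exists>d. norm d \<le> \<rho> t \<and> (y has_vector_derivative d) (at t within {0..T})" by blast
  qed
  define D where "D t = inner (x t - y t) (x t - y t)" for t
  define \<alpha> where "\<alpha> t = 2 * M + 4 * M\<psi> * (E g (x t) + E g (y t))" for t
  define c where "c = 8 * R * M + 8 * M"
  define q where "q j = x (real j * h) - y (real j * h)" for j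
  define \<Delta> where "\<Delta> j s = f (x (real j * h), v s) - f (x (real j * h), w j)" for j s
  define \<kappa> where "\<kappa> s = c * \<omega> (nat \<lfloor>s / h\<rfloor>) + 2 * inner (q (nat \<lfloor>s / h\<rfloor>)) (\<Delta> (nat \<lfloor>s / h\<rfloor>) s)" for s
  have c0: "c \<ge> 0" using R0 M_pos by (simp add: c_def)
  have xyR: "norm (x s - y s) \<le> 2 * R" if "s \<in> {0..T}" for s
    using norm_triangle_ineq4[of "x s" "y s"] R[OF xC[OF that]] R[OF yC[OF that]] by linarith
  have grid: "real j * h \<in> {0..T}" if "j < N" for j using step_sub[OF that] h by auto
  have \<Delta>_norm: "norm (\<Delta> j s) \<le> 2 * M" if "j < N" for j s
  proof -
    have "norm (f (x (real j * h), v s)) \<le> M" "norm (f (x (real j * h), w j)) \<le> M"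
      using f_bound xC[OF grid[OF that]] vU w by blast+
    then show ?thesis
      unfolding \<Delta>_def using norm_triangle_ineq4[of "f (x (real j * h), v s)" "f (x (real j * h), w j)"] by linarith
  qed
  \<comment> \<open>The velocity difference is split four ways: freezing the state for
    \<open>v\<close>, unfreezing it for \<open>w j\<close>, the control mismatch, and the penalty.
    The bounds \<open>2 * R * M\<close>, \<open>2 * R * M\<close> and \<open>4 * M\<close> for the
    multiples of \<open>\<omega> j\<close>, doubled, make up \<open>c\<close>; the quadratic terms
    make up \<alpha>.\<close>
  have key: "inner (f (x s, v s) - G g (x s) - (f (y s, w j) - G g (y s))) (2 *\<^sub>R (x s - y s))
      \<le> \<alpha> s * D s + (c * \<omega> j + 2 * inner (q j) (\<Delta> j s))"
    if j: "j < N" and s: "s \<in> {real j * h..(real j + 1) * h}" for j s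
  proof -
    have sT: "s \<in> {0..T}" using step_sub[OF j] s by blast
    define e where "e = x s - y s"
    define z where "z = x (real j * h)"
    have e: "norm e \<le> 2 * R" unfolding e_def by (rule xyR[OF sT])
    have dx: "norm (x s - z) \<le> \<omega> j" unfolding z_def by (rule disp_x[OF j s])
    have dy: "norm (y s - y (real j * h)) \<le> \<omega> j" by (rule disp_y[OF j s])
    have 1: "inner e (f (x s, v s) - f (z, v s)) \<le> 2 * R * (M * \<omega> j)"
    proof -
      have "norm (f (x s, v s) - f (z, v s)) \<le> M * norm (x s - z)"
        using f_lip vU by (intro lipschitz_on_normD) auto
      also have "\<dots> \<le> M * \<omega> j" using dx M_pos by (intro mult_left_mono) auto
      finally have "norm e * norm (f (x s, v s) - f (z, v s)) \<le> 2 * R * (M * \<omega> j)"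
        using e R0 by (intro mult_mono) auto
      then show ?thesis using norm_cauchy_schwarz[of e "f (x s, v s) - f (z, v s)"] by linarith
    qed
    have 2: "inner e (f (z, w j) - f (y s, w j)) \<le> 2 * R * (M * \<omega> j) + M * (norm e)\<^sup>2"
    proof -
      have "norm (f (z, w j) - f (y s, w j)) \<le> M * norm (z - y s)"
        using f_lip w by (intro lipschitz_on_normD) auto
      also have "norm (z - y s) \<le> \<omega> j + norm e"
        using norm_triangle_ineq[of "z - x s" e] dx by (simp add: e_def norm_minus_commute)
      finally have "norm (f (z, w j) - f (y s, w j)) \<le> M * (\<omega> j + norm e)"
        using M_pos by simp
      then have "norm e * norm (f (z, w j) - f (y s, w j)) \<le> norm e * (M * (\<omega> j + norm e))"
        by (intro mult_left_mono) auto
      also have "\<dots> = norm e * (M * \<omega> j) + M * (norm e)\<^sup>2" by (simp add: algebra_simps power2_eq_square)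
      also have "norm e * (M * \<omega> j) \<le> 2 * R * (M * \<omega> j)"
        using e M_pos \<omega>0[OF j] by (intro mult_right_mono) auto
      finally show ?thesis using norm_cauchy_schwarz[of e "f (z, w j) - f (y s, w j)"] by linarith
    qed
    have 3: "inner e (\<Delta> j s) \<le> inner (q j) (\<Delta> j s) + 4 * M * \<omega> j"
    proof -
      have "e - q j = (x s - z) - (y s - y (real j * h))" by (simp add: e_def q_def z_def)
      then have "norm (e - q j) \<le> 2 * \<omega> j"
        using norm_triangle_ineq4[of "x s - z" "y s - y (real j * h)"] dx dy by simp
      then have "norm (e - q j) * norm (\<Delta> j s) \<le> 2 * \<omega> j * (2 * M)"
        using \<Delta>_norm[OF j] \<omega>0[OF j] by (intro mult_mono) auto
      then show ?thesis
        using norm_cauchy_schwarz[of "e - q j" "\<Delta> j s"] by (simp add: inner_diff_left mult_ac)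
    qed
    have 4: "inner e (G g (y s) - G g (x s)) \<le> 2 * M\<psi> * (E g (x s) + E g (y s)) * (norm e)\<^sup>2"
      using penalty_force_hypomonotone[OF g yC[OF sT] xC[OF sT]]
      by (simp add: e_def inner_diff_right inner_diff_left inner_commute algebra_simps)
    have "f (x s, v s) - G g (x s) - (f (y s, w j) - G g (y s))
        = (f (x s, v s) - f (z, v s)) + (f (z, w j) - f (y s, w j)) + \<Delta> j s + (G g (y s) - G g (x s))"
      by (simp add: \<Delta>_def z_def)
    then have "inner (f (x s, v s) - G g (x s) - (f (y s, w j) - G g (y s))) (2 *\<^sub>R (x s - y s))
        = 2 * (inner e (f (x s, v s) - f (z, v s)) + inner e (f (z, w j) - f (y s, w j))
          + inner e (\<Delta> j s) + inner e (G g (y s) - G g (x s)))"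
      unfolding e_def[symmetric] by (simp only: inner_scaleR_right inner_add_right inner_commute[of _ e])
    also have "\<dots> \<le> 2 * (2 * R * (M * \<omega> j) + (2 * R * (M * \<omega> j) + M * (norm e)\<^sup>2)
        + (inner (q j) (\<Delta> j s) + 4 * M * \<omega> j) + 2 * M\<psi> * (E g (x s) + E g (y s)) * (norm e)\<^sup>2)"
      by (intro mult_left_mono add_mono 1 2 3 4) simp
    also have "\<dots> = \<alpha> s * D s + (c * \<omega> j + 2 * inner (q j) (\<Delta> j s))"
      unfolding \<alpha>_def D_def c_def e_def[symmetric] dot_square_norm by (simp add: algebra_simps)
    finally show ?thesis .
  qed
  have \<kappa>_step: "\<kappa> s = c * \<omega> j + 2 * inner (q j) (\<Delta> j s)"
    if "j < N" "real j * h \<le> s" "s < (real j + 1) * h" for j s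
    using floor_step[OF h(1) that(2,3)] by (simp add: \<kappa>_def)
  define I where "I j t = integral {real j * h..t} (\<lambda>s. f (x (real j * h), v s))" for j t
  have \<kappa>_int: "(\<kappa> has_integral c * \<omega> j * (t - real j * h)
      + 2 * inner (q j) (I j t - (t - real j * h) *\<^sub>R f (x (real j * h), w j))) {real j * h..t}"
    if j: "j < N" and t: "t \<in> {real j * h..(real j + 1) * h}" for j t
  proof -
    have sub: "{real j * h..t} \<subseteq> {0..T}" using step_sub[OF j] t by auto
    have "(\<lambda>s. f (x (real j * h), v s)) integrable_on {real j * h..t}"
      by (rule integrable_on_subinterval[OF f_control_integrable[OF xC[OF grid[OF j]] vU v] sub])
    then have "((\<lambda>s. f (x (real j * h), v s)) has_integral I j t) {real j * h..t}"
      unfolding I_def by (rule integrable_integral)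
    moreover have "((\<lambda>s. f (x (real j * h), w j)) has_integral (t - real j * h) *\<^sub>R f (x (real j * h), w j)) {real j * h..t}"
      using has_integral_const_real[of "f (x (real j * h), w j)" "real j * h" t] t by simp
    ultimately have "(\<Delta> j has_integral I j t - (t - real j * h) *\<^sub>R f (x (real j * h), w j)) {real j * h..t}"
      unfolding \<Delta>_def by (rule has_integral_diff)
    from has_integral_linear[OF this bounded_linear_inner_right[of "q j"]]
    have "((\<lambda>s. inner (q j) (\<Delta> j s)) has_integral
        inner (q j) (I j t - (t - real j * h) *\<^sub>R f (x (real j * h), w j))) {real j * h..t}"
      by (simp add: o_def)
    then have "((\<lambda>s. c * \<omega> j + 2 * inner (q j) (\<Delta> j s)) has_integral c * \<omega> j * (t - real j * h)
      + 2 * inner (q j) (I j t - (t - real j * h) *\<^sub>R f (x (real j * h), w j))) {real j * h..t}"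
      using has_integral_const_real[of "c * \<omega> j" "real j * h" t] t
      by (intro has_integral_add has_integral_mult_right) (simp_all add: mult.commute)
    then show ?thesis
      by (rule has_integral_spike_finite[of "{(real j + 1) * h}", rotated 2]) (use \<kappa>_step[OF j] t in auto)
  qed
  have \<kappa>_le: "integral {0..\<tau>} \<kappa> \<le> (\<Sum>j<N. c * \<omega> j * h) + 8 * R * M * h" if \<tau>: "\<tau> \<in> {0..T}" for \<tau>
  proof (rule integral_steps_le[OF h(1)])
    show "0 \<le> c * \<omega> j * h" if "j < N" for j using c0 \<omega>0[OF that] h by simp
    show "0 \<le> 8 * R * M * h" using R0 M_pos h by simp
    show "\<kappa> integrable_on {real j * h..(real j + 1) * h}" if "j < N" for j
      using \<kappa>_int[OF that, of "(real j + 1) * h"] h by (auto simp: integrable_on_def)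
    \<comment> \<open>On a complete step the mismatch cancels by \<open>mean\<close>, and only the
      freezing error survives.\<close>
    show "integral {real j * h..(real j + 1) * h} \<kappa> \<le> c * \<omega> j * h" if j: "j < N" for j
    proof -
      have len: "(real j + 1) * h - real j * h = h" by (simp add: algebra_simps)
      have "(real j + 1) * h \<in> {real j * h..(real j + 1) * h}" using h by simp
      from integral_unique[OF \<kappa>_int[OF j this]] show ?thesis
        unfolding len by (simp add: I_def mean[OF j])
    qed
    \<comment> \<open>An interrupted step has no cancellation. The mismatch is bounded crudely by
      \<open>2 * (2 * R) * (2 * M * h)\<close>, which gives the surcharge.\<close>
    show "integral {real j * h..t} \<kappa> \<le> c * \<omega> j * h + 8 * R * M * h"
      if j: "j < N" and t: "t \<in> {real j * h..(real j + 1) * h}" for j t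
    proof -
      have len: "0 \<le> t - real j * h" "t - real j * h \<le> h" using t by (auto simp: algebra_simps)
      have xj: "x (real j * h) \<in> C" by (rule xC[OF grid[OF j]])
      have sub: "{real j * h..t} \<subseteq> {0..T}" using step_sub[OF j] t by auto
      have "(\<lambda>s. f (x (real j * h), v s)) integrable_on cbox (real j * h) t"
        using integrable_on_subinterval[OF f_control_integrable[OF xj vU v] sub] by simp
      from has_integral_bound[OF _ integrable_integral[OF this], of M]
      have "norm (I j t) \<le> M * (t - real j * h)"
        using f_bound xj vU M_pos t by (auto simp: I_def)
      also have "\<dots> \<le> M * h" using len M_pos by (intro mult_left_mono) auto
      finally have "norm (I j t) \<le> M * h" .
      moreover have "norm ((t - real j * h) *\<^sub>R f (x (real j * h), w j)) \<le> h * M"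
        using len f_bound xj w by (auto intro!: mult_mono)
      moreover have "h * M = M * h" by (rule mult.commute)
      ultimately have "norm (I j t - (t - real j * h) *\<^sub>R f (x (real j * h), w j)) \<le> 2 * M * h"
        using norm_triangle_ineq4[of "I j t" "(t - real j * h) *\<^sub>R f (x (real j * h), w j)"]
        by linarith
      then have "norm (q j) * norm (I j t - (t - real j * h) *\<^sub>R f (x (real j * h), w j)) \<le> (2 * R) * (2 * M * h)"
        using xyR[OF grid[OF j]] R0 by (intro mult_mono) (auto simp: q_def)
      then have "inner (q j) (I j t - (t - real j * h) *\<^sub>R f (x (real j * h), w j)) \<le> (2 * R) * (2 * M * h)"
        using norm_cauchy_schwarz[of "q j" "I j t - (t - real j * h) *\<^sub>R f (x (real j * h), w j)"] by linarith
      moreover have "c * \<omega> j * (t - real j * h) \<le> c * \<omega> j * h"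
        using len c0 \<omega>0[OF j] by (intro mult_left_mono) auto
      ultimately show ?thesis using integral_unique[OF \<kappa>_int[OF j t]] by simp
    qed
    show "\<tau> \<in> {0..real N * h}" using \<tau> h by simp
  qed
  define cc where "cc = (c * travel_bound K + 8 * R * M) * h"
  have \<kappa>_le': "integral {0..\<tau>} \<kappa> \<le> cc" if "\<tau> \<in> {0..T}" for \<tau>
  proof -
    have "(\<Sum>j<N. c * \<omega> j * h) = c * h * (\<Sum>j<N. \<omega> j)" by (simp add: sum_distrib_left mult_ac)
    also have "\<dots> \<le> c * h * travel_bound K" using \<omega>_sum c0 h by (intro mult_left_mono) auto
    finally show ?thesis using \<kappa>_le[OF that] by (simp add: cc_def algebra_simps)
  qed
  have \<kappa>_intT: "\<kappa> integrable_on {0..T}"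
    unfolding h(2)[symmetric]
  proof (rule integrable_on_steps)
    show "\<kappa> integrable_on {real j * h..(real j + 1) * h}" if "j < N" for j
      using \<kappa>_int[OF that, of "(real j + 1) * h"] h by (auto simp: integrable_on_def)
  qed (use h in simp)
  have D_cont: "continuous_on {0..T} D" unfolding D_def by (intro continuous_intros x_cont y_cont)
  have \<alpha>_cont: "continuous_on {0..T} \<alpha>" unfolding \<alpha>_def by (intro continuous_intros Ex_cont Ey_cont)
  have D_le: "D \<tau> \<le> cc + integral {0..\<tau>} (\<lambda>s. \<alpha> s * D s)" if \<tau>: "\<tau> \<in> {0..T}" for \<tau>
  proof -
    have sub: "{0..\<tau>} \<subseteq> {0..T}" using \<tau> by auto
    have "D \<tau> - D 0 \<le> integral {0..\<tau>} (\<lambda>s. \<alpha> s * D s) + integral {0..\<tau>} \<kappa>"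
    \<comment> \<open>The time \<open>T\<close> is excluded because it belongs to no half-open
      step.\<close>
    proof (rule abs_continuous_increment_le[where \<phi> = D and a = 0 and b = \<tau> and Z = "insert T Z"
          and B = "\<lambda>s. \<alpha> s * D s + \<kappa> s"])
      show "0 \<le> \<tau>" using \<tau> by simp
      have "GDERIV (\<lambda>p. inner p p) p :> 2 *\<^sub>R p" for p :: 'a
        unfolding gderiv_def by (auto intro!: derivative_eq_intros simp: inner_commute)
      note sq = this
      show "abs_continuous_on_interval 0 \<tau> D"
        unfolding D_def
        by (rule abs_continuous_on_interval_subset[OF abs_continuous_on_interval_compose_C1[OF
              abs_continuous_on_interval_diff[OF acx acy] sq]])
           (use \<tau> in \<open>auto intro!: continuous_intros\<close>)
      show "negligible (insert T Z)" using Z by simp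
      have "(\<lambda>s. \<alpha> s * D s) integrable_on {0..\<tau>}"
        by (intro integrable_continuous_real continuous_intros continuous_on_subset[OF \<alpha>_cont sub]
            continuous_on_subset[OF D_cont sub])
      then show "((\<lambda>s. \<alpha> s * D s + \<kappa> s) has_integral
          integral {0..\<tau>} (\<lambda>s. \<alpha> s * D s) + integral {0..\<tau>} \<kappa>) {0..\<tau>}"
        by (intro has_integral_add integrable_integral integrable_on_subinterval[OF \<kappa>_intT sub])
      fix s assume s: "s \<in> {0..\<tau>} - insert T Z"
      then have sT: "s \<in> {0..T} - Z" "s < real N * h" "0 \<le> s" using \<tau> h by auto
      obtain j where j: "j < N" "real j * h \<le> s" "s < (real j + 1) * h"
        using ex_step[OF h(1) sT(3,2)] .
      have fl: "nat \<lfloor>s / h\<rfloor> = j" using floor_step[OF h(1) j(2,3)] .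
      have "((\<lambda>t. x t - y t) has_vector_derivative
          f (x s, v s) - G g (x s) - (f (y s, w j) - G g (y s))) (at s within {0..T})"
        using has_vector_derivative_diff[OF x'[OF sT(1)] y'[OF sT(1)]] by (simp add: fl)
      from GDERIV_compose_has_vector_derivative[OF sq this]
      have "(D has_vector_derivative
          inner (f (x s, v s) - G g (x s) - (f (y s, w j) - G g (y s))) (2 *\<^sub>R (x s - y s))) (at s within {0..T})"
        unfolding D_def .
      then have "(D has_vector_derivative
          inner (f (x s, v s) - G g (x s) - (f (y s, w j) - G g (y s))) (2 *\<^sub>R (x s - y s))) (at s within {0..\<tau>})"
        by (rule has_vector_derivative_within_subset[OF _ sub])
      moreover have "inner (f (x s, v s) - G g (x s) - (f (y s, w j) - G g (y s))) (2 *\<^sub>R (x s - y s))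
          \<le> \<alpha> s * D s + \<kappa> s"
        using key[OF j(1), of s] j \<kappa>_step[OF j] by simp
      ultimately show "\<exists>d\<le>\<alpha> s * D s + \<kappa> s. (D has_vector_derivative d) (at s within {0..\<tau>})" by blast
    qed
    moreover have "D 0 = 0" using xy0 by (simp add: D_def)
    ultimately show ?thesis using \<kappa>_le'[OF \<tau>] by simp
  qed
  have \<alpha>0: "\<alpha> s \<ge> 0" for s
    using E_pos[OF g] M_pos M\<psi>_pos by (simp add: \<alpha>_def add_nonneg_nonneg less_imp_le)
  have "integral {0..t} \<alpha> \<le> integral {0..T} \<alpha>"
    using t \<alpha>0 by (intro integral_subset_le integrable_continuous_real \<alpha>_cont continuous_on_subset[OF \<alpha>_cont]) auto
  also have "\<dots> \<le> 2 * M * T + 8 * M\<psi> * K"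
  proof -
    have "(\<alpha> has_integral 2 * M * T + 4 * M\<psi> * (integral {0..T} (\<lambda>t. E g (x t)) + integral {0..T} (\<lambda>t. E g (y t)))) {0..T}"
      unfolding \<alpha>_def
      using has_integral_const_real[of "2 * M" 0 T] T_pos
      by (intro has_integral_add has_integral_mult_right integrable_integral ExI EyI) (simp add: mult.commute)
    moreover have "4 * M\<psi> * (integral {0..T} (\<lambda>t. E g (x t)) + integral {0..T} (\<lambda>t. E g (y t))) \<le> 4 * M\<psi> * (K + K)"
      using Kx Ky M\<psi>_pos by (intro mult_left_mono) auto
    ultimately show ?thesis by (simp add: integral_unique)
  qed
  finally have \<alpha>_le: "integral {0..t} \<alpha> \<le> 2 * M * T + 8 * M\<psi> * K" .
  have "integral {0..T} \<rho> \<ge> 0" using \<rho>0 \<rho>_int by (intro integral_nonneg) auto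
  with \<rho>_le have "travel_bound K \<ge> 0" by simp
  then have cc0: "cc \<ge> 0" using c0 R0 M_pos h by (simp add: cc_def)
  have "D t \<le> cc * exp (integral {0..t} \<alpha>)"
    using gronwall_integral[OF D_cont \<alpha>_cont \<alpha>0 D_le t] .
  also have "\<dots> \<le> cc * exp (2 * M * T + 8 * M\<psi> * K)"
    using \<alpha>_le cc0 by (intro mult_left_mono) auto
  also have "\<dots> = error_const R K * h"
    by (simp add: cc_def error_const_def c_def mult_ac)
  finally show ?thesis by (simp add: D_def dot_square_norm)
qed

end

section \<open>The sampled control and the choice of \<beta>\<close>

context penalized_system
begin

lemma step_control_mem_pc_controls:
  fixes w :: "nat \<Rightarrow> 'b"
  assumes "N \<ge> 1" "\<And>j. w j \<in> U"
  shows "(\<lambda>t. w (nat \<lfloor>t / (T / real N)\<rfloor>)) \<in> pc_controls T U N"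
  unfolding pc_controls_def
proof (intro CollectI ballI)
  fix j assume j: "j \<in> {1..N}"
  have h: "T / real N > 0" using assms(1) T_pos by simp
  \<comment> \<open>The shift by one reconciles the indices \<open>1..N\<close> of
    \<open>pc_controls\<close> with the floor, which counts from 0.\<close>
  have "w (nat \<lfloor>t / (T / real N)\<rfloor>) = w (j - 1)"
    if "t \<in> {(real j - 1) * (T / real N)..<real j * (T / real N)}" for t
    using floor_step[OF h, of "j - 1" t] that j by (simp add: of_nat_diff)
  then show "\<exists>wa\<in>U. \<forall>t\<in>{(real j - 1) * (T / real N)..<real j * (T / real N)}.
      w (nat \<lfloor>t / (T / real N)\<rfloor>) = wa"
    using assms(2) by blast
qed

lemma ex_sampled_control:
  assumes g: "g > 2 * M / \<eta>"
    and large: "\<And>p. p \<in> C \<Longrightarrow> E g p \<ge> 2 * M / \<eta> \<Longrightarrow> norm (G g p) \<ge> \<eta> * E g p"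
    and K: "\<And>x. trajectory g x \<Longrightarrow> E g (x 0) < g \<Longrightarrow> integral {0..T} (\<lambda>t. E g (x t)) \<le> K"
    and R: "\<And>p. p \<in> C \<Longrightarrow> norm p \<le> R"
    and \<xi>: "E g \<xi> < g" and u: "u \<in> controls T U" and x: "solves T f r \<psi> g \<xi> u x" and N: "N \<ge> 1"
  shows "\<exists>uN\<in>pc_controls T U N. (\<exists>xN. solves T f r \<psi> g \<xi> uN xN) \<and>
    (\<forall>xN. solves T f r \<psi> g \<xi> uN xN \<longrightarrow>
      (\<forall>t\<in>{0..T}. (norm (x t - xN t))\<^sup>2 \<le> error_const R K * (T / real N)))"
proof -
  define h where "h = T / real N"
  have h: "h > 0" "real N * h = T" using N T_pos by (auto simp: h_def)
  have g0: "g > 0" using g M_pos \<eta>_pos by (smt (verit) divide_pos_pos)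
  obtain v where v: "\<And>t. v t \<in> U" "v \<in> borel_measurable (lebesgue_on {0..T})"
    "AE t in lebesgue_on {0..T}. v t = u t"
    using control_representative[OF u] by blast
  have inC: "y t \<in> C" if "trajectory g y" "y 0 = \<xi>" "t \<in> {0..T}" for y t
    using trajectory_stays[OF g large that(1) _ that(3)] \<xi> that(2) mem_C_if_E_le[OF g0] by (simp add: less_imp_le)
  have xt: "trajectory g x"
    using solves_trajectory[OF x] u by (simp add: controls_def)
  have x0: "x 0 = \<xi>" and acx: "abs_continuous_on_interval 0 T x" using x by (auto simp: solves_def)
  \<comment> \<open>Beyond the last step any element of \<open>U\<close> will do. Such values occur
    only outside \<open>[0, T)\<close>, but the step control has to remain in \<open>U\<close> there
    as well.\<close>
  have "\<exists>a. a \<in> U \<and> (j < N \<longrightarrow>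
      integral {real j * h..(real j + 1) * h} (\<lambda>s. f (x (real j * h), v s)) = h *\<^sub>R f (x (real j * h), a))" for j
  proof (cases "j < N")
    case True
    have le: "(real j + 1) * h \<le> real N * h" using True h by (intro mult_right_mono) auto
    have len: "(real j + 1) * h - real j * h = h" by (simp add: algebra_simps)
    have b: "0 \<le> real j * h" "real j * h < (real j + 1) * h" "(real j + 1) * h \<le> T" using le h by auto
    then have "x (real j * h) \<in> C" by (intro inC xt x0) auto
    from ex_averaged_control[OF this v(1,2) b] show ?thesis unfolding len by blast
  next
    case False
    then show ?thesis using U_nonempty by auto
  qed
  then obtain w where w: "\<And>j. w j \<in> U" and mean: "\<And>j. j < N \<Longrightarrow>
      integral {real j * h..(real j + 1) * h} (\<lambda>s. f (x (real j * h), v s)) = h *\<^sub>R f (x (real j * h), w j)"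
    by metis
  define uN where "uN t = w (nat \<lfloor>t / h\<rfloor>)" for t
  have "(norm (x t - y t))\<^sup>2 \<le> error_const R K * h" if y: "solves T f r \<psi> g \<xi> uN y" and t: "t \<in> {0..T}" for y t
  proof -
    have yt: "trajectory g y" by (rule solves_trajectory[OF y]) (simp add: uN_def w)
    have y0: "y 0 = \<xi>" and acy: "abs_continuous_on_interval 0 T y" using y by (auto simp: solves_def)
    have "AE t in lebesgue_on {0..T}.
        (x has_vector_derivative f (x t, u t) - G g (x t)) (at t within {0..T})"
      "AE t in lebesgue_on {0..T}.
        (y has_vector_derivative f (y t, uN t) - G g (y t)) (at t within {0..T})"
      using x y by (simp_all add: solves_def penalty_force_def)
    with v(3) have "AE t in lebesgue_on {0..T}.
        (x has_vector_derivative f (x t, v t) - G g (x t)) (at t within {0..T}) \<and>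
        (y has_vector_derivative f (y t, uN t) - G g (y t)) (at t within {0..T})"
      by eventually_elim simp
    then obtain Z where Z: "negligible Z" "\<forall>t\<in>{0..T} - Z.
        (x has_vector_derivative f (x t, v t) - G g (x t)) (at t within {0..T}) \<and>
        (y has_vector_derivative f (y t, uN t) - G g (y t)) (at t within {0..T})"
      by (subst (asm) AE_lebesgue_on_negligible_iff) auto
    show ?thesis
    proof (rule sampled_control_error[OF g0 N h_def v(1,2) w _ _ acx acy _ Z(1) _ _ mean _ _ R t])
      show "x t \<in> C" "y t \<in> C" if "t \<in> {0..T}" for t using inC xt yt x0 y0 that by auto
      show "integral {0..T} (\<lambda>t. E g (x t)) \<le> K" "integral {0..T} (\<lambda>t. E g (y t)) \<le> K"
        using K[OF xt] K[OF yt] x0 y0 \<xi> by auto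
    qed (use x0 y0 Z(2) in \<open>auto simp: uN_def\<close>)
  qed
  moreover have "uN \<in> pc_controls T U N"
    using step_control_mem_pc_controls[OF N w] by (simp add: uN_def[abs_def] h_def)
  moreover have "\<exists>xN. solves T f r \<psi> g \<xi> uN xN"
    using ex_solution_step_control[OF g large \<xi> N w] by (simp add: uN_def[abs_def] h_def)
  ultimately show ?thesis unfolding h_def by blast
qed

text \<open>On \<open>C_gamma\<close> both values of \<open>E\<close> are at most
  \<open>2 * M / \<eta>\<close>, so the general hypomonotonicity constant becomes
  \<open>8 * M * M\<psi> / \<eta>\<close>. With at least one constraint,
  \<open>\<beta> \<ge> 2\<close> covers it, and nothing bounds \<beta> from above.\<close>

lemma gradient_exp_psi_gamma_hypomonotone:
  assumes g: "g > 2 * M / \<eta>" and \<beta>: "\<beta> \<ge> 2"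
    and x: "x \<in> C_gamma r \<psi> M \<eta> g" and y: "y \<in> C_gamma r \<psi> M \<eta> g"
  shows "inner (gradient (\<lambda>z. exp (g * psi_gamma r \<psi> g z)) y
          - gradient (\<lambda>z. exp (g * psi_gamma r \<psi> g z)) x) (y - x)
       \<ge> - (4 * real r * \<beta> * M * M\<psi> / \<eta>) * (norm (y - x))\<^sup>2"
proof -
  have g0: "g > 0" using g M_pos \<eta>_pos by (smt (verit) divide_pos_pos)
  have E: "E g x \<le> 2 * M / \<eta>" "E g y \<le> 2 * M / \<eta>"
    using x y mem_C_gamma_iff[OF M_pos g0] by auto
  then have "x \<in> C" "y \<in> C" using mem_C_if_E_le[OF g0] g by auto
  from penalty_force_hypomonotone[OF g0 this]
  have "inner (G g y - G g x) (y - x) \<ge> - (2 * M\<psi> * (E g x + E g y)) * (norm (y - x))\<^sup>2" .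
  moreover have "2 * M\<psi> * (E g x + E g y) \<le> 4 * real r * \<beta> * M * M\<psi> / \<eta>"
  proof -
    have "2 * M\<psi> * (E g x + E g y) \<le> 2 * M\<psi> * (2 * M / \<eta> + 2 * M / \<eta>)"
      using E M\<psi>_pos by (intro mult_left_mono add_mono) auto
    also have "\<dots> = 2 * (4 * M * M\<psi> / \<eta>)" by (simp add: field_simps)
    also have "\<dots> \<le> (real r * \<beta>) * (4 * M * M\<psi> / \<eta>)"
      using mult_mono[of 1 "real r" 2 \<beta>] r_ge_1 \<beta> M_pos M\<psi>_pos \<eta>_pos by (intro mult_right_mono) auto
    finally show ?thesis by (simp add: mult_ac)
  qed
  then have "2 * M\<psi> * (E g x + E g y) * (norm (y - x))\<^sup>2
      \<le> 4 * real r * \<beta> * M * M\<psi> / \<eta> * (norm (y - x))\<^sup>2"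
    by (rule mult_right_mono) simp
  ultimately show ?thesis using g0 by (simp add: gradient_exp_psi_gamma)
qed

end

text \<open>With \<open>m = M + a * \<beta>\<close>, the quadratic Taylor term of the exponential
  beats the denominator: the leading coefficient is at least
  \<open>12 * Mh\<^sup>2 * T\<^sup>2 * m\<close>, which exceeds \<open>c\<close> for large \<beta>.
  The threshold in the choice of \<beta> is read off from this bound, and the two remaining factors
  are at least 1.\<close>

lemma ex_large_exponential_coefficient:
  fixes c :: real
  assumes T: "T > 0" and M: "M > 0" and a: "a > 0" and Mh: "Mh > 0"
  shows "\<exists>\<beta>\<ge>2. \<forall>h\<ge>0. c * h \<le> 2 * Mh\<^sup>2 * exp (6 * (M + a * \<beta>) * T) / (3 * (M + a * \<beta>))
        * (1 + 6 * (M + a * \<beta>) * h) * (1 + (M + a * \<beta>) * h) * h"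
proof -
  define \<beta> where "\<beta> = max 2 (c / (12 * Mh\<^sup>2 * T\<^sup>2 * a))"
  have b2: "\<beta> \<ge> 2" by (simp add: \<beta>_def)
  define m where "m = M + a * \<beta>"
  have m: "m > 0" using M a b2 by (simp add: m_def add_pos_pos)
  have d: "12 * Mh\<^sup>2 * T\<^sup>2 * a > 0" using Mh T a by simp
  have "c / (12 * Mh\<^sup>2 * T\<^sup>2 * a) \<le> \<beta>" by (simp add: \<beta>_def)
  then have "c \<le> 12 * Mh\<^sup>2 * T\<^sup>2 * (a * \<beta>)" using d by (simp add: pos_divide_le_eq mult_ac)
  also have "\<dots> \<le> 12 * Mh\<^sup>2 * T\<^sup>2 * m" using M Mh T by (intro mult_left_mono) (auto simp: m_def)
  also have "\<dots> = 2 * Mh\<^sup>2 * ((6 * m * T)\<^sup>2 / 2) / (3 * m)"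
    using m by (simp add: power2_eq_square field_simps)
  also have "\<dots> \<le> 2 * Mh\<^sup>2 * exp (6 * m * T) / (3 * m)"
  proof -
    have "(6 * m * T)\<^sup>2 / 2 \<le> exp (6 * m * T)"
    proof -
      have "0 \<le> 6 * m * T" using m T by simp
      with exp_lower_Taylor_quadratic[OF this] show ?thesis by linarith
    qed
    then show ?thesis using m by (intro divide_right_mono mult_left_mono) auto
  qed
  finally have c: "c \<le> 2 * Mh\<^sup>2 * exp (6 * m * T) / (3 * m)" .
  define q where "q = 2 * Mh\<^sup>2 * exp (6 * m * T) / (3 * m)"
  have q: "q \<ge> 0" using m by (simp add: q_def)
  have "c * h \<le> q * (1 + 6 * m * h) * (1 + m * h) * h" if h: "h \<ge> 0" for h
  proof -
    have "1 * 1 \<le> (1 + 6 * m * h) * (1 + m * h)" using m h by (intro mult_mono) auto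
    from mult_left_mono[OF this q] have "q \<le> q * ((1 + 6 * m * h) * (1 + m * h))" by simp
    with c have "c \<le> q * (1 + 6 * m * h) * (1 + m * h)" by (simp add: q_def mult.assoc)
    then show ?thesis using h by (rule mult_right_mono)
  qed
  with b2 show ?thesis unfolding q_def m_def by blast
qed

theorem proposition4p3:
  fixes T M \<eta> Mbar\<psi> M\<psi> :: real
    and f :: "(real ^ 'n) \<times> (real ^ 'm) \<Rightarrow> real ^ 'n"
    and U :: "(real ^ 'm) set"
    and r :: nat
    and \<psi> :: "nat \<Rightarrow> real ^ 'n \<Rightarrow> real"
    and x0 :: "real ^ 'n"
    and \<gamma> :: "nat \<Rightarrow> real"
  assumes "T > 0" and "U \<noteq> {}" and "r \<ge> 1" and "x0 \<in> constraint_set r \<psi>"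
    and f_cont: "continuous_on (constraint_set r \<psi> \<times> U) f"
    and "M > 0"
    and f_lip: "\<forall>u\<in>U. M-lipschitz_on UNIV (\<lambda>x. f (x, u))"
    and f_bound: "\<forall>x\<in>constraint_set r \<psi>. \<forall>u\<in>U. norm (f (x, u)) \<le> M"
    and f_convex: "\<forall>x. convex ((\<lambda>u. f (x, u)) ` U)"
    and "compact U"
    and "constraint_set r \<psi> \<noteq> {}"
    and \<psi>_C11: "\<forall>i\<in>{1..r}. C11 (\<psi> i)"
    and \<psi>_compact: "\<forall>i\<in>{1..r}. compact {x. \<psi> i x \<le> 0}"
    and \<psi>_connected: "CARD('n) > 1 \<longrightarrow> (\<forall>i\<in>{1..r}. connected (frontier {x. \<psi> i x \<le> 0}))"
    and \<psi>_convex: "CARD('n) = 1 \<longrightarrow> (\<forall>i\<in>{1..r}. convex {x. \<psi> i x \<le> 0})"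
    and "\<eta> > 0"
    and \<psi>_qual: "\<forall>c l. active r \<psi> c \<noteq> {} \<and> (\<forall>i\<in>active r \<psi> c. l i \<ge> 0) \<and>
                    (\<Sum>i\<in>active r \<psi> c. l i) = 1 \<longrightarrow>
                  norm (\<Sum>i\<in>active r \<psi> c. l i *\<^sub>R gradient (\<psi> i) c) > 2 * \<eta>"
    and "Mbar\<psi> \<ge> 2 * \<eta>"
    and grad_bound: "\<forall>i\<in>{1..r}. \<forall>x\<in>constraint_set r \<psi>. norm (gradient (\<psi> i) x) \<le> Mbar\<psi>"
    and "M\<psi> > 0"
    and grad_lip: "\<forall>i\<in>{1..r}. (2 * M\<psi>)-lipschitz_on (convex hull (constraint_set r \<psi>)) (gradient (\<psi> i))"
    and \<gamma>_large: "\<forall>k. \<gamma> k > 2 * M / \<eta>"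
    and \<gamma>_lim: "filterlim \<gamma> at_top sequentially"
  shows "\<exists>(k9 :: nat) (\<beta> :: real). \<beta> > 0 \<and>
    (\<forall>k\<ge>k9. \<forall>x\<in>C_gamma r \<psi> M \<eta> (\<gamma> k). \<forall>y\<in>C_gamma r \<psi> M \<eta> (\<gamma> k).
       (gradient (\<lambda>z. exp (\<gamma> k * psi_gamma r \<psi> (\<gamma> k) z)) y
          - gradient (\<lambda>z. exp (\<gamma> k * psi_gamma r \<psi> (\<gamma> k) z)) x) \<bullet> (y - x)
       \<ge> - (4 * real r * \<beta> * M * M\<psi> / \<eta>) * (norm (y - x))\<^sup>2) \<and>
    (\<forall>u\<in>controls T U. \<forall>k\<ge>k9. \<forall>x.
       solves T f r \<psi> (\<gamma> k) (initial_point r \<psi> M \<eta> M\<psi> x0 (\<gamma> k)) u x \<longrightarrow>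
       (\<forall>N\<ge>(1::nat). \<exists>uN\<in>pc_controls T U N.
          (\<exists>xN. solves T f r \<psi> (\<gamma> k) (initial_point r \<psi> M \<eta> M\<psi> x0 (\<gamma> k)) uN xN) \<and>
          (\<forall>xN. solves T f r \<psi> (\<gamma> k) (initial_point r \<psi> M \<eta> M\<psi> x0 (\<gamma> k)) uN xN \<longrightarrow>
             (let h = T / real N;
                  Mbar = M + 4 * real r * \<beta> * M * M\<psi> / \<eta>;
                  Mhat = M + 2 * M * Mbar\<psi> / \<eta>
              in \<forall>j\<in>{1..N}.
                   (norm (x (real j * h) - xN (real j * h)))\<^sup>2
                     \<le> 2 * Mhat\<^sup>2 * exp (6 * Mbar * T) / (3 * Mbar)
                         * (1 + 6 * Mbar * h) * (1 + Mbar * h) * h))))"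
proof -
  interpret penalized_system r \<psi> \<eta> Mbar\<psi> M\<psi> T M f U
    by unfold_locales (fact assms)+
  obtain g0 where g0: "\<And>g p. g \<ge> g0 \<Longrightarrow> p \<in> C \<Longrightarrow> E g p \<ge> 2 * M / \<eta> \<Longrightarrow> norm (G g p) \<ge> \<eta> * E g p"
    using norm_penalty_force_ge[of "2 * M / \<eta>"] M_pos \<eta>_pos by auto
  obtain K where K: "\<And>g x. g > 2 * M / \<eta> \<Longrightarrow>
      (\<And>p. p \<in> C \<Longrightarrow> E g p \<ge> 2 * M / \<eta> \<Longrightarrow> norm (G g p) \<ge> \<eta> * E g p) \<Longrightarrow>
      trajectory g x \<Longrightarrow> E g (x 0) < g \<Longrightarrow> integral {0..T} (\<lambda>t. E g (x t)) \<le> K"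
    using ex_integral_penalty_bound by metis
  obtain R where R: "\<And>p. p \<in> C \<Longrightarrow> norm p \<le> R"
    using compact_imp_bounded[OF compact_C] by (auto simp: bounded_iff)
  have \<gamma>_gt: "\<gamma> k > 2 * M / \<eta>" for k using \<gamma>_large by blast
  have "\<forall>\<^sub>F k in sequentially. \<gamma> k \<ge> g0 \<and> E (\<gamma> k) (initial_point r \<psi> M \<eta> M\<psi> x0 (\<gamma> k)) < \<gamma> k"
    using \<gamma>_lim eventually_E_initial_point_less[OF M_pos \<gamma>_gt \<gamma>_lim \<open>x0 \<in> C\<close>]
    by (intro eventually_conj) (auto simp: filterlim_at_top)
  then obtain k9 where k9: "\<And>k. k \<ge> k9 \<Longrightarrow> \<gamma> k \<ge> g0"
    "\<And>k. k \<ge> k9 \<Longrightarrow> E (\<gamma> k) (initial_point r \<psi> M \<eta> M\<psi> x0 (\<gamma> k)) < \<gamma> k"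
    unfolding eventually_sequentially by blast
  \<comment> \<open>In the claimed bound \<beta> enters only through \<open>Mbar\<close>, which is
    \<open>M + a * \<beta>\<close>; the constants \<open>K\<close> and \<open>R\<close> in
    \<open>error_const\<close> are already fixed and do not depend on it.\<close>
  define a where "a = 4 * real r * M * M\<psi> / \<eta>"
  have a: "a > 0" using r_ge_1 M_pos M\<psi>_pos \<eta>_pos by (simp add: a_def)
  define Mh where "Mh = M + 2 * M * Mbar\<psi> / \<eta>"
  have Mh: "Mh > 0" using M_pos Mbar\<psi>_pos \<eta>_pos by (simp add: Mh_def add_pos_pos)
  obtain \<beta> where \<beta>: "\<beta> \<ge> 2" and \<beta>_le: "\<forall>h\<ge>0. error_const R K * h
      \<le> 2 * Mh\<^sup>2 * exp (6 * (M + a * \<beta>) * T) / (3 * (M + a * \<beta>))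
        * (1 + 6 * (M + a * \<beta>) * h) * (1 + (M + a * \<beta>) * h) * h"
    using ex_large_exponential_coefficient[where c = "error_const R K", OF T_pos M_pos a Mh] by (elim exE conjE)
  have a_eq: "4 * real r * \<beta> * M * M\<psi> / \<eta> = a * \<beta>" by (simp add: a_def)
  show ?thesis
  proof (intro exI[of _ k9] exI[of _ \<beta>] conjI allI impI ballI)
    show "\<beta> > 0" using \<beta> by simp
    show "inner (gradient (\<lambda>z. exp (\<gamma> k * psi_gamma r \<psi> (\<gamma> k) z)) y
          - gradient (\<lambda>z. exp (\<gamma> k * psi_gamma r \<psi> (\<gamma> k) z)) x) (y - x)
       \<ge> - (4 * real r * \<beta> * M * M\<psi> / \<eta>) * (norm (y - x))\<^sup>2"
      if "x \<in> C_gamma r \<psi> M \<eta> (\<gamma> k)" "y \<in> C_gamma r \<psi> M \<eta> (\<gamma> k)" for k x y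
      by (rule gradient_exp_psi_gamma_hypomonotone[OF \<gamma>_gt \<beta> that])
    fix u k x and N :: nat
    assume u: "u \<in> controls T U" and k: "k \<ge> k9" and N: "N \<ge> 1"
      and x: "solves T f r \<psi> (\<gamma> k) (initial_point r \<psi> M \<eta> M\<psi> x0 (\<gamma> k)) u x"
    note large = g0[OF k9(1)[OF k]]
    obtain uN where uN: "uN \<in> pc_controls T U N"
      and ex: "\<exists>xN. solves T f r \<psi> (\<gamma> k) (initial_point r \<psi> M \<eta> M\<psi> x0 (\<gamma> k)) uN xN"
      and err: "\<And>xN t. solves T f r \<psi> (\<gamma> k) (initial_point r \<psi> M \<eta> M\<psi> x0 (\<gamma> k)) uN xN \<Longrightarrow> t \<in> {0..T} \<Longrightarrow>
        (norm (x t - xN t))\<^sup>2 \<le> error_const R K * (T / real N)"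
      using ex_sampled_control[OF \<gamma>_gt large K[OF \<gamma>_gt large] R k9(2)[OF k] u x N] by blast
    show "\<exists>uN\<in>pc_controls T U N.
          (\<exists>xN. solves T f r \<psi> (\<gamma> k) (initial_point r \<psi> M \<eta> M\<psi> x0 (\<gamma> k)) uN xN) \<and>
          (\<forall>xN. solves T f r \<psi> (\<gamma> k) (initial_point r \<psi> M \<eta> M\<psi> x0 (\<gamma> k)) uN xN \<longrightarrow>
             (let h = T / real N;
                  Mbar = M + 4 * real r * \<beta> * M * M\<psi> / \<eta>;
                  Mhat = M + 2 * M * Mbar\<psi> / \<eta>
              in \<forall>j\<in>{1..N}.
                   (norm (x (real j * h) - xN (real j * h)))\<^sup>2
                     \<le> 2 * Mhat\<^sup>2 * exp (6 * Mbar * T) / (3 * Mbar)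
                         * (1 + 6 * Mbar * h) * (1 + Mbar * h) * h))"
      unfolding Let_def a_eq Mh_def[symmetric]
    proof (intro bexI[OF _ uN] conjI ex allI impI ballI)
      fix xN j assume xN: "solves T f r \<psi> (\<gamma> k) (initial_point r \<psi> M \<eta> M\<psi> x0 (\<gamma> k)) uN xN"
        and j: "j \<in> {1..N}"
      have h: "T / real N \<ge> 0" using T_pos by simp
      have "real j * (T / real N) \<le> real N * (T / real N)"
        using j h by (intro mult_right_mono) auto
      moreover have "0 \<le> real j * (T / real N)" using h by (intro mult_nonneg_nonneg) auto
      ultimately have "real j * (T / real N) \<in> {0..T}" using N by simp
      from order_trans[OF err[OF xN this] \<beta>_le[rule_format, OF h]]
      show "(norm (x (real j * (T / real N)) - xN (real j * (T / real N))))\<^sup>2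
          \<le> 2 * Mh\<^sup>2 * exp (6 * (M + a * \<beta>) * T) / (3 * (M + a * \<beta>))
            * (1 + 6 * (M + a * \<beta>) * (T / real N)) * (1 + (M + a * \<beta>) * (T / real N)) * (T / real N)" .
    qed
  qed
qed

end
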